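(* For $n=4$ and for $n=6$, the free spectrahedron $\mathcal D_{F^{[3]}}$ has a free extreme point at level $n$. Consequently $\mathcal D_{F^{[3]}}$ is not the minimal matrix convex set over its first level (the closed unit ball $\overline{\mathbb B_3}$), and $\mathcal W(F^{[3]})$ is not the maximal matrix convex set over $\overline{\mathbb B_3}$. Explicitly, for a tuple $C=(C_1,C_2,C_3)$ of complex symmetric $(n/2)\times(n/2)$ matrices put $$X=\left(\begin{bmatrix}0&C_1\\ \overline{C_1}&0\end{bmatrix},\begin{bmatrix}0&C_2\\ \overline{C_2}&0\end{bmatrix},\begin{bmatrix}0&C_3\\ \overline{C_3}&0\end{bmatrix}\right)\in SM_n(\mathbb C)^3.$$ For $n=4$ and $C=\tfrac12\left(\begin{bmatrix}1+\tfrac1{\sqrt3}&0\\0&-1+\sqrt3\end{bmatrix},\begin{bmatrix}0&1\\1&0\end{bmatrix},\begin{bmatrix}-i+\tfrac{2i}{\sqrt3}&0\\0&-i\end{bmatrix}\right)$, and for $n=6$ with $\alpha=\sqrt2-1$ and $C_1=\tfrac14\begin{bmatrix}\alpha+1&0&-\alpha\\0&\alpha+1&-\alpha\\-\alpha&-\alpha&\alpha+1\end{bmatrix}$, $C_2=\tfrac14\begin{bmatrix}-4\sqrt{2\alpha}&0&0\\0&4\sqrt{2\alpha}&0\\0&0&0\end{bmatrix}$, $C_3=\tfrac{i}4\begin{bmatrix}0&3\alpha-1&\alpha\\3\alpha-1&0&\alpha\\\alpha&\alpha&3-\alpha\end{bmatrix}$, the tuple $X$ belongs to $\mathcal D_{F^{[3]}}(n)$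 and is a free extreme point of $\mathcal D_{F^{[3]}}$.
   Context: $F^{[3]}=(\sigma_z\otimes\sigma_z,\sigma_x\otimes\sigma_z,I_2\otimes\sigma_x)$ with $\sigma_z=\begin{bmatrix}1&0\\0&-1\end{bmatrix}$, $\sigma_x=\begin{bmatrix}0&1\\1&0\end{bmatrix}$ (pairwise anticommuting self-adjoint unitaries). For a self-adjoint matrix tuple $A$, $\mathcal D_A=\bigcup_n\mathcal D_A(n)$, $\mathcal D_A(n)=\{X\in SM_n(\mathbb C)^g: I-\sum_iA_i\otimes X_i\succeq0\}$; the matrix range $\mathcal W(A)$ is the set of all images $\phi(A)$ under unital completely positive maps into matrix algebras. A matrix convex set is a graded set closed under matrix convex combinations $\sum_iV_i^*X^{(i)}V_i$ with $\sum_iV_i^*V_i=I$. A point $X\in K(n)$ is a free extreme point of a matrix convex set $K$ if whenever $X=\sum_iV_i^*X^{(i)}V_i$ is a matrix convex combination of points of $K$ with all $V_i\ne0$, each $X^{(i)}$ is unitarily equivalent to $X$ or to $X\oplus Z$ for some $Z\in K$. For compact convex $C\subseteq\mathbb R^g$, the minimal (maximal) matrix convex set over $C$ is the smallest (largest) matrix convex set whose first level equals $C$. $\overline{C_j}$ denotes entrywise complex conjugation. *)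

theory Defs
  imports "HOL-Analysis.Analysis" "Jordan_Normal_Form.Schur_Decomposition"
begin

definition selfadj :: "nat \<Rightarrow> complex mat \<Rightarrow> bool" where
  "selfadj n A \<longleftrightarrow> A \<in> carrier_mat n n \<and> mat_adjoint A = A"

definition psd :: "nat \<Rightarrow> complex mat \<Rightarrow> bool" where
  "psd n A \<longleftrightarrow> selfadj n A \<and>
     (\<forall>v \<in> carrier_vec n. 0 \<le> Re ((A *\<^sub>v v) \<bullet>c v))"

definition unitary :: "nat \<Rightarrow> complex mat \<Rightarrow> bool" where
  "unitary n U \<longleftrightarrow> U \<in> carrier_mat n n \<and> mat_adjoint U * U = 1\<^sub>m n \<and> U * mat_adjoint U = 1\<^sub>m n"

definition kron :: "complex mat \<Rightarrow> complex mat \<Rightarrow> complex mat" where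
  "kron A B = mat (dim_row A * dim_row B) (dim_col A * dim_col B)
     (\<lambda>(i,j). A $$ (i div dim_row B, j div dim_col B) * B $$ (i mod dim_row B, j mod dim_col B))"

definition msum :: "nat \<Rightarrow> nat \<Rightarrow> ('i \<Rightarrow> complex mat) \<Rightarrow> 'i set \<Rightarrow> complex mat" where
  "msum n m f I = mat n m (\<lambda>(a,b). \<Sum>i\<in>I. f i $$ (a,b))"

definition conj_mat :: "complex mat \<Rightarrow> complex mat" where
  "conj_mat A = map_mat cnj A"

text \<open>A g-tuple of matrices is a list of length g. A graded set is K :: nat => tuple set,
  K n being its level n (levels n >= 1; level 0 is unused and required to be empty).\<close>

definition SM_tuple :: "nat \<Rightarrow> nat \<Rightarrow> complex mat list \<Rightarrow> bool" where
  "SM_tuple g n X \<longleftrightarrow> length X = g \<and> (\<forall>j<g. selfadj n (X ! j))"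

definition mconv_comb :: "nat \<Rightarrow> nat \<Rightarrow> 'i set \<Rightarrow> ('i \<Rightarrow> complex mat) \<Rightarrow> ('i \<Rightarrow> complex mat list) \<Rightarrow> complex mat list" where
  "mconv_comb g n I V Y = map (\<lambda>j. msum n n (\<lambda>i. mat_adjoint (V i) * (Y i ! j) * V i) I) [0..<g]"

definition mconv_data :: "nat \<Rightarrow> (nat \<Rightarrow> complex mat list set) \<Rightarrow> nat \<Rightarrow> 'i set \<Rightarrow> ('i \<Rightarrow> nat)
     \<Rightarrow> ('i \<Rightarrow> complex mat) \<Rightarrow> ('i \<Rightarrow> complex mat list) \<Rightarrow> bool" where
  "mconv_data g K n I m V Y \<longleftrightarrow> finite I \<and>
     (\<forall>i\<in>I. 1 \<le> m i \<and> Y i \<in> K (m i) \<and> V i \<in> carrier_mat (m i) n) \<and>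
     msum n n (\<lambda>i. mat_adjoint (V i) * V i) I = 1\<^sub>m n"

definition matrix_convex :: "nat \<Rightarrow> (nat \<Rightarrow> complex mat list set) \<Rightarrow> bool" where
  "matrix_convex g K \<longleftrightarrow> K 0 = {} \<and>
     (\<forall>n\<ge>1. \<forall>X\<in>K n. SM_tuple g n X) \<and>
     (\<forall>n\<ge>1. \<forall>(I::nat set) m V Y. mconv_data g K n I m V Y \<longrightarrow> mconv_comb g n I V Y \<in> K n)"

definition unit_equiv :: "nat \<Rightarrow> complex mat list \<Rightarrow> complex mat list \<Rightarrow> bool" where
  "unit_equiv n Y X \<longleftrightarrow> length Y = length X \<and> (\<forall>j<length X. X ! j \<in> carrier_mat n n) \<and>
     (\<exists>U. unitary n U \<and> (\<forall>j<length X. Y ! j = mat_adjoint U * X ! j * U))"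

definition tuple_dsum :: "complex mat list \<Rightarrow> complex mat list \<Rightarrow> complex mat list" where
  "tuple_dsum X Z = map2 (\<lambda>A B. four_block_mat A (0\<^sub>m (dim_row A) (dim_col B)) (0\<^sub>m (dim_row B) (dim_col A)) B) X Z"

definition free_extreme :: "nat \<Rightarrow> (nat \<Rightarrow> complex mat list set) \<Rightarrow> nat \<Rightarrow> complex mat list \<Rightarrow> bool" where
  "free_extreme g K n X \<longleftrightarrow> X \<in> K n \<and>
     (\<forall>(I::nat set) m V Y. mconv_data g K n I m V Y \<and> (\<forall>i\<in>I. V i \<noteq> 0\<^sub>m (m i) n) \<and>
        X = mconv_comb g n I V Y \<longrightarrow>
        (\<forall>i\<in>I. unit_equiv (m i) (Y i) X \<or>
           (\<exists>k\<ge>1. \<exists>Z\<in>K k. unit_equiv (m i) (Y i) (tuple_dsum X Z))))"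

definition free_spec :: "nat \<Rightarrow> complex mat list \<Rightarrow> nat \<Rightarrow> complex mat list set" where
  "free_spec d A n = (if n = 0 then {} else
     {X. SM_tuple (length A) n X \<and>
         psd (d * n) (1\<^sub>m (d * n) - msum (d * n) (d * n) (\<lambda>j. kron (A ! j) (X ! j)) {..<length A})})"

text \<open>Ampliation id_k (x) phi applied to a kd x kd block matrix (blocks of size d).\<close>
definition amplify :: "nat \<Rightarrow> nat \<Rightarrow> nat \<Rightarrow> (complex mat \<Rightarrow> complex mat) \<Rightarrow> complex mat \<Rightarrow> complex mat" where
  "amplify k d n phi M = mat (k * n) (k * n)
     (\<lambda>(i,j). phi (mat d d (\<lambda>(p,q). M $$ ((i div n) * d + p, (j div n) * d + q))) $$ (i mod n, j mod n))"

definition ucp :: "nat \<Rightarrow> nat \<Rightarrow> (complex mat \<Rightarrow> complex mat) \<Rightarrow> bool" where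
  "ucp d n phi \<longleftrightarrow>
     (\<forall>A\<in>carrier_mat d d. phi A \<in> carrier_mat n n) \<and>
     (\<forall>A\<in>carrier_mat d d. \<forall>B\<in>carrier_mat d d. phi (A + B) = phi A + phi B) \<and>
     (\<forall>c. \<forall>A\<in>carrier_mat d d. phi (c \<cdot>\<^sub>m A) = c \<cdot>\<^sub>m phi A) \<and>
     phi (1\<^sub>m d) = 1\<^sub>m n \<and>
     (\<forall>k. \<forall>M\<in>carrier_mat (k * d) (k * d). psd (k * d) M \<longrightarrow> psd (k * n) (amplify k d n phi M))"

definition matrix_range :: "nat \<Rightarrow> complex mat list \<Rightarrow> nat \<Rightarrow> complex mat list set" where
  "matrix_range d A n = (if n = 0 then {} else {map phi A | phi. ucp d n phi})"

text \<open>Level 1 of a graded set identified with a subset of R^g (points as real lists).\<close>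
definition lift1 :: "real list set \<Rightarrow> complex mat list set" where
  "lift1 C = (\<lambda>x. map (\<lambda>t. mat 1 1 (\<lambda>_. complex_of_real t)) x) ` C"

definition is_min_mcs :: "nat \<Rightarrow> real list set \<Rightarrow> (nat \<Rightarrow> complex mat list set) \<Rightarrow> bool" where
  "is_min_mcs g C K \<longleftrightarrow> matrix_convex g K \<and> K 1 = lift1 C \<and>
     (\<forall>K'. matrix_convex g K' \<and> K' 1 = lift1 C \<longrightarrow> (\<forall>n. K n \<subseteq> K' n))"

definition is_max_mcs :: "nat \<Rightarrow> real list set \<Rightarrow> (nat \<Rightarrow> complex mat list set) \<Rightarrow> bool" where
  "is_max_mcs g C K \<longleftrightarrow> matrix_convex g K \<and> K 1 = lift1 C \<and>
     (\<forall>K'. matrix_convex g K' \<and> K' 1 = lift1 C \<longrightarrow> (\<forall>n. K' n \<subseteq> K n))"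

definition ball3 :: "real list set" where
  "ball3 = {x. length x = 3 \<and> (\<Sum>t\<leftarrow>x. t\<^sup>2) \<le> 1}"

definition sigma_z :: "complex mat" where
  "sigma_z = mat_of_rows_list 2 [[1, 0], [0, -1]]"
definition sigma_x :: "complex mat" where
  "sigma_x = mat_of_rows_list 2 [[0, 1], [1, 0]]"

definition F3 :: "complex mat list" where
  "F3 = [kron sigma_z sigma_z, kron sigma_x sigma_z, kron (1\<^sub>m 2) sigma_x]"

definition Xof :: "nat \<Rightarrow> complex mat list \<Rightarrow> complex mat list" where
  "Xof k C = map (\<lambda>Cj. four_block_mat (0\<^sub>m k k) Cj (conj_mat Cj) (0\<^sub>m k k)) C"

definition C4 :: "complex mat list" where
  "C4 = map (\<lambda>M. (1/2) \<cdot>\<^sub>m M)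
    [mat_of_rows_list 2 [[1 + 1 / sqrt 3, 0], [0, -1 + sqrt 3]],
     mat_of_rows_list 2 [[0, 1], [1, 0]],
     mat_of_rows_list 2 [[-\<i> + 2 * \<i> / sqrt 3, 0], [0, -\<i>]]]"

definition alpha6 :: real where "alpha6 = sqrt 2 - 1"

definition C6 :: "complex mat list" where
  "C6 = (let a = complex_of_real alpha6; s = complex_of_real (sqrt (2 * alpha6)) in
    [(1/4) \<cdot>\<^sub>m mat_of_rows_list 3 [[a + 1, 0, -a], [0, a + 1, -a], [-a, -a, a + 1]],
     (1/4) \<cdot>\<^sub>m mat_of_rows_list 3 [[-4 * s, 0, 0], [0, 4 * s, 0], [0, 0, 0]],
     (\<i>/4) \<cdot>\<^sub>m mat_of_rows_list 3 [[0, 3 * a - 1, a], [3 * a - 1, 0, a], [a, a, 3 - a]]])"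

end

(* F3 is unitarily equivalent to the direct sum of the Pauli triple and its complex conjugate, so X
   lies in the free spectrahedron iff two Hermitian forms in pairs of vectors, one for each sign of
   the imaginary unit, are nonnegative. If X = sum V_i* Y_i V_i, then V_i maps the kernels of the
   forms of X into those of Y_i. If the kernels are large enough (X is an Arveson extreme point),
   this forces Y_i V_i = V_i X; if X is moreover irreducible, V_i is a multiple of an isometry and
   its range reduces Y_i, so Y_i is X or X + Z. For the two explicit tuples each form comes from a
   real contraction T with I - T* T of rank one, and the extremality is a linear system over
   Q(sqrt 3), respectively Q(sqrt (2 sqrt 2 - 2)).

   The points without a nonzero intertwiner to X form a smaller matrix convex set with the same
   first level, so the free spectrahedron is not minimal. The matrix range is not maximal because
   there is an indecomposable positive map from 2 by 2 to 4 by 4 matrices: its values at the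
   Pauli matrices lie in the maximal set over the ball, but they are not a ucp image of F3, since the
   map is negative on an entangled state with positive partial transpose. *)

theory Submission
  imports Defs
begin

section \<open>Matrices acting on functions\<close>

text \<open>Rigidity rests on a count. If the defect of the corner T has rank one, each of the two
  forms has a kernel of dimension n - 1, and every kernel vector imposes two equations on three
  unknown rows of length n: 4 (n - 1) equations in 3 n unknowns, 12 in 12 for n = 4 and 20 in 18 for
  n = 6. One condition serves both signs: the first two blocks of X are real symmetric and the third
  is i times a real symmetric one, so the corners of the two forms are real and transposes of each
  other.

  The size 4 in the argument for the matrix range is forced. The maximal set over the ball consists
  of the values of unital positive maps at the Pauli matrices. A ucp map on F3 sees the Pauli
  matrices and their transposes side by side, so its values are those of a decomposable map. By
  Stormer and Woronowicz all positive maps from 2 by 2 to n by n matrices with n at most 3 are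
  decomposable. A 2 by 4 state with positive partial transpose pairs nonnegatively with every
  decomposable map; the block positive form violates this inequality.\<close>

definition act :: "nat \<Rightarrow> complex mat \<Rightarrow> (nat \<Rightarrow> complex) \<Rightarrow> nat \<Rightarrow> complex" where
  "act n A x i = (\<Sum>k<n. A $$ (i,k) * x k)"

text \<open>Vectors are plain functions on \<open>nat\<close> of which only the first n values
  count. Blocks and halves of a vector are then just reindexed functions and carry no dimension
  conditions.\<close>

definition ip :: "nat \<Rightarrow> (nat \<Rightarrow> complex) \<Rightarrow> (nat \<Rightarrow> complex) \<Rightarrow> complex" where
  "ip n x y = (\<Sum>i<n. x i * cnj (y i))"

lemma ip_cong: "(\<And>i. i < n \<Longrightarrow> x i = x' i) \<Longrightarrow> (\<And>i. i < n \<Longrightarrow> y i = y' i) \<Longrightarrow> ip n x y = ip n x' y'"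
  unfolding ip_def by (rule sum.cong) auto

lemma act_cong: "(\<And>k. k < n \<Longrightarrow> x k = x' k) \<Longrightarrow> act n A x i = act n A x' i"
  unfolding act_def by (rule sum.cong) auto

lemma act_add: "act n A (\<lambda>k. x k + y k) i = act n A x i + act n A y i"
  by (simp add: act_def algebra_simps sum.distrib)

lemma act_diff: "act n A (\<lambda>k. x k - y k) i = act n A x i - act n A y i"
  by (simp add: act_def algebra_simps sum_subtractf)

lemma act_minus: "act n A (\<lambda>k. - x k) i = - act n A x i"
  by (simp add: act_def sum_negf)

lemma act_scale: "act n A (\<lambda>k. c * x k) i = c * act n A x i"
  by (simp add: act_def sum_distrib_left mult.left_commute)

lemmas act_lin = act_add act_diff act_minus act_scale

lemma ip_add_left: "ip n (\<lambda>k. x k + y k) z = ip n x z + ip n y z"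
  by (simp add: ip_def algebra_simps sum.distrib)
lemma ip_diff_left: "ip n (\<lambda>k. x k - y k) z = ip n x z - ip n y z"
  by (simp add: ip_def algebra_simps sum_subtractf)
lemma ip_minus_left: "ip n (\<lambda>k. - x k) z = - ip n x z"
  by (simp add: ip_def sum_negf)
lemma ip_scale_left: "ip n (\<lambda>k. c * x k) z = c * ip n x z"
  by (simp add: ip_def sum_distrib_left mult.assoc)
lemma ip_add_right: "ip n z (\<lambda>k. x k + y k) = ip n z x + ip n z y"
  by (simp add: ip_def algebra_simps sum.distrib)
lemma ip_diff_right: "ip n z (\<lambda>k. x k - y k) = ip n z x - ip n z y"
  by (simp add: ip_def algebra_simps sum_subtractf)
lemma ip_minus_right: "ip n z (\<lambda>k. - x k) = - ip n z x"
  by (simp add: ip_def sum_negf)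
lemma ip_scale_right: "ip n z (\<lambda>k. c * x k) = cnj c * ip n z x"
  by (simp add: ip_def sum_distrib_left mult.left_commute)

lemmas ip_lin = ip_add_left ip_diff_left ip_minus_left ip_scale_left
  ip_add_right ip_diff_right ip_minus_right ip_scale_right

lemma cnj_ip: "cnj (ip n x y) = ip n y x"
  by (simp add: ip_def mult.commute)

lemma ip_self: "ip n x x = complex_of_real (\<Sum>i<n. (cmod (x i))\<^sup>2)"
  by (simp only: ip_def complex_norm_square of_real_sum)

lemma ip_self_nonneg: "0 \<le> Re (ip n x x)"
  unfolding ip_self by (simp add: sum_nonneg)

lemma ip_self_zero: assumes "Re (ip n x x) = 0" "i < n" shows "x i = 0"
proof -
  have "(\<Sum>i<n. (cmod (x i))\<^sup>2) = 0" using assms(1) unfolding ip_self by simp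
  then have "(cmod (x i))\<^sup>2 = 0"
    using assms(2) by (subst (asm) sum_nonneg_eq_0_iff) auto
  then show ?thesis by simp
qed

section \<open>Adjoints, products and sums of matrices in terms of \<open>act\<close> and
  \<open>ip\<close>\<close>

lemma adjoint_dim [simp]:
  "dim_row (mat_adjoint A) = dim_col A" "dim_col (mat_adjoint A) = dim_row A"
  by (auto simp: mat_adjoint_def)

lemma adjoint_carrier: "A \<in> carrier_mat m n \<Longrightarrow> mat_adjoint A \<in> carrier_mat n m"
  by (rule carrier_matI) simp_all

lemma adjoint_index [simp]:
  fixes A :: "complex mat"
  assumes "i < dim_col A" "j < dim_row A"
  shows "mat_adjoint A $$ (i,j) = cnj (A $$ (j,i))"
  using assms by (simp add: mat_adjoint_def mat_of_rows_index)

lemma adjoint_adjoint [simp]: "mat_adjoint (mat_adjoint A) = (A :: complex mat)"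
  by (rule eq_matI) auto

lemma mult_index:
  assumes "A \<in> carrier_mat r m" "B \<in> carrier_mat m n" "i < r" "j < n"
  shows "(A * B) $$ (i,j) = (\<Sum>k<m. A $$ (i,k) * B $$ (k,j))"
  using assms by (simp add: scalar_prod_def lessThan_atLeast0)

lemma adjoint_mult:
  fixes A B :: "complex mat"
  assumes A: "A \<in> carrier_mat r m" and B: "B \<in> carrier_mat m n"
  shows "mat_adjoint (A * B) = mat_adjoint B * mat_adjoint A"
proof (rule eq_matI)
  fix i j assume "i < dim_row (mat_adjoint B * mat_adjoint A)" "j < dim_col (mat_adjoint B * mat_adjoint A)"
  then have ij: "i < n" "j < r" using A B by auto
  have "mat_adjoint (A * B) $$ (i,j) = cnj ((A * B) $$ (j,i))" using ij A B by simp
  also have "\<dots> = (\<Sum>k<m. cnj (A $$ (j,k)) * cnj (B $$ (k,i)))"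
    using mult_index[OF A B ij(2,1)] by simp
  also have "\<dots> = (mat_adjoint B * mat_adjoint A) $$ (i,j)"
    using mult_index[OF adjoint_carrier[OF B] adjoint_carrier[OF A] ij] ij A B
    by (auto intro!: sum.cong)
  finally show "mat_adjoint (A * B) $$ (i,j) = (mat_adjoint B * mat_adjoint A) $$ (i,j)" .
qed (use A B in auto)

lemma act_mult:
  assumes "A \<in> carrier_mat r m" "B \<in> carrier_mat m n" "i < r"
  shows "act n (A * B) x i = act m A (act n B x) i"
proof -
  have "act n (A * B) x i = (\<Sum>k<n. \<Sum>p<m. A $$ (i,p) * B $$ (p,k) * x k)"
    unfolding act_def by (rule sum.cong) (simp_all add: mult_index[OF assms(1,2,3)] sum_distrib_right)
  also have "\<dots> = (\<Sum>p<m. \<Sum>k<n. A $$ (i,p) * B $$ (p,k) * x k)" by (rule sum.swap)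
  also have "\<dots> = act m A (act n B x) i"
    by (simp add: act_def sum_distrib_left mult.assoc)
  finally show ?thesis .
qed

lemma act_one: "i < n \<Longrightarrow> act n (1\<^sub>m n) x i = x i"
proof -
  assume i: "i < n"
  have "act n (1\<^sub>m n) x i = (\<Sum>k<n. if k = i then x k else 0)"
    unfolding act_def by (rule sum.cong) (use i in auto)
  then show ?thesis using i by simp
qed

lemma ip_adjoint:
  assumes V: "V \<in> carrier_mat m n"
  shows "ip n (act m (mat_adjoint V) z) y = ip m z (act n V y)"
proof -
  have "ip n (act m (mat_adjoint V) z) y = (\<Sum>i<n. \<Sum>p<m. cnj (V $$ (p,i)) * z p * cnj (y i))"
    unfolding ip_def act_def by (intro sum.cong) (use V in \<open>auto simp: sum_distrib_right\<close>)
  also have "\<dots> = (\<Sum>p<m. \<Sum>i<n. cnj (V $$ (p,i)) * z p * cnj (y i))" by (rule sum.swap)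
  also have "\<dots> = ip m z (act n V y)"
    by (simp add: ip_def act_def sum_distrib_left mult_ac)
  finally show ?thesis .
qed

lemma ip_selfadj:
  assumes "selfadj n A"
  shows "ip n (act n A x) y = ip n x (act n A y)"
  using ip_adjoint[of A n n x y] assms by (simp add: selfadj_def)

lemma ip_sandwich:
  assumes A: "A \<in> carrier_mat m m" and V: "V \<in> carrier_mat m n"
  shows "ip n (act n (mat_adjoint V * A * V) x) y = ip m (act m A (act n V x)) (act n V y)"
proof -
  note V' = adjoint_carrier[OF V]
  have "act n (mat_adjoint V * A * V) x i = act m (mat_adjoint V) (act m A (act n V x)) i" if i: "i < n" for i
  proof -
    have "act n (mat_adjoint V * A * V) x i = act n (mat_adjoint V * (A * V)) x i"
      by (simp only: assoc_mult_mat[OF V' A V])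
    also have "\<dots> = act m (mat_adjoint V) (act n (A * V) x) i"
      by (rule act_mult[OF V' mult_carrier_mat[OF A V] i])
    also have "\<dots> = act m (mat_adjoint V) (act m A (act n V x)) i"
      by (rule act_cong) (rule act_mult[OF A V])
    finally show ?thesis .
  qed
  then have "ip n (act n (mat_adjoint V * A * V) x) y
      = ip n (act m (mat_adjoint V) (act m A (act n V x))) y"
    by (intro ip_cong) simp_all
  then show ?thesis by (simp add: ip_adjoint[OF V])
qed

lemma act_msum: "i < n \<Longrightarrow> act n (msum n n f I) x i = (\<Sum>j\<in>I. act n (f j) x i)"
proof -
  assume i: "i < n"
  have "act n (msum n n f I) x i = (\<Sum>k<n. \<Sum>j\<in>I. f j $$ (i,k) * x k)"
    unfolding act_def msum_def by (rule sum.cong) (use i in \<open>auto simp: sum_distrib_right\<close>)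
  also have "\<dots> = (\<Sum>j\<in>I. act n (f j) x i)" unfolding act_def by (rule sum.swap)
  finally show ?thesis .
qed

lemma ip_msum: "ip n (act n (msum n n f I) x) y = (\<Sum>j\<in>I. ip n (act n (f j) x) y)"
proof -
  have "ip n (act n (msum n n f I) x) y = (\<Sum>i<n. \<Sum>j\<in>I. act n (f j) x i * cnj (y i))"
    unfolding ip_def by (rule sum.cong) (auto simp: act_msum sum_distrib_right)
  also have "\<dots> = (\<Sum>j\<in>I. ip n (act n (f j) x) y)" unfolding ip_def by (rule sum.swap)
  finally show ?thesis .
qed

lemma selfadj_sandwich:
  assumes "selfadj m A" "V \<in> carrier_mat m n"
  shows "selfadj n (mat_adjoint V * A * V)"
proof -
  have A: "A \<in> carrier_mat m m" "mat_adjoint A = A" using assms by (auto simp: selfadj_def)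
  note V' = adjoint_carrier[OF assms(2)]
  have "mat_adjoint (mat_adjoint V * A * V) = mat_adjoint V * (mat_adjoint A * mat_adjoint (mat_adjoint V))"
    using adjoint_mult[OF mult_carrier_mat[OF V' A(1)] assms(2)] adjoint_mult[OF V' A(1)] by simp
  then show ?thesis using A V' assms(2) by (simp add: selfadj_def assoc_mult_mat[OF V' A(1) assms(2)])
qed

lemma selfadj_entry: "selfadj n A \<longleftrightarrow> A \<in> carrier_mat n n \<and> (\<forall>i<n. \<forall>j<n. cnj (A $$ (j,i)) = A $$ (i,j))"
proof
  assume "selfadj n A"
  then have A: "A \<in> carrier_mat n n" "mat_adjoint A = A" by (auto simp: selfadj_def)
  have "cnj (A $$ (j,i)) = A $$ (i,j)" if "i < n" "j < n" for i j
    using adjoint_index[of i A j] A that by simp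
  with A show "A \<in> carrier_mat n n \<and> (\<forall>i<n. \<forall>j<n. cnj (A $$ (j,i)) = A $$ (i,j))" by blast
next
  assume r: "A \<in> carrier_mat n n \<and> (\<forall>i<n. \<forall>j<n. cnj (A $$ (j,i)) = A $$ (i,j))"
  have "mat_adjoint A = A" by (rule eq_matI) (use r in auto)
  with r show "selfadj n A" by (simp add: selfadj_def)
qed

lemma selfadj_msum:
  assumes "\<And>i. i \<in> I \<Longrightarrow> selfadj n (f i)"
  shows "selfadj n (msum n n f I)"
  unfolding selfadj_entry using assms unfolding selfadj_entry by (auto simp: msum_def intro!: sum.cong)

text \<open>\<open>pauli1\<close> and \<open>pauli2\<close> are the two components of the Pauli
  pencil of X at the pair (x, y), with the third Pauli matrix written as [[0, e], [-e, 0]]. The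
  choices e = i and e = -i differ by complex conjugation of the Pauli matrices.\<close>

definition pauli1 :: "complex \<Rightarrow> nat \<Rightarrow> complex mat list \<Rightarrow> (nat \<Rightarrow> complex) \<Rightarrow> (nat \<Rightarrow> complex) \<Rightarrow> nat \<Rightarrow> complex" where
  "pauli1 e n X x y = (\<lambda>i. x i - act n (X!0) x i - act n (X!1) y i - e * act n (X!2) y i)"

definition pauli2 :: "complex \<Rightarrow> nat \<Rightarrow> complex mat list \<Rightarrow> (nat \<Rightarrow> complex) \<Rightarrow> (nat \<Rightarrow> complex) \<Rightarrow> nat \<Rightarrow> complex" where
  "pauli2 e n X x y = (\<lambda>i. y i + act n (X!0) y i - act n (X!1) x i + e * act n (X!2) x i)"

definition pform :: "complex \<Rightarrow> nat \<Rightarrow> complex mat list \<Rightarrow> (nat \<Rightarrow> complex) \<Rightarrow> (nat \<Rightarrow> complex) \<Rightarrow>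
    (nat \<Rightarrow> complex) \<Rightarrow> (nat \<Rightarrow> complex) \<Rightarrow> complex" where
  "pform e n X x y x' y' = ip n (pauli1 e n X x y) x' + ip n (pauli2 e n X x y) y'"

lemma pform_expand: "pform e n X x y x' y' = ip n x x' + ip n y y'
   - ip n (act n (X!0) x) x' + ip n (act n (X!0) y) y'
   - ip n (act n (X!1) y) x' - ip n (act n (X!1) x) y'
   - e * ip n (act n (X!2) y) x' + e * ip n (act n (X!2) x) y'"
  unfolding pform_def pauli1_def pauli2_def by (simp add: ip_lin)

lemma pform_hermitian:
  assumes "SM_tuple 3 n X" "cnj e = - e"
  shows "cnj (pform e n X x y x' y') = pform e n X x' y' x y"
proof -
  have "selfadj n (X!0)" "selfadj n (X!1)" "selfadj n (X!2)" using assms by (auto simp: SM_tuple_def)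
  note h = this[THEN ip_selfadj]
  show ?thesis unfolding pform_expand by (simp del: One_nat_def add: cnj_ip h assms(2))
qed

text \<open>Let L be the pencil and v = (x, y) a zero of the nonnegative form. Along v + t L v the
  form has derivative 2 |L v|^2 at t = 0 and value 0 there, so L v = 0.\<close>

lemma pform_psd_kernel:
  assumes X: "SM_tuple 3 n X" and e: "cnj e = - e"
    and psd: "\<And>x y. 0 \<le> Re (pform e n X x y x y)"
    and z: "Re (pform e n X x y x y) = 0" and i: "i < n"
  shows "pauli1 e n X x y i = 0 \<and> pauli2 e n X x y i = 0"
proof -
  define p where "p = pauli1 e n X x y"
  define q where "q = pauli2 e n X x y"
  define N where "N = Re (pform e n X x y p q)"
  define C where "C = Re (pform e n X p q p q)"
  have N: "N = Re (ip n p p) + Re (ip n q q)" by (simp add: N_def pform_def p_def q_def)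
  have N2: "Re (pform e n X p q x y) = N"
    using arg_cong[OF pform_hermitian[OF X e, of x y p q], of Re] by (simp add: N_def)
  have quad: "0 \<le> 2 * t * N + t\<^sup>2 * C" for t :: real
  proof -
    have "pform e n X (\<lambda>i. x i + complex_of_real t * p i) (\<lambda>i. y i + complex_of_real t * q i)
        (\<lambda>i. x i + complex_of_real t * p i) (\<lambda>i. y i + complex_of_real t * q i)
      = pform e n X x y x y + complex_of_real t * pform e n X p q x y + complex_of_real t * pform e n X x y p q
        + complex_of_real (t\<^sup>2) * pform e n X p q p q"
      unfolding pform_expand
      by (simp add: act_lin ip_lin act_add[abs_def] act_scale[abs_def] algebra_simps power2_eq_square)
    from arg_cong[OF this, of Re] psd[of "\<lambda>i. x i + complex_of_real t * p i" "\<lambda>i. y i + complex_of_real t * q i"]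
    show ?thesis using z N2 by (simp add: N_def C_def)
  qed
  have N0: "0 \<le> N" using N ip_self_nonneg by simp
  have "C \<ge> 0" using psd C_def by simp
  have "N = 0"
  proof (rule ccontr)
    assume "N \<noteq> 0"
    with N0 have Np: "N > 0" by simp
    \<comment> \<open>This t nearly minimises the quadratic; C + 1 in place of C covers the case C =
      0.\<close>
    have "0 \<le> 2 * (- N / (C+1)) * N + (- N / (C+1))\<^sup>2 * C" by (rule quad)
    also have "\<dots> = N\<^sup>2 / (C+1)\<^sup>2 * (C - 2 * (C+1))"
      using \<open>C \<ge> 0\<close> by (simp add: field_simps power2_eq_square add_nonneg_eq_0_iff)
    also have "\<dots> < 0" using Np \<open>C \<ge> 0\<close> by (intro mult_pos_neg) auto
    finally show False by simp
  qed
  then have "Re (ip n p p) = 0" "Re (ip n q q) = 0"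
    using N ip_self_nonneg[of n p] ip_self_nonneg[of n q] by linarith+
  then show ?thesis using ip_self_zero i p_def q_def by blast
qed

lemma sum_blocks: "(\<Sum>p<k*n. f p) = (\<Sum>a<k. \<Sum>i<n. f (a*n+i))" for f :: "nat \<Rightarrow> 'a::comm_monoid_add"
proof -
  have "(\<Sum>p<k*n. f p) = (\<Sum>a<k. sum f {a*n..<a*n+n})" by (rule sum.nat_group[symmetric])
  also have "\<dots> = (\<Sum>a<k. \<Sum>i<n. f (a*n+i))"
  proof (rule sum.cong)
    fix a
    have "sum f {a*n..<a*n+n} = (\<Sum>i\<in>{0..<n}. f (i + a*n))"
      using sum.shift_bounds_nat_ivl[of f 0 "a*n" n] by (simp add: add.commute)
    then show "sum f {a*n..<a*n+n} = (\<Sum>i<n. f (a*n+i))"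
      by (simp add: lessThan_atLeast0 add.commute)
  qed simp
  finally show ?thesis .
qed

lemma quadform_ip:
  assumes "A \<in> carrier_mat N N" "v \<in> carrier_vec N"
  shows "(A *\<^sub>v v) \<bullet>c v = ip N (act N A (\<lambda>i. v $ i)) (\<lambda>i. v $ i)"
  using assms by (simp add: scalar_prod_def ip_def act_def lessThan_atLeast0)

lemma psd_iff_ip:
  "psd N A \<longleftrightarrow> selfadj N A \<and> (\<forall>x. 0 \<le> Re (ip N (act N A x) x))"
proof -
  have "ip N (act N A x) x = ((A *\<^sub>v vec N x) \<bullet>c vec N x)" if "A \<in> carrier_mat N N" for x
    unfolding quadform_ip[OF that vec_carrier]
    by (rule ip_cong) (auto intro!: act_cong)
  then show ?thesis unfolding psd_def
    by (metis quadform_ip selfadj_def vec_carrier)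
qed

section \<open>The pencil of F3\<close>

lemma act_minus_mat:
  assumes "A \<in> carrier_mat n n" "B \<in> carrier_mat n n" "i < n"
  shows "act n (A - B) x i = act n A x i - act n B x i"
  unfolding act_def using assms by (simp add: left_diff_distrib sum_subtractf)

lemma kron_carrier: "A \<in> carrier_mat m m \<Longrightarrow> B \<in> carrier_mat n n \<Longrightarrow> kron A B \<in> carrier_mat (m*n) (m*n)"
  by (auto simp: kron_def)

lemma block_index_less: "a < m \<Longrightarrow> i < n \<Longrightarrow> a * n + i < m * (n::nat)"
  using mult_le_mono1[of "Suc a" m n] by simp

lemma kron_index:
  assumes "A \<in> carrier_mat m m" "B \<in> carrier_mat n n" "a < m" "b < m" "i < n" "k < n"
  shows "kron A B $$ (a*n+i, b*n+k) = A $$ (a,b) * B $$ (i,k)"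
  using assms block_index_less[of a m i n] block_index_less[of b m k n] by (auto simp: kron_def)

lemma selfadj_kron:
  assumes "selfadj m A" "selfadj n B"
  shows "selfadj (m*n) (kron A B)"
  unfolding selfadj_entry
proof (intro conjI allI impI)
  have AB: "A \<in> carrier_mat m m" "B \<in> carrier_mat n n" using assms by (auto simp: selfadj_entry)
  then show "kron A B \<in> carrier_mat (m*n) (m*n)" by (rule kron_carrier)
  fix i j assume ij: "i < m*n" "j < m*n"
  then have n: "n > 0" by (cases n) auto
  have "i div n < m" "j div n < m" "i mod n < n" "j mod n < n"
    using ij n by (auto simp: less_mult_imp_div_less)
  then show "cnj (kron A B $$ (j,i)) = kron A B $$ (i,j)"
    using assms AB ij unfolding selfadj_entry by (auto simp: kron_def)
qed

lemma selfadj_diff: "selfadj n A \<Longrightarrow> selfadj n B \<Longrightarrow> selfadj n (A - B)"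
  by (auto simp: selfadj_entry)

lemma selfadj_one: "selfadj n (1\<^sub>m n)"
  by (auto simp: selfadj_entry)

lemma act_kron:
  assumes "A \<in> carrier_mat m m" "B \<in> carrier_mat n n" "a < m" "i < n"
  shows "act (m*n) (kron A B) w (a*n+i) = (\<Sum>b<m. A $$ (a,b) * act n B (\<lambda>k. w (b*n+k)) i)"
  unfolding act_def sum_blocks sum_distrib_left
  by (intro sum.cong) (use assms in \<open>auto simp: kron_index[OF assms(1,2)]\<close>)

lemma ip_blocks: "ip (m*n) x y = (\<Sum>a<m. ip n (\<lambda>i. x (a*n+i)) (\<lambda>i. y (a*n+i)))"
  unfolding ip_def by (rule sum_blocks)

lemma nat4_cases: "i < 4 \<Longrightarrow> i = 0 \<or> i = 1 \<or> i = 2 \<or> i = (3::nat)" by linarith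
lemma nat3_cases: "i < 3 \<Longrightarrow> i = 0 \<or> i = 1 \<or> i = (2::nat)" by linarith

lemma mat4_eqI:
  assumes "A \<in> carrier_mat 4 4" "B \<in> carrier_mat 4 4"
    "\<And>i j. i \<in> {0,1,2,3} \<Longrightarrow> j \<in> {0,1,2,3} \<Longrightarrow> A $$ (i,j) = B $$ (i,j)"
  shows "A = B"
  by (rule eq_matI) (use assms nat4_cases in auto)

lemma div_mod_two:
  "2 mod Suc (Suc 0) = 0" "3 mod Suc (Suc 0) = Suc 0" "2 div Suc (Suc 0) = Suc 0" "3 div Suc (Suc 0) = Suc 0"
  by (simp_all flip: numeral_2_eq_2)

lemma F3_nth:
  "F3!0 = mat_of_rows_list 4 [[1,0,0,0],[0,-1,0,0],[0,0,-1,0],[0,0,0,1]]"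
  "F3!1 = mat_of_rows_list 4 [[0,0,1,0],[0,0,0,-1],[1,0,0,0],[0,-1,0,0]]"
  "F3!2 = mat_of_rows_list 4 [[0,1,0,0],[1,0,0,0],[0,0,0,1],[0,0,1,0]]"
  by (rule mat4_eqI; auto simp: F3_def kron_def sigma_z_def sigma_x_def mat_of_rows_list_def div_mod_two)+

lemma length_F3 [simp]: "length F3 = 3" by (simp add: F3_def)

lemma selfadj_F3: "j < 3 \<Longrightarrow> selfadj 4 (F3!j)"
  by (drule nat3_cases, elim disjE; simp only: F3_nth selfadj_entry)
     (auto simp: mat_of_rows_list_def dest!: nat4_cases)

text \<open>The coefficients M stay arbitrary because the form is used twice: for the tuple X in the
  free spectrahedron and for the coefficients \<open>Hs\<close> of the Horodecki state.\<close>

definition F3form :: "nat \<Rightarrow> (nat \<Rightarrow> complex mat) \<Rightarrow> (nat \<Rightarrow> nat \<Rightarrow> complex) \<Rightarrow> complex" where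
  "F3form n M v = (\<Sum>a<4. \<Sum>b<4. \<Sum>j<3. F3!j $$ (a,b) * ip n (act n (M j) (v b)) (v a))"

text \<open>Coordinates on $C^4 \otimes C^n$ in which the pencil of F3 splits into the form of the
  Pauli matrices (e = i) and that of their complex conjugates (e = -i).\<close>

definition vsplit :: "(nat \<Rightarrow> complex) \<Rightarrow> (nat \<Rightarrow> complex) \<Rightarrow> (nat \<Rightarrow> complex) \<Rightarrow> (nat \<Rightarrow> complex) \<Rightarrow> nat \<Rightarrow> nat \<Rightarrow> complex" where
  "vsplit x x' y y' a = (if a = 0 then (\<lambda>i. x i + x' i) else if a = 1 then (\<lambda>i. \<i> * (y i - y' i))
     else if a = 2 then (\<lambda>i. y i + y' i) else (\<lambda>i. - (\<i> * (x i - x' i))))"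

lemma F3form_explicit:
  "F3form n M v = (let S = (\<lambda>j a b. ip n (act n (M j) (v b)) (v a)) in
     S 0 0 0 - S 0 1 1 - S 0 2 2 + S 0 3 3 + S 1 0 2 + S 1 2 0 - S 1 1 3 - S 1 3 1
     + S 2 0 1 + S 2 1 0 + S 2 2 3 + S 2 3 2)"
proof -
  have 4: "{..<4::nat} = {0,1,2,3}" and 3: "{..<3::nat} = {0,1,2}" by auto
  show ?thesis
    unfolding F3form_def Let_def 4 3
    by (simp del: One_nat_def add: F3_nth mat_of_rows_list_def)
qed

text \<open>The Pauli form without its constant term, since the Horodecki state has
  \<open>H0\<close> where the pencil has the identity.\<close>

definition pdiag :: "complex \<Rightarrow> nat \<Rightarrow> (nat \<Rightarrow> complex mat) \<Rightarrow> (nat \<Rightarrow> complex) \<Rightarrow> (nat \<Rightarrow> complex) \<Rightarrow> complex" where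
  "pdiag e n M x y = ip n (act n (M 0) x) x - ip n (act n (M 0) y) y
     + ip n (act n (M 1) y) x + ip n (act n (M 1) x) y
     + e * ip n (act n (M 2) y) x - e * ip n (act n (M 2) x) y"

text \<open>The product \<open>F3!0 * F3!1 * F3!2\<close> commutes with the three matrices and has
  square -1. The vectors built from x, y alone and those built from x', y' alone fill its
  eigenspaces for -i and i, so no mixed terms occur. The factor 2 arises because each of x, x', y,
  y' enters two blocks with a coefficient of modulus 1.\<close>

lemma F3form_split:
  "F3form n M (vsplit x x' y y') = 2 * (pdiag \<i> n M x y + pdiag (-\<i>) n M x' y')"
  unfolding F3form_explicit Let_def pdiag_def vsplit_def
  by (simp del: One_nat_def add: act_lin ip_lin act_add[abs_def] act_diff[abs_def] act_minus[abs_def] act_scale[abs_def])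
     (simp add: algebra_simps)

lemma vsplit_norm:
  "(\<Sum>a<4. ip n (vsplit x x' y y' a) (vsplit x x' y y' a))
    = 2 * (ip n x x + ip n y y + ip n x' x' + ip n y' y')"
proof -
  have 4: "{..<4::nat} = {0,1,2,3}" by auto
  show ?thesis unfolding 4
    by (simp add: vsplit_def ip_lin algebra_simps)
qed

lemma pform_diag: "pform e n X x y x y = ip n x x + ip n y y - pdiag e n (\<lambda>j. X!j) x y"
  by (simp add: pform_expand pdiag_def)

lemma vsplit_surj:
  "v a = vsplit (\<lambda>i. (v 0 i + \<i> * v 3 i)/2) (\<lambda>i. (v 0 i - \<i> * v 3 i)/2)
      (\<lambda>i. (v 2 i - \<i> * v 1 i)/2) (\<lambda>i. (v 2 i + \<i> * v 1 i)/2) a"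
  if "a < 4" for a :: nat
  using nat4_cases[OF that] by (auto simp: vsplit_def field_simps)

lemma pencil_form:
  assumes X: "\<And>j. j < 3 \<Longrightarrow> X!j \<in> carrier_mat n n"
  shows "ip (4*n) (act (4*n) (1\<^sub>m (4*n) - msum (4*n) (4*n) (\<lambda>j. kron (F3!j) (X!j)) {..<3}) w) w
     = (\<Sum>a<4. ip n (\<lambda>i. w (a*n+i)) (\<lambda>i. w (a*n+i))) - F3form n (\<lambda>j. X!j) (\<lambda>a i. w (a*n+i))"
proof -
  have F: "F3!j \<in> carrier_mat 4 4" if "j < 3" for j using selfadj_F3[OF that] by (simp add: selfadj_def)
  have "ip (4*n) (act (4*n) (1\<^sub>m (4*n) - msum (4*n) (4*n) (\<lambda>j. kron (F3!j) (X!j)) {..<3}) w) w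
     = ip (4*n) w w - ip (4*n) (act (4*n) (msum (4*n) (4*n) (\<lambda>j. kron (F3!j) (X!j)) {..<3}) w) w"
    unfolding ip_diff_left[symmetric]
    by (rule ip_cong) (auto simp: act_minus_mat msum_def act_one)
  also have "ip (4*n) (act (4*n) (msum (4*n) (4*n) (\<lambda>j. kron (F3!j) (X!j)) {..<3}) w) w
      = (\<Sum>j<3. \<Sum>a<4. ip n (\<lambda>i. \<Sum>b<4. F3!j $$ (a,b) * act n (X!j) (\<lambda>k. w (b*n+k)) i) (\<lambda>i. w (a*n+i)))"
    unfolding ip_msum ip_blocks
    by (intro sum.cong ip_cong refl) (use act_kron[OF F X] in auto)
  also have "\<dots> = (\<Sum>j<3. \<Sum>a<4. \<Sum>b<4. F3!j $$ (a,b) * ip n (act n (X!j) (\<lambda>k. w (b*n+k))) (\<lambda>i. w (a*n+i)))"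
  proof (intro sum.cong refl)
    fix j a
    show "ip n (\<lambda>i. \<Sum>b<4. F3!j $$ (a,b) * act n (X!j) (\<lambda>k. w (b*n+k)) i) (\<lambda>i. w (a*n+i))
       = (\<Sum>b<4. F3!j $$ (a,b) * ip n (act n (X!j) (\<lambda>k. w (b*n+k))) (\<lambda>i. w (a*n+i)))"
      unfolding ip_def sum_distrib_right sum_distrib_left
      by (subst sum.swap) (simp add: mult.assoc)
  qed
  also have "\<dots> = F3form n (\<lambda>j. X!j) (\<lambda>a i. w (a*n+i))"
    unfolding F3form_def
    by (subst sum.swap, rule sum.cong, simp, subst sum.swap, simp)
  finally show ?thesis unfolding ip_blocks by simp
qed

lemma F3form_cong:
  assumes "\<And>a i. a < 4 \<Longrightarrow> i < n \<Longrightarrow> v a i = v' a i"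
  shows "F3form n M v = F3form n M v'"
  unfolding F3form_def
  by (intro sum.cong refl arg_cong2[of _ _ _ _ "(*)"] ip_cong act_cong) (use assms in auto)

theorem free_spec_F3_iff:
  "X \<in> free_spec 4 F3 n \<longleftrightarrow> n \<noteq> 0 \<and> SM_tuple 3 n X \<and>
     (\<forall>e x y. e \<in> {\<i>, -\<i>} \<longrightarrow> 0 \<le> Re (pform e n X x y x y))"
proof (cases "n \<noteq> 0 \<and> SM_tuple 3 n X")
  case False
  then show ?thesis by (auto simp: free_spec_def)
next
  case True
  then have n: "n \<noteq> 0" and SM: "SM_tuple 3 n X" by auto
  have Xs: "selfadj n (X!j)" and X: "X!j \<in> carrier_mat n n" if "j < 3" for j
    using SM that by (auto simp: SM_tuple_def selfadj_def)
  define L where "L = 1\<^sub>m (4*n) - msum (4*n) (4*n) (\<lambda>j. kron (F3!j) (X!j)) {..<3}"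
  have sL: "selfadj (4*n) L"
    unfolding L_def by (intro selfadj_diff selfadj_one selfadj_msum selfadj_kron selfadj_F3 Xs) auto
  have form: "ip (4*n) (act (4*n) L w) w
      = (\<Sum>a<4. ip n (\<lambda>i. w (a*n+i)) (\<lambda>i. w (a*n+i))) - F3form n (\<lambda>j. X!j) (\<lambda>a i. w (a*n+i))" for w
    unfolding L_def by (rule pencil_form) (rule X)
  have split: "(\<Sum>a<4. ip n (vsplit x x' y y' a) (vsplit x x' y y' a)) - F3form n (\<lambda>j. X!j) (vsplit x x' y y')
      = 2 * (pform \<i> n X x y x y + pform (-\<i>) n X x' y' x' y')" for x x' y y'
    unfolding F3form_split vsplit_norm pform_diag by (simp add: algebra_simps)
  have "(\<forall>w. 0 \<le> Re (ip (4*n) (act (4*n) L w) w)) \<longleftrightarrow>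
      (\<forall>e x y. e \<in> {\<i>, -\<i>} \<longrightarrow> 0 \<le> Re (pform e n X x y x y))" (is "?l = ?r")
  proof
    assume ?l
    have pos: "0 \<le> Re (pform \<i> n X x y x y) + Re (pform (-\<i>) n X x' y' x' y')" for x x' y y'
    proof -
      define w where "w = (\<lambda>p. vsplit x x' y y' (p div n) (p mod n))"
      have w: "w (a*n+i) = vsplit x x' y y' a i" if "i < n" for a i using that by (simp add: w_def)
      have "ip (4*n) (act (4*n) L w) w = 2 * (pform \<i> n X x y x y + pform (-\<i>) n X x' y' x' y')"
        unfolding form split[symmetric]
        by (intro arg_cong2[of _ _ _ _ "(-)"] sum.cong refl ip_cong F3form_cong) (simp_all add: w)
      with \<open>?l\<close>[rule_format, of w] show ?thesis by simp
    qed
    \<comment> \<open>Setting one of the two pairs to 0 in \<open>pos\<close> isolates the form of a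
      single sign.\<close>
    have zero: "pform e n X (\<lambda>_. 0) (\<lambda>_. 0) (\<lambda>_. 0) (\<lambda>_. 0) = 0" for e
      by (simp add: pform_expand ip_def)
    show ?r
      using pos[of _ _ "\<lambda>_. 0" "\<lambda>_. 0"] pos[of "\<lambda>_. 0" "\<lambda>_. 0"] zero by auto
  next
    assume r: ?r
    show ?l
    proof
      fix w :: "nat \<Rightarrow> complex"
      define v where "v = (\<lambda>a i. w (a*n+i))"
      define x where "x = (\<lambda>i. (v 0 i + \<i> * v 3 i)/2)"
      define x' where "x' = (\<lambda>i. (v 0 i - \<i> * v 3 i)/2)"
      define y where "y = (\<lambda>i. (v 2 i - \<i> * v 1 i)/2)"
      define y' where "y' = (\<lambda>i. (v 2 i + \<i> * v 1 i)/2)"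
      have v: "v a = vsplit x x' y y' a" if "a < 4" for a
        unfolding x_def x'_def y_def y'_def by (rule vsplit_surj[OF that])
      have "ip (4*n) (act (4*n) L w) w = (\<Sum>a<4. ip n (v a) (v a)) - F3form n (\<lambda>j. X!j) v"
        unfolding form v_def ..
      also have "\<dots> = 2 * (pform \<i> n X x y x y + pform (-\<i>) n X x' y' x' y')"
        unfolding split[symmetric]
        by (intro arg_cong2[of _ _ _ _ "(-)"] sum.cong refl F3form_cong) (simp_all add: v)
      finally show "0 \<le> Re (ip (4*n) (act (4*n) L w) w)" using r by simp
    qed
  qed
  then show ?thesis
    using n SM sL by (simp add: free_spec_def psd_iff_ip L_def[symmetric])
qed

section \<open>Matrix convex combinations and intertwiners\<close>

lemma ip_gram:
  assumes "V \<in> carrier_mat m n"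
  shows "ip n (act n (mat_adjoint V * V) x) y = ip m (act n V x) (act n V y)"
  using ip_sandwich[OF one_carrier_mat[of m] assms, of x y] right_mult_one_mat[OF adjoint_carrier[OF assms]]
  by (simp add: act_one cong: ip_cong)

lemma mconv_comb_nth: "j < g \<Longrightarrow> mconv_comb g n I V Y ! j = msum n n (\<lambda>i. mat_adjoint (V i) * (Y i ! j) * V i) I"
  by (simp add: mconv_comb_def)

lemma mconv_comb_SM:
  assumes "mconv_data g K n I m V Y" "\<And>k X. X \<in> K k \<Longrightarrow> SM_tuple g k X"
  shows "SM_tuple g n (mconv_comb g n I V Y)"
  unfolding SM_tuple_def
proof (intro conjI allI impI)
  show "length (mconv_comb g n I V Y) = g" by (simp add: mconv_comb_def)
  fix j assume j: "j < g"
  show "selfadj n (mconv_comb g n I V Y ! j)"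
    unfolding mconv_comb_nth[OF j]
    by (intro selfadj_msum selfadj_sandwich[of "m i" for i]) (use assms j in \<open>auto simp: mconv_data_def SM_tuple_def\<close>)
qed

lemma ip_comb_one:
  assumes "mconv_data g K n I m V Y"
  shows "ip n x y = (\<Sum>i\<in>I. ip (m i) (act n (V i) x) (act n (V i) y))"
proof -
  have "ip n x y = ip n (act n (msum n n (\<lambda>i. mat_adjoint (V i) * V i) I) x) y"
    using assms by (simp add: mconv_data_def act_one cong: ip_cong)
  also have "\<dots> = (\<Sum>i\<in>I. ip (m i) (act n (V i) x) (act n (V i) y))"
    unfolding ip_msum by (intro sum.cong refl ip_gram) (use assms in \<open>auto simp: mconv_data_def\<close>)
  finally show ?thesis .
qed

lemma ip_comb:
  assumes "mconv_data g K n I m V Y" "\<And>k X. X \<in> K k \<Longrightarrow> SM_tuple g k X" "j < g"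
  shows "ip n (act n (mconv_comb g n I V Y ! j) x) y
     = (\<Sum>i\<in>I. ip (m i) (act (m i) (Y i ! j) (act n (V i) x)) (act n (V i) y))"
  unfolding mconv_comb_nth[OF assms(3)] ip_msum
  by (intro sum.cong refl ip_sandwich) (use assms in \<open>auto simp: mconv_data_def SM_tuple_def selfadj_def\<close>)

text \<open>The constant term is distributed by the condition that the V* V sum to 1. Hence the form
  of a matrix convex combination is the plain sum of the forms of its points, pulled back by the
  V.\<close>

lemma pform_comb:
  assumes "mconv_data 3 K n I m V Y" "\<And>k X. X \<in> K k \<Longrightarrow> SM_tuple 3 k X"
  shows "pform e n (mconv_comb 3 n I V Y) x y x' y'
     = (\<Sum>i\<in>I. pform e (m i) (Y i) (act n (V i) x) (act n (V i) y) (act n (V i) x') (act n (V i) y'))"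
proof -
  let ?X = "mconv_comb 3 n I V Y"
  have "pform e n ?X x y x' y' =
      (\<Sum>i\<in>I. ip (m i) (act n (V i) x) (act n (V i) x')) + (\<Sum>i\<in>I. ip (m i) (act n (V i) y) (act n (V i) y'))
   - ip n (act n (?X!0) x) x' + ip n (act n (?X!0) y) y'
   - ip n (act n (?X!1) y) x' - ip n (act n (?X!1) x) y'
   - e * ip n (act n (?X!2) y) x' + e * ip n (act n (?X!2) x) y'"
    unfolding pform_expand by (simp only: ip_comb_one[OF assms(1)])
  also have "\<dots> = (\<Sum>i\<in>I. pform e (m i) (Y i) (act n (V i) x) (act n (V i) y) (act n (V i) x') (act n (V i) y'))"
    unfolding pform_expand
    by (simp del: One_nat_def add: ip_comb[OF assms] sum.distrib sum_subtractf sum_distrib_left)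
  finally show ?thesis .
qed

lemma free_spec_F3_SM: "X \<in> free_spec 4 F3 n \<Longrightarrow> SM_tuple 3 n X"
  by (simp add: free_spec_F3_iff)

lemma free_spec_F3_pform: "X \<in> free_spec 4 F3 n \<Longrightarrow> e \<in> {\<i>,-\<i>} \<Longrightarrow> 0 \<le> Re (pform e n X x y x y)"
  unfolding free_spec_F3_iff by blast

lemma free_spec_F3_comb:
  assumes "mconv_data 3 (free_spec 4 F3) n I m V Y" "n \<ge> 1"
  shows "mconv_comb 3 n I V Y \<in> free_spec 4 F3 n"
  unfolding free_spec_F3_iff
proof (intro conjI allI impI)
  show "n \<noteq> 0" using assms by simp
  show "SM_tuple 3 n (mconv_comb 3 n I V Y)"
    by (rule mconv_comb_SM[OF assms(1)]) (rule free_spec_F3_SM)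
  fix e x y assume e: "e \<in> {\<i>, -\<i>}"
  have "0 \<le> (\<Sum>i\<in>I. Re (pform e (m i) (Y i) (act n (V i) x) (act n (V i) y) (act n (V i) x) (act n (V i) y)))"
    by (intro sum_nonneg free_spec_F3_pform e) (use assms in \<open>auto simp: mconv_data_def\<close>)
  then show "0 \<le> Re (pform e n (mconv_comb 3 n I V Y) x y x y)"
    by (simp add: pform_comb[OF assms(1) free_spec_F3_SM])
qed

text \<open>The three rows are those of the off-diagonal part of a dilation of X: the condition says that
  the kernel of the pencil allows only trivial dilations inside the free spectrahedron, i.e.
  X is an Arveson extreme point.\<close>

definition row_rigid :: "nat \<Rightarrow> complex mat list \<Rightarrow> bool" where
  "row_rigid n X \<longleftrightarrow> (\<forall>r1 r2 r3.
     (\<forall>e x y. e \<in> {\<i>, -\<i>} \<and> (\<forall>i<n. pauli1 e n X x y i = 0 \<and> pauli2 e n X x y i = 0) \<longrightarrow>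
        (\<Sum>k<n. r1 k * x k + r2 k * y k + e * (r3 k * y k)) = 0 \<and>
        (\<Sum>k<n. r2 k * x k - r1 k * y k - e * (r3 k * x k)) = 0) \<longrightarrow>
     (\<forall>k<n. r1 k = 0 \<and> r2 k = 0 \<and> r3 k = 0))"

text \<open>For a self-adjoint tuple the commutant is a star algebra, so its triviality means that
  there is no proper common reducing subspace.\<close>

definition irreducible_tuple :: "nat \<Rightarrow> complex mat list \<Rightarrow> bool" where
  "irreducible_tuple n X \<longleftrightarrow>
     (\<forall>H\<in>carrier_mat n n. (\<forall>j<3. H * X!j = X!j * H) \<longrightarrow> (\<exists>c. H = c \<cdot>\<^sub>m 1\<^sub>m n))"

text \<open>W carries a kernel vector of the form of X into the kernel for the combination P. There
  a sum of nonnegative terms vanishes, so each term does, and V_i carries the vector on into the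
  kernel for Y_i. Thus with U = V_i W every row of Y_i U - U X solves the system in
  \<open>row_rigid\<close> and is 0. The case W = 1 gives extremality; general W is what
  \<open>not_minimal\<close> needs.\<close>

theorem comb_intertwines:
  assumes rigid: "row_rigid n X" and X: "SM_tuple 3 n X"
    and data: "mconv_data 3 (free_spec 4 F3) l I m V Y" and W: "W \<in> carrier_mat l n"
    and tw: "\<And>j. j < 3 \<Longrightarrow> mconv_comb 3 l I V Y ! j * W = W * X!j" and i: "i \<in> I" and j: "j < 3"
  shows "Y i ! j * (V i * W) = V i * W * X!j"
proof -
  define P where "P = mconv_comb 3 l I V Y"
  define M where "M = m i"
  define U where "U = V i * W"
  define Z where "Z = Y i"
  have fin: "finite I" and Zin: "Z \<in> free_spec 4 F3 M" and V: "V i \<in> carrier_mat M l"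
    using data i by (auto simp: mconv_data_def Z_def M_def)
  have U: "U \<in> carrier_mat M n" using V W by (simp add: U_def)
  have "SM_tuple 3 l P" unfolding P_def by (rule mconv_comb_SM[OF data free_spec_F3_SM])
  then have Xc: "X!k \<in> carrier_mat n n" and Zc: "Z!k \<in> carrier_mat M M" and Pc: "P!k \<in> carrier_mat l l" if "k < 3" for k
    using X free_spec_F3_SM[OF Zin] that by (auto simp: SM_tuple_def selfadj_def)
  \<comment> \<open>Row p of \<open>R 0\<close>, \<open>R 1\<close>, \<open>R 2\<close> will play
    the part of r1, r2, r3 in \<open>row_rigid\<close>.\<close>
  define R where "R k p q = (Z!k * U) $$ (p,q) - (U * X!k) $$ (p,q)" for k p q
  have actR: "(\<Sum>q<n. R k p q * x q) = act M (Z!k) (act n U x) p - act n U (act n (X!k) x) p"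
    if "k < 3" "p < M" for k p x
    using act_mult[OF Zc[OF that(1)] U that(2), of x] act_mult[OF U Xc[OF that(1)] that(2), of x]
    by (simp add: R_def act_def left_diff_distrib sum_subtractf)
  have R0: "R 0 p k = 0 \<and> R 1 p k = 0 \<and> R 2 p k = 0" if p: "p < M" and k: "k < n" for p k
  proof (rule rigid[unfolded row_rigid_def, rule_format, OF _ k])
    fix e x y
    assume a: "e \<in> {\<i>, -\<i>} \<and> (\<forall>i<n. pauli1 e n X x y i = 0 \<and> pauli2 e n X x y i = 0)"
    then have e: "e \<in> {\<i>, -\<i>}" "cnj e = - e" by auto
    have zero: "act n A (pauli1 e n X x y) q = 0" "act n A (pauli2 e n X x y) q = 0" for A q
      using a by (auto simp: act_def intro!: sum.neutral)
    have PW: "act l (P!k) (act n W x) q = act n W (act n (X!k) x) q" if "k < 3" "q < l" for k q x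
      using act_mult[OF Pc[OF that(1)] W that(2), of x] act_mult[OF W Xc[OF that(1)] that(2), of x]
        tw[OF that(1)] by (simp add: P_def)
    have "pauli1 e l P (act n W x) (act n W y) q = act n W (pauli1 e n X x y) q"
      "pauli2 e l P (act n W x) (act n W y) q = act n W (pauli2 e n X x y) q" if "q < l" for q
      using that by (simp_all del: One_nat_def add: pauli1_def pauli2_def act_lin PW)
    then have "0 = Re (pform e l P (act n W x) (act n W y) (act n W x) (act n W y))"
      by (simp add: pform_def ip_def zero)
    also have "\<dots> = (\<Sum>i\<in>I. Re (pform e (m i) (Y i) (act l (V i) (act n W x)) (act l (V i) (act n W y))
        (act l (V i) (act n W x)) (act l (V i) (act n W y))))"
      unfolding P_def by (simp add: pform_comb[OF data free_spec_F3_SM])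
    finally have "Re (pform e (m i) (Y i) (act l (V i) (act n W x)) (act l (V i) (act n W y))
        (act l (V i) (act n W x)) (act l (V i) (act n W y))) = 0"
      using free_spec_F3_pform[OF _ e(1)] data i by (subst (asm) eq_commute, subst (asm) sum_nonneg_eq_0_iff[OF fin])
        (auto simp: mconv_data_def)
    then have "pauli1 e M Z (act l (V i) (act n W x)) (act l (V i) (act n W y)) p = 0 \<and>
        pauli2 e M Z (act l (V i) (act n W x)) (act l (V i) (act n W y)) p = 0"
      unfolding Z_def M_def
      by (intro pform_psd_kernel) (use free_spec_F3_SM free_spec_F3_pform Zin e p in \<open>auto simp: Z_def M_def\<close>)
    moreover have Ux: "act n U x q = act l (V i) (act n W x) q" if "q < M" for x q
      unfolding U_def by (rule act_mult[OF V W that])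
    moreover have "act M A (act l (V i) (act n W x)) p = act M A (act n U x) p" for A x
      by (rule act_cong) (simp add: Ux)
    ultimately have ker: "pauli1 e M Z (act n U x) (act n U y) p = 0 \<and> pauli2 e M Z (act n U x) (act n U y) p = 0"
      using p by (simp add: pauli1_def pauli2_def)
    have s1: "(\<Sum>k<n. R 0 p k * x k + R 1 p k * y k + e * (R 2 p k * y k))
        = (\<Sum>k<n. R 0 p k * x k) + (\<Sum>k<n. R 1 p k * y k) + e * (\<Sum>k<n. R 2 p k * y k)"
      by (simp add: sum.distrib sum_distrib_left)
    have s2: "(\<Sum>k<n. R 1 p k * x k - R 0 p k * y k - e * (R 2 p k * x k))
        = (\<Sum>k<n. R 1 p k * x k) - (\<Sum>k<n. R 0 p k * y k) - e * (\<Sum>k<n. R 2 p k * x k)"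
      by (simp add: sum_subtractf sum_distrib_left)
    have sums: "(\<Sum>k<n. R 0 p k * x k + R 1 p k * y k + e * (R 2 p k * y k))
        = act n U (pauli1 e n X x y) p - pauli1 e M Z (act n U x) (act n U y) p"
      "(\<Sum>k<n. R 1 p k * x k - R 0 p k * y k - e * (R 2 p k * x k))
        = act n U (pauli2 e n X x y) p - pauli2 e M Z (act n U x) (act n U y) p"
      unfolding s1 s2
      by (simp_all del: One_nat_def add: actR[OF _ p] pauli1_def pauli2_def act_lin) (simp_all add: algebra_simps)
    show "(\<Sum>k<n. R 0 p k * x k + R 1 p k * y k + e * (R 2 p k * y k)) = 0 \<and>
        (\<Sum>k<n. R 1 p k * x k - R 0 p k * y k - e * (R 2 p k * x k)) = 0"
      unfolding sums using ker zero by simp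
  qed
  show ?thesis
    unfolding Z_def[symmetric] U_def[symmetric]
  proof (rule eq_matI)
    fix p k assume "p < dim_row (U * X!j)" "k < dim_col (U * X!j)"
    then have "p < M" "k < n" using U Xc[OF j] by auto
    with R0[OF this] nat3_cases[OF j] show "(Z!j * U) $$ (p,k) = (U * X!j) $$ (p,k)"
      by (auto simp: R_def)
  qed (use U Xc[OF j] Zc[OF j] in auto)
qed

text \<open>Taking adjoints turns Y V = V X into V* Y = X V*, so V* V commutes with X.\<close>

lemma intertwiner_isometric:
  assumes X: "SM_tuple 3 n X" and Y: "SM_tuple 3 m Y" and V: "V \<in> carrier_mat m n"
    and irr: "irreducible_tuple n X" and tw: "\<And>j. j < 3 \<Longrightarrow> Y!j * V = V * X!j"
  shows "\<exists>c. mat_adjoint V * V = c \<cdot>\<^sub>m 1\<^sub>m n"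
proof -
  note V' = adjoint_carrier[OF V]
  have "mat_adjoint V * V * X!j = X!j * (mat_adjoint V * V)" if j: "j < 3" for j
  proof -
    have Xj: "X!j \<in> carrier_mat n n" "mat_adjoint (X!j) = X!j"
      and Yj: "Y!j \<in> carrier_mat m m" "mat_adjoint (Y!j) = Y!j"
      using X Y j by (auto simp: SM_tuple_def selfadj_def)
    have "mat_adjoint V * Y!j = mat_adjoint (Y!j * V)" using adjoint_mult[OF Yj(1) V] Yj by simp
    also have "\<dots> = X!j * mat_adjoint V" using tw[OF j] adjoint_mult[OF V Xj(1)] Xj by simp
    finally have "mat_adjoint V * Y!j = X!j * mat_adjoint V" .
    then show ?thesis
      using assoc_mult_mat[OF V' V Xj(1)] assoc_mult_mat[OF V' Yj(1) V] assoc_mult_mat[OF Xj(1) V' V] tw[OF j]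
      by simp
  qed
  then show ?thesis using irr V V' unfolding irreducible_tuple_def by (meson mult_carrier_mat)
qed

text \<open>All diagonal entries of V* V are squared norms of columns, and some column is
  nonzero.\<close>

lemma gram_trace_pos:
  assumes V: "V \<in> carrier_mat m n" and nz: "V \<noteq> 0\<^sub>m m n" and g: "mat_adjoint V * V = c \<cdot>\<^sub>m 1\<^sub>m n"
  shows "\<exists>r>0. c = complex_of_real r"
proof -
  have diag: "complex_of_real (\<Sum>p<m. (cmod (V $$ (p,k)))\<^sup>2) = c" if k: "k < n" for k
  proof -
    have "(mat_adjoint V * V) $$ (k,k) = (\<Sum>p<m. cnj (V $$ (p,k)) * V $$ (p,k))"
      using mult_index[OF adjoint_carrier[OF V] V k k] V k by simp
    moreover have "(mat_adjoint V * V) $$ (k,k) = c" using k unfolding g by simp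
    ultimately show ?thesis
      by (simp only: of_real_sum complex_norm_square mult.commute)
  qed
  obtain p k where pk: "p < m" "k < n" "V $$ (p,k) \<noteq> 0"
    using nz V by (metis eq_matI index_zero_mat carrier_matD)
  have "(cmod (V $$ (p,k)))\<^sup>2 \<le> (\<Sum>p<m. (cmod (V $$ (p,k)))\<^sup>2)"
    by (rule member_le_sum) (use pk in auto)
  moreover have "(cmod (V $$ (p,k)))\<^sup>2 > 0" using pk by simp
  ultimately show ?thesis using diag[OF pk(2)] by (metis less_le_trans)
qed

section \<open>Free extreme points\<close>

text \<open>Padding A with zero rows to a square matrix makes the determinant vanish. The row m - 1
  that is set to zero lies beyond the rows of A because k < m.\<close>

lemma wide_kernel:
  assumes A: "A \<in> carrier_mat k m" and k: "k < m"
  shows "\<exists>x. (\<exists>i<m. x i \<noteq> 0) \<and> (\<forall>i<k. act m A x i = 0)"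
proof -
  define B where "B = mat\<^sub>r m m (\<lambda>i. if i = m - 1 then 0\<^sub>v m else vec m (\<lambda>j. if i < k then A $$ (i,j) else 0))"
  have B: "B \<in> carrier_mat m m" by (simp add: B_def)
  have "det B = 0" unfolding B_def by (rule det_row_0) (use k in auto)
  then obtain v where v: "v \<in> carrier_vec m" "v \<noteq> 0\<^sub>v m" "B *\<^sub>v v = 0\<^sub>v m"
    using det_0_iff_vec_prod_zero_field[OF B] by blast
  have "act m A (\<lambda>j. v $ j) i = 0" if i: "i < k" for i
  proof -
    have im: "i < m" "i \<noteq> m - 1" using i k by auto
    have "(B *\<^sub>v v) $ i = 0" using v im by simp
    then show ?thesis using B v(1) im i
      by (simp add: B_def act_def scalar_prod_def lessThan_atLeast0)
  qed
  moreover have "\<exists>i<m. v $ i \<noteq> 0" using v by auto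
  ultimately show ?thesis by (intro exI[of _ "\<lambda>j. v $ j"]) auto
qed

section \<open>Orthonormal families and their completion to a unitary\<close>

definition orthonormal_cols :: "nat \<Rightarrow> nat \<Rightarrow> (nat \<Rightarrow> nat \<Rightarrow> complex) \<Rightarrow> bool" where
  "orthonormal_cols m k w \<longleftrightarrow> (\<forall>a<k. \<forall>b<k. ip m (w a) (w b) = (if a = b then 1 else 0))"

text \<open>The new vector is a normalised kernel element of the k by m matrix whose rows are the
  conjugates of the given vectors.\<close>

lemma orthonormal_extend_one:
  assumes w: "orthonormal_cols m k w" and k: "k < m"
  shows "\<exists>v. orthonormal_cols m (Suc k) (w(k := v))"
proof -
  obtain x where x: "\<exists>i<m. x i \<noteq> 0" "\<forall>i<k. act m (mat k m (\<lambda>(i,j). cnj (w i j))) x i = 0"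
    using wide_kernel[OF mat_carrier k] by blast
  have orth: "ip m x (w i) = 0" if "i < k" for i
    using x(2) that by (simp add: act_def ip_def mult.commute)
  define r where "r = Re (ip m x x)"
  have r: "ip m x x = complex_of_real r" by (simp add: r_def ip_self)
  have "r \<noteq> 0" using x(1) ip_self_zero unfolding r_def by blast
  then have rpos: "r > 0" using ip_self_nonneg[of m x] by (simp add: r_def)
  define s where "s = 1 / sqrt r"
  have ss: "s * s * r = 1" using rpos by (simp add: s_def field_simps)
  define v where "v = (\<lambda>i. complex_of_real s * x i)"
  have "ip m v v = complex_of_real (s * s * r)" by (simp add: v_def ip_lin r)
  then have vv: "ip m v v = 1" by (simp add: ss)
  have vw: "ip m v (w i) = 0" if "i < k" for i using orth[OF that] by (simp add: v_def ip_lin)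
  have wv: "ip m (w i) v = 0" if "i < k" for i using vw[OF that] cnj_ip[of m v "w i"] by simp
  show ?thesis
    by (rule exI[of _ v]) (use w vv vw wv in \<open>auto simp: orthonormal_cols_def less_Suc_eq\<close>)
qed

lemma orthonormal_extend:
  assumes "orthonormal_cols m k w" "k \<le> m"
  shows "\<exists>w'. orthonormal_cols m m w' \<and> (\<forall>j<k. w' j = w j)"
  using assms
proof (induction "m - k" arbitrary: k w)
  case 0
  then show ?case by auto
next
  case (Suc d)
  then have "k < m" by simp
  obtain v where v: "orthonormal_cols m (Suc k) (w(k := v))"
    using orthonormal_extend_one[OF Suc.prems(1) \<open>k < m\<close>] by blast
  have "d = m - Suc k" using Suc.hyps(2) by simp
  from Suc.hyps(1)[OF this v] \<open>k < m\<close> obtain w' where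
    "orthonormal_cols m m w'" "\<forall>j<Suc k. w' j = (w(k := v)) j" by auto
  then show ?case by (intro exI[of _ w']) auto
qed

text \<open>More than m orthonormal vectors would form a matrix W with W* W = 1 and, by
  \<open>wide_kernel\<close>, a nonzero kernel.\<close>

lemma orthonormal_cols_le:
  assumes w: "orthonormal_cols m k w"
  shows "k \<le> m"
proof (rule ccontr)
  assume "\<not> k \<le> m"
  define W where "W = mat m k (\<lambda>(i,j). w j i)"
  have W: "W \<in> carrier_mat m k" by (simp add: W_def)
  obtain x where x: "\<exists>i<k. x i \<noteq> 0" "\<forall>i<m. act k W x i = 0"
    using wide_kernel[OF W] \<open>\<not> k \<le> m\<close> by auto
  have "mat_adjoint W * W = 1\<^sub>m k"
  proof (rule eq_matI)
    fix i j assume "i < dim_row (1\<^sub>m k)" "j < dim_col (1\<^sub>m k)"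
    then have ij: "i < k" "j < k" by auto
    have "(mat_adjoint W * W) $$ (i,j) = ip m (w j) (w i)"
      using mult_index[OF adjoint_carrier[OF W] W ij] ij by (simp add: W_def ip_def mult.commute)
    then show "(mat_adjoint W * W) $$ (i,j) = 1\<^sub>m k $$ (i,j)"
      using w ij by (simp add: orthonormal_cols_def)
  qed (simp_all add: W_def)
  then have "ip k x x = ip m (act k W x) (act k W x)"
    using ip_gram[OF W, of x x] by (simp add: act_one cong: ip_cong)
  also have "\<dots> = 0" using x(2) by (simp add: ip_def)
  finally show False using x(1) ip_self_zero[of k x] by auto
qed

definition colmat :: "nat \<Rightarrow> nat \<Rightarrow> (nat \<Rightarrow> nat \<Rightarrow> complex) \<Rightarrow> complex mat" where
  "colmat m k w = mat m k (\<lambda>(i,j). w j i)"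

lemma colmat_carrier [simp]: "colmat m k w \<in> carrier_mat m k" by (simp add: colmat_def)

lemma colmat_sandwich:
  assumes A: "A \<in> carrier_mat m m" and ab: "a < k" "b < l"
  shows "(mat_adjoint (colmat m k f) * A * colmat m l g) $$ (a,b) = ip m (act m A (g b)) (f a)"
proof -
  have "(mat_adjoint (colmat m k f) * A * colmat m l g) $$ (a,b)
      = (mat_adjoint (colmat m k f) * (A * colmat m l g)) $$ (a,b)"
    by (simp only: assoc_mult_mat[OF adjoint_carrier[OF colmat_carrier] A colmat_carrier])
  also have "\<dots> = (\<Sum>p<m. cnj (f a p) * (A * colmat m l g) $$ (p,b))"
    using mult_index[OF adjoint_carrier[OF colmat_carrier] mult_carrier_mat[OF A colmat_carrier] ab, of f g] ab
    by (simp add: colmat_def)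
  also have "\<dots> = ip m (act m A (g b)) (f a)"
    unfolding ip_def act_def
    by (rule sum.cong) (use ab mult_index[OF A colmat_carrier, of _ b l g] in \<open>auto simp: colmat_def mult.commute\<close>)
  finally show ?thesis .
qed

lemma colmat_gram:
  assumes ab: "a < k" "b < l"
  shows "(mat_adjoint (colmat m k f) * colmat m l g) $$ (a,b) = ip m (g b) (f a)"
  using colmat_sandwich[OF one_carrier_mat ab, of m f g] right_mult_one_mat[OF adjoint_carrier[OF colmat_carrier[of m k f]]]
  by (simp add: act_one cong: ip_cong)

lemma colmat_unitary:
  assumes "orthonormal_cols m m w"
  shows "unitary m (colmat m m w)"
proof -
  let ?U = "colmat m m w"
  have 1: "mat_adjoint ?U * ?U = 1\<^sub>m m"
    by (rule eq_matI) (use assms in \<open>auto simp: colmat_gram orthonormal_cols_def\<close>, simp_all add: colmat_def)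
  then show ?thesis
    using mat_mult_left_right_inverse[OF adjoint_carrier[OF colmat_carrier] colmat_carrier 1]
    by (simp add: unitary_def)
qed

lemma unitary_adjoint: "unitary n U \<Longrightarrow> unitary n (mat_adjoint U)"
  by (auto simp: unitary_def adjoint_carrier)

lemma unitary_conj_conj:
  assumes U: "unitary m U" and Y: "Y \<in> carrier_mat m m"
  shows "U * (mat_adjoint U * Y * U) * mat_adjoint U = Y"
proof -
  have c: "U \<in> carrier_mat m m" "mat_adjoint U \<in> carrier_mat m m" "U * mat_adjoint U = 1\<^sub>m m"
    using U by (auto simp: unitary_def adjoint_carrier)
  have "U * (mat_adjoint U * Y * U) * mat_adjoint U = (U * mat_adjoint U) * Y * (U * mat_adjoint U)"
    using c(1,2) Y by (simp add: assoc_mult_mat[of _ m m _ m _ m])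
  then show ?thesis using c Y by simp
qed

text \<open>A multiple of V is an isometry, whose columns are completed to a unitary U. In the new
  basis Y has X in the upper left corner and 0 below it by the intertwining relation, hence 0 to the
  right of it because Y is self-adjoint. The bound on n is stated separately: it is what leaves
  level 1 unchanged in \<open>not_minimal\<close>.\<close>

theorem intertwiner_unit_equiv:
  assumes X: "SM_tuple 3 n X" and Y: "Y \<in> free_spec 4 F3 m" and V: "V \<in> carrier_mat m n"
    and nz: "V \<noteq> 0\<^sub>m m n" and irr: "irreducible_tuple n X"
    and tw: "\<And>j. j < 3 \<Longrightarrow> Y!j * V = V * X!j"
  shows "n \<le> m" and "unit_equiv m Y X \<or> (\<exists>k\<ge>1. \<exists>Z\<in>free_spec 4 F3 k. unit_equiv m Y (tuple_dsum X Z))"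
proof -
  note SY = free_spec_F3_SM[OF Y]
  have Xc: "selfadj n (X!j)" "X!j \<in> carrier_mat n n" and Yc: "selfadj m (Y!j)" "Y!j \<in> carrier_mat m m" if "j < 3" for j
    using X SY that by (auto simp: SM_tuple_def selfadj_def)
  have len: "length X = 3" "length Y = 3" using X SY by (auto simp: SM_tuple_def)
  obtain c where c: "mat_adjoint V * V = c \<cdot>\<^sub>m 1\<^sub>m n"
    using intertwiner_isometric[OF X SY V irr tw] by blast
  obtain r where r: "r > 0" "c = complex_of_real r" using gram_trace_pos[OF V nz c] by blast
  define s where "s = 1 / sqrt r"
  have ss: "s * s * r = 1" using r(1) by (simp add: s_def field_simps)
  define w where "w b p = complex_of_real s * V $$ (p,b)" for b p
  have on: "orthonormal_cols m n w"
    unfolding orthonormal_cols_def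
  proof (intro allI impI)
    fix a b assume ab: "a < n" "b < n"
    have "(mat_adjoint V * V) $$ (b,a) = (\<Sum>p<m. cnj (V $$ (p,b)) * V $$ (p,a))"
      using mult_index[OF adjoint_carrier[OF V] V ab(2,1)] V ab by simp
    moreover have "(mat_adjoint V * V) $$ (b,a) = (if a = b then c else 0)" using ab unfolding c by simp
    ultimately have "(\<Sum>p<m. V $$ (p,a) * cnj (V $$ (p,b))) = (if a = b then c else 0)"
      by (simp only: mult.commute)
    then have "ip m (\<lambda>p. V $$ (p,a)) (\<lambda>p. V $$ (p,b)) = (if a = b then c else 0)" by (simp add: ip_def)
    then have "ip m (w a) (w b) = (if a = b then complex_of_real (s * s * r) else 0)"
      by (simp add: w_def[abs_def] ip_lin r)
    then show "ip m (w a) (w b) = (if a = b then 1 else 0)" by (simp add: ss)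
  qed
  show nm: "n \<le> m" by (rule orthonormal_cols_le[OF on])
  obtain u where u: "orthonormal_cols m m u" "\<And>j. j < n \<Longrightarrow> u j = w j"
    using orthonormal_extend[OF on nm] by blast
  define U where "U = colmat m m u"
  have U: "unitary m U" unfolding U_def by (rule colmat_unitary[OF u(1)])
  have Uc: "U \<in> carrier_mat m m" by (simp add: U_def)
  define B where "B j = mat_adjoint U * Y!j * U" for j
  have Bc: "B j \<in> carrier_mat m m" if "j < 3" for j
    unfolding B_def using adjoint_carrier[OF Uc] Yc(2)[OF that] Uc by (meson mult_carrier_mat)
  have Bs: "cnj (B j $$ (b,a)) = B j $$ (a,b)" if "j < 3" "a < m" "b < m" for j a b
    using selfadj_sandwich[OF Yc(1)[OF that(1)] Uc] that by (simp add: selfadj_entry B_def)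
  have B: "B j $$ (a,b) = ip m (act m (Y!j) (u b)) (u a)" if "j < 3" "a < m" "b < m" for j a b
    unfolding B_def U_def by (rule colmat_sandwich[OF Yc(2)[OF that(1)] that(2,3)])
  have Yw: "act m (Y!j) (w b) p = (\<Sum>q<n. X!j $$ (q,b) * w q p)" if j: "j < 3" and b: "b < n" and p: "p < m" for j b p
  proof -
    have "(Y!j * V) $$ (p,b) = (V * X!j) $$ (p,b)" using tw[OF j] by simp
    then have "(\<Sum>k<m. Y!j $$ (p,k) * V $$ (k,b)) = (\<Sum>k<n. V $$ (p,k) * X!j $$ (k,b))"
      using mult_index[OF Yc(2)[OF j] V p b] mult_index[OF V Xc(2)[OF j] p b] by simp
    then have "act m (Y!j) (\<lambda>p. V $$ (p,b)) p = (\<Sum>q<n. X!j $$ (q,b) * V $$ (p,q))"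
      by (simp add: act_def mult.commute)
    then show ?thesis
      unfolding w_def[abs_def] act_scale by (simp add: sum_distrib_left mult.left_commute)
  qed
  have Bn: "B j $$ (a,b) = (if a < n then X!j $$ (a,b) else 0)" if j: "j < 3" and a: "a < m" and b: "b < n" for j a b
  proof -
    have bm: "b < m" using b nm by simp
    have "B j $$ (a,b) = ip m (\<lambda>p. \<Sum>q<n. X!j $$ (q,b) * w q p) (u a)"
      unfolding B[OF j a bm] u(2)[OF b] by (rule ip_cong) (simp_all add: Yw[OF j b])
    also have "\<dots> = (\<Sum>q<n. X!j $$ (q,b) * ip m (w q) (u a))"
      unfolding ip_def sum_distrib_right sum_distrib_left by (subst sum.swap) (simp add: mult.assoc)
    also have "\<dots> = (\<Sum>q<n. if q = a then X!j $$ (q,b) else 0)"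
      using u a nm by (intro sum.cong) (auto simp: orthonormal_cols_def simp flip: u(2))
    finally show ?thesis by simp
  qed
  \<comment> \<open>\<open>unit_equiv\<close> has the adjoint of its witness on the left, so the
    witness is the adjoint of U rather than U.\<close>
  have YB: "Y!j = mat_adjoint (mat_adjoint U) * B j * mat_adjoint U" if "j < 3" for j
    using unitary_conj_conj[OF U Yc(2)[OF that]] by (simp add: B_def)
  show "unit_equiv m Y X \<or> (\<exists>k\<ge>1. \<exists>Z\<in>free_spec 4 F3 k. unit_equiv m Y (tuple_dsum X Z))"
  proof (cases "m = n")
    case True
    have "B j = X!j" if "j < 3" for j
      by (rule eq_matI) (use Bc[OF that] Xc[OF that] Bn[OF that] True in auto)
    then have "unit_equiv m Y X"
      unfolding unit_equiv_def using len Xc YB unitary_adjoint[OF U] True by metis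
    then show ?thesis ..
  next
    case False
    define k where "k = m - n"
    have k: "k \<ge> 1" "n + k = m" using nm False by (auto simp: k_def)
    define W where "W = colmat m k (\<lambda>j. u (n + j))"
    have W: "W \<in> carrier_mat m k" by (simp add: W_def)
    have WW: "mat_adjoint W * W = 1\<^sub>m k"
      unfolding W_def
      by (rule eq_matI) (use u(1) k in \<open>auto simp: colmat_gram orthonormal_cols_def\<close>, simp_all add: colmat_def)
    \<comment> \<open>Compressing Y to the orthogonal complement of the range of V is a matrix
      convex combination with a single term, so Z stays in the free spectrahedron.\<close>
    define Z where "Z = mconv_comb 3 k {0::nat} (\<lambda>_. W) (\<lambda>_. Y)"
    have "mconv_data 3 (free_spec 4 F3) k {0::nat} (\<lambda>_. m) (\<lambda>_. W) (\<lambda>_. Y)"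
      unfolding mconv_data_def using W Y k WW by (auto simp: msum_def)
    then have Z: "Z \<in> free_spec 4 F3 k" unfolding Z_def using k(1) by (rule free_spec_F3_comb)
    note SZ = free_spec_F3_SM[OF Z]
    have Zc: "Z!j \<in> carrier_mat k k" if "j < 3" for j using SZ that by (auto simp: SM_tuple_def selfadj_def)
    have lenZ: "length Z = 3" using SZ by (simp add: SM_tuple_def)
    have Zi: "Z!j $$ (a,b) = B j $$ (n+a,n+b)" if j: "j < 3" and ab: "a < k" "b < k" for j a b
    proof -
      have "Z!j $$ (a,b) = (mat_adjoint W * Y!j * W) $$ (a,b)"
        using ab unfolding Z_def mconv_comb_nth[OF j] by (simp add: msum_def)
      also have "\<dots> = ip m (act m (Y!j) (u (n+b))) (u (n+a))"
        unfolding W_def by (rule colmat_sandwich[OF Yc(2)[OF j] ab])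
      finally show ?thesis using B[OF j] ab k by simp
    qed
    have "tuple_dsum X Z ! j = B j" if j: "j < 3" for j
    proof (rule eq_matI)
      fix a b assume "a < dim_row (B j)" "b < dim_col (B j)"
      then have ab: "a < m" "b < m" using Bc[OF j] by auto
      have r0: "B j $$ (a,b) = 0" if "a < n" "\<not> b < n"
        using Bs[OF j ab] Bn[OF j ab(2) that(1)] that by (metis complex_cnj_zero)
      show "tuple_dsum X Z ! j $$ (a,b) = B j $$ (a,b)"
        using j len lenZ Xc[OF j] Zc[OF j] ab k Bn[OF j ab(1)] Zi[OF j, of "a-n" "b-n"] r0
        by (auto simp: tuple_dsum_def)
    qed (use j len lenZ Xc[OF j] Zc[OF j] Bc[OF j] k in \<open>auto simp: tuple_dsum_def\<close>)
    moreover have "length (tuple_dsum X Z) = 3" using len lenZ by (simp add: tuple_dsum_def)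
    ultimately have "unit_equiv m Y (tuple_dsum X Z)"
      unfolding unit_equiv_def using len Bc YB unitary_adjoint[OF U] by metis
    then show ?thesis using Z k by blast
  qed
qed

theorem free_extremeI:
  assumes X: "X \<in> free_spec 4 F3 n" and rigid: "row_rigid n X" and irr: "irreducible_tuple n X"
  shows "free_extreme 3 (free_spec 4 F3) n X"
  unfolding free_extreme_def
proof (intro conjI allI impI ballI X)
  fix I :: "nat set" and m V Y i
  assume a: "mconv_data 3 (free_spec 4 F3) n I m V Y \<and> (\<forall>i\<in>I. V i \<noteq> 0\<^sub>m (m i) n) \<and> X = mconv_comb 3 n I V Y"
    and i: "i \<in> I"
  show "unit_equiv (m i) (Y i) X \<or> (\<exists>k\<ge>1. \<exists>Z\<in>free_spec 4 F3 k. unit_equiv (m i) (Y i) (tuple_dsum X Z))"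
  proof (rule intertwiner_unit_equiv(2)[OF free_spec_F3_SM[OF X] _ _ _ irr])
    show "Y i \<in> free_spec 4 F3 (m i)" "V i \<in> carrier_mat (m i) n" "V i \<noteq> 0\<^sub>m (m i) n"
      using a i by (auto simp: mconv_data_def)
    have V: "V i \<in> carrier_mat (m i) n" using a i by (simp add: mconv_data_def)
    show "Y i ! j * V i = V i * X!j" if j: "j < 3" for j
    proof -
      have "mconv_comb 3 n I V Y ! k * 1\<^sub>m n = 1\<^sub>m n * X!k" if "k < 3" for k
      proof -
        have "X!k \<in> carrier_mat n n" using free_spec_F3_SM[OF X] that by (simp add: SM_tuple_def selfadj_def)
        then show ?thesis using a by simp
      qed
      then have "Y i ! j * (V i * 1\<^sub>m n) = V i * 1\<^sub>m n * X!j"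
        using a by (intro comb_intertwines[OF rigid free_spec_F3_SM[OF X] _ one_carrier_mat _ i j]) auto
      then show ?thesis using right_mult_one_mat[OF V] by simp
    qed
  qed
qed

text \<open>Suppose W intertwines X with a combination of points of K. By
  \<open>comb_intertwines\<close> each V_i W intertwines X with Y_i, hence is 0 because Y_i lies in
  K. As the V_i* V_i sum to 1, also W = 0. So K is matrix convex, although X has been removed from
  it.\<close>

theorem not_minimal:
  assumes X: "X \<in> free_spec 4 F3 n" and rigid: "row_rigid n X" and irr: "irreducible_tuple n X" and n: "n \<ge> 2"
  shows "\<not> is_min_mcs 3 C (free_spec 4 F3)"
proof
  assume min: "is_min_mcs 3 C (free_spec 4 F3)"
  note SX = free_spec_F3_SM[OF X]
  define tw where "tw m Y W \<longleftrightarrow> W \<in> carrier_mat m n \<and> W \<noteq> 0\<^sub>m m n \<and> (\<forall>j<3. Y!j * W = W * X!j)" for m Y W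
  define K where "K m = {Y \<in> free_spec 4 F3 m. \<not> (\<exists>W. tw m Y W)}" for m
  \<comment> \<open>At level 1 a nonzero intertwiner would force n to be at most 1.\<close>
  have K1: "K 1 = free_spec 4 F3 1"
  proof -
    have "\<not> tw 1 Y W" if "Y \<in> free_spec 4 F3 1" for Y W
      using intertwiner_unit_equiv(1)[OF SX that _ _ irr, of W] n unfolding tw_def by fastforce
    then show ?thesis unfolding K_def by blast
  qed
  have "matrix_convex 3 K"
    unfolding matrix_convex_def
  proof (intro conjI allI impI ballI)
    show "K 0 = {}" by (simp add: K_def free_spec_def)
    show "SM_tuple 3 m Y" if "Y \<in> K m" for m Y using that free_spec_F3_SM by (simp add: K_def)
    fix l :: nat and I :: "nat set" and m V Y
    assume l: "1 \<le> l" and data: "mconv_data 3 K l I m V Y"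
    have data': "mconv_data 3 (free_spec 4 F3) l I m V Y" using data by (auto simp: mconv_data_def K_def)
    define P where "P = mconv_comb 3 l I V Y"
    have P: "P \<in> free_spec 4 F3 l" unfolding P_def by (rule free_spec_F3_comb[OF data' l])
    have "\<not> tw l P W" for W
    proof
      assume "tw l P W"
      then have W: "W \<in> carrier_mat l n" "W \<noteq> 0\<^sub>m l n" "\<And>j. j < 3 \<Longrightarrow> P!j * W = W * X!j" by (auto simp: tw_def)
      have "V i * W = 0\<^sub>m (m i) n" if i: "i \<in> I" for i
      proof (rule ccontr)
        assume "V i * W \<noteq> 0\<^sub>m (m i) n"
        moreover have "V i * W \<in> carrier_mat (m i) n" using data i W by (auto simp: mconv_data_def)
        moreover have "Y i ! j * (V i * W) = V i * W * X!j" if "j < 3" for j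
          using comb_intertwines[OF rigid SX data' W(1) W(3)[unfolded P_def] i that] .
        ultimately show False using data i by (auto simp: mconv_data_def K_def tw_def)
      qed
      then have "act l (V i) (act n W x) q = 0" if "i \<in> I" "q < m i" for i x q
        using act_mult[of "V i" "m i" l W n q x] data W(1) that by (auto simp: mconv_data_def act_def)
      then have Wx: "ip l (act n W x) (act n W x) = 0" for x
        by (subst ip_comb_one[OF data]) (auto simp: ip_def intro!: sum.neutral)
      obtain p k where pk: "p < l" "k < n" "W $$ (p,k) \<noteq> 0"
        using W by (metis eq_matI index_zero_mat carrier_matD)
      have "act n W (\<lambda>q. if q = k then 1 else 0) p = W $$ (p,k)"
        using pk by (simp add: act_def if_distrib cong: if_cong)
      then show False using ip_self_zero[of l "act n W (\<lambda>q. if q = k then 1 else 0)" p] Wx pk by simp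
    qed
    then show "mconv_comb 3 l I V Y \<in> K l" using P by (auto simp: K_def P_def)
  qed
  moreover have "K 1 = lift1 C" using min K1 by (simp add: is_min_mcs_def)
  ultimately have "free_spec 4 F3 n \<subseteq> K n" using min unfolding is_min_mcs_def by blast
  then have "X \<in> K n" using X by blast
  \<comment> \<open>The identity intertwines X with itself, so X is not in K.\<close>
  moreover have "tw n X (1\<^sub>m n)"
    using SX n by (auto simp: tw_def SM_tuple_def selfadj_def) (metis index_one_mat(1) index_zero_mat(1) less_le_trans pos2 zero_neq_one)
  ultimately show False by (auto simp: K_def)
qed

section \<open>Tuples built from real symmetric matrices\<close>

definition realsym :: "nat \<Rightarrow> complex mat \<Rightarrow> bool" where
  "realsym k C \<longleftrightarrow> C \<in> carrier_mat k k \<and>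
     (\<forall>i<k. \<forall>j<k. cnj (C $$ (i,j)) = C $$ (i,j) \<and> C $$ (j,i) = C $$ (i,j))"

abbreviation real_tuple :: "nat \<Rightarrow> complex mat \<Rightarrow> complex mat \<Rightarrow> complex mat \<Rightarrow> complex mat list" where
  "real_tuple k C1 C2 D \<equiv> Xof k [C1, C2, \<i> \<cdot>\<^sub>m D]"

text \<open>After sorting coordinates, the Pauli form of the tuple built from C1, C2 and i D, for the sign
  e = i times epsilon, has the matrix with blocks I, -T, -T* and I, where T is this corner.
  It is real because the imaginary unit of the third matrix cancels the one in e.\<close>

definition corner :: "complex mat \<Rightarrow> complex mat \<Rightarrow> complex mat \<Rightarrow> complex \<Rightarrow> complex mat" where
  "corner C1 C2 D \<epsilon> = four_block_mat C1 (C2 - \<epsilon> \<cdot>\<^sub>m D) (C2 + \<epsilon> \<cdot>\<^sub>m D) (- C1)"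

text \<open>\<open>outer_part\<close> collects the upper halves of x and y,
  \<open>inner_part\<close> the lower halves. The matrices of the tuple are block off-diagonal and
  exchange the two.\<close>

definition outer_part :: "nat \<Rightarrow> (nat \<Rightarrow> complex) \<Rightarrow> (nat \<Rightarrow> complex) \<Rightarrow> nat \<Rightarrow> complex" where
  "outer_part k x y i = (if i < k then x i else y (i - k))"

definition inner_part :: "nat \<Rightarrow> (nat \<Rightarrow> complex) \<Rightarrow> (nat \<Rightarrow> complex) \<Rightarrow> nat \<Rightarrow> complex" where
  "inner_part k x y i = (if i < k then x (k + i) else y i)"

lemma sum_two_blocks: "(\<Sum>i<2*k. f i) = (\<Sum>i<k. f i) + (\<Sum>i<k. f (k+i))" for f :: "nat \<Rightarrow> 'a::comm_monoid_add"
proof -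
  have "{..<2::nat} = {0,1}" by auto
  then show ?thesis using sum_blocks[of f 2 k] by simp
qed

lemma act_four_block:
  assumes "A \<in> carrier_mat k k" "B \<in> carrier_mat k k" "C \<in> carrier_mat k k" "D \<in> carrier_mat k k" "i < k"
  shows "act (2*k) (four_block_mat A B C D) x i = act k A x i + act k B (\<lambda>j. x (k+j)) i"
    and "act (2*k) (four_block_mat A B C D) x (k+i) = act k C x i + act k D (\<lambda>j. x (k+j)) i"
  using assms by (simp_all add: act_def sum_two_blocks)

lemma act_add_mat:
  assumes "A \<in> carrier_mat n n" "B \<in> carrier_mat n n" "i < n"
  shows "act n (A + B) x i = act n A x i + act n B x i"
  unfolding act_def using assms by (simp add: distrib_right sum.distrib)

lemma act_smult_mat:
  assumes "A \<in> carrier_mat n n" "i < n"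
  shows "act n (c \<cdot>\<^sub>m A) x i = c * act n A x i"
  unfolding act_def using assms by (simp add: sum_distrib_left mult.assoc)

lemma act_uminus_mat:
  assumes "A \<in> carrier_mat n n" "i < n"
  shows "act n (- A) x i = - act n A x i"
  unfolding act_def using assms by (simp add: sum_negf)

lemma act_zero_mat: "i < n \<Longrightarrow> act n (0\<^sub>m n n) x i = 0"
  by (simp add: act_def)

lemma conj_mat_real: "realsym k C \<Longrightarrow> conj_mat C = C"
  by (rule eq_matI) (auto simp: conj_mat_def realsym_def)

lemma conj_mat_imag: "realsym k D \<Longrightarrow> conj_mat (\<i> \<cdot>\<^sub>m D) = (- \<i>) \<cdot>\<^sub>m D"
  by (rule eq_matI) (auto simp: conj_mat_def realsym_def)

lemma real_tuple_nth:
  assumes "realsym k C1" "realsym k C2" "realsym k D"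
  shows "real_tuple k C1 C2 D ! 0 = four_block_mat (0\<^sub>m k k) C1 C1 (0\<^sub>m k k)"
    "real_tuple k C1 C2 D ! 1 = four_block_mat (0\<^sub>m k k) C2 C2 (0\<^sub>m k k)"
    "real_tuple k C1 C2 D ! 2 = four_block_mat (0\<^sub>m k k) (\<i> \<cdot>\<^sub>m D) ((- \<i>) \<cdot>\<^sub>m D) (0\<^sub>m k k)"
  using assms by (simp_all add: Xof_def conj_mat_real conj_mat_imag)

lemma real_tuple_SM:
  assumes "realsym k C1" "realsym k C2" "realsym k D"
  shows "SM_tuple 3 (2*k) (real_tuple k C1 C2 D)"
  unfolding SM_tuple_def
proof (intro conjI allI impI)
  show "length (real_tuple k C1 C2 D) = 3" by (simp add: Xof_def)
  fix j :: nat assume "j < 3"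
  from nat3_cases[OF this] show "selfadj (2*k) (real_tuple k C1 C2 D ! j)"
    unfolding selfadj_entry
    by (elim disjE; insert assms) (auto simp del: One_nat_def simp: real_tuple_nth[OF assms] realsym_def)
qed

lemma corner_carrier:
  assumes "realsym k C1" "realsym k C2" "realsym k D"
  shows "corner C1 C2 D \<epsilon> \<in> carrier_mat (2*k) (2*k)"
  using assms by (auto simp: corner_def realsym_def)

lemma act_corner:
  assumes "realsym k C1" "realsym k C2" "realsym k D" "i < k"
  shows "act (2*k) (corner C1 C2 D \<epsilon>) p i
      = act k C1 p i + act k C2 (\<lambda>j. p (k+j)) i - \<epsilon> * act k D (\<lambda>j. p (k+j)) i"
    and "act (2*k) (corner C1 C2 D \<epsilon>) p (k+i)
      = act k C2 p i + \<epsilon> * act k D p i - act k C1 (\<lambda>j. p (k+j)) i"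
proof -
  have c: "C1 \<in> carrier_mat k k" "C2 \<in> carrier_mat k k" "D \<in> carrier_mat k k"
    "\<epsilon> \<cdot>\<^sub>m D \<in> carrier_mat k k" "C2 - \<epsilon> \<cdot>\<^sub>m D \<in> carrier_mat k k"
    "C2 + \<epsilon> \<cdot>\<^sub>m D \<in> carrier_mat k k" "- C1 \<in> carrier_mat k k"
    using assms by (auto simp: realsym_def)
  show "act (2*k) (corner C1 C2 D \<epsilon>) p i
      = act k C1 p i + act k C2 (\<lambda>j. p (k+j)) i - \<epsilon> * act k D (\<lambda>j. p (k+j)) i"
    "act (2*k) (corner C1 C2 D \<epsilon>) p (k+i)
      = act k C2 p i + \<epsilon> * act k D p i - act k C1 (\<lambda>j. p (k+j)) i"
    unfolding corner_def act_four_block[OF c(1,5,6,7) assms(4)]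
    using c assms(4) by (simp_all add: act_minus_mat act_add_mat act_smult_mat act_uminus_mat)
qed

text \<open>All blocks are real symmetric, so transposition only swaps the two off-diagonal blocks.
  Thus T and T* in the form of one sign are the corners of both signs.\<close>

lemma corner_adjoint:
  assumes "realsym k C1" "realsym k C2" "realsym k D" "cnj \<epsilon> = \<epsilon>"
  shows "mat_adjoint (corner C1 C2 D \<epsilon>) = corner C1 C2 D (- \<epsilon>)"
  by (rule eq_matI) (use assms in \<open>auto simp: corner_def realsym_def\<close>)

lemma pauli_real_tuple:
  assumes C: "realsym k C1" "realsym k C2" "realsym k D" and i: "i < k"
  defines "X \<equiv> real_tuple k C1 C2 D" and "T \<equiv> corner C1 C2 D"
  shows "pauli1 (\<i> * \<epsilon>) (2*k) X x y i
      = outer_part k x y i - act (2*k) (T \<epsilon>) (inner_part k x y) i"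
    "pauli2 (\<i> * \<epsilon>) (2*k) X x y i
      = outer_part k x y (k+i) - act (2*k) (T \<epsilon>) (inner_part k x y) (k+i)"
    "pauli1 (\<i> * \<epsilon>) (2*k) X x y (k+i)
      = inner_part k x y i - act (2*k) (T (-\<epsilon>)) (outer_part k x y) i"
    "pauli2 (\<i> * \<epsilon>) (2*k) X x y (k+i)
      = inner_part k x y (k+i) - act (2*k) (T (-\<epsilon>)) (outer_part k x y) (k+i)"
proof -
  have c: "C1 \<in> carrier_mat k k" "C2 \<in> carrier_mat k k" "D \<in> carrier_mat k k"
    "\<i> \<cdot>\<^sub>m D \<in> carrier_mat k k" "(-\<i>) \<cdot>\<^sub>m D \<in> carrier_mat k k" using C by (auto simp: realsym_def)
  note z = zero_carrier_mat[of k k]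
  have aX: "act (2*k) (X!0) x i = act k C1 (\<lambda>j. x (k+j)) i" "act (2*k) (X!0) x (k+i) = act k C1 x i"
    "act (2*k) (X!1) x i = act k C2 (\<lambda>j. x (k+j)) i" "act (2*k) (X!1) x (k+i) = act k C2 x i"
    "act (2*k) (X!2) x i = \<i> * act k D (\<lambda>j. x (k+j)) i" "act (2*k) (X!2) x (k+i) = - \<i> * act k D x i" for x
    unfolding X_def real_tuple_nth[OF C]
    using act_four_block[OF z c(1) c(1) z i] act_four_block[OF z c(2) c(2) z i]
      act_four_block[OF z c(4) c(5) z i] act_smult_mat[OF c(3) i] act_zero_mat[OF i] by simp_all
  have o: "act k A (outer_part k x y) i = act k A x i"
    "act k A (\<lambda>j. outer_part k x y (k+j)) i = act k A y i"
    "act k A (inner_part k x y) i = act k A (\<lambda>j. x (k+j)) i"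
    "act k A (\<lambda>j. inner_part k x y (k+j)) i = act k A (\<lambda>j. y (k+j)) i" for A
    by (auto intro!: act_cong simp: outer_part_def inner_part_def)
  have oi: "outer_part k x y i = x i" "outer_part k x y (k+i) = y i"
    "inner_part k x y i = x (k+i)" "inner_part k x y (k+i) = y (k+i)"
    using i by (auto simp: outer_part_def inner_part_def)
  show "pauli1 (\<i> * \<epsilon>) (2*k) X x y i
      = outer_part k x y i - act (2*k) (T \<epsilon>) (inner_part k x y) i"
    "pauli2 (\<i> * \<epsilon>) (2*k) X x y i
      = outer_part k x y (k+i) - act (2*k) (T \<epsilon>) (inner_part k x y) (k+i)"
    "pauli1 (\<i> * \<epsilon>) (2*k) X x y (k+i)
      = inner_part k x y i - act (2*k) (T (-\<epsilon>)) (outer_part k x y) i"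
    "pauli2 (\<i> * \<epsilon>) (2*k) X x y (k+i)
      = inner_part k x y (k+i) - act (2*k) (T (-\<epsilon>)) (outer_part k x y) (k+i)"
    unfolding pauli1_def pauli2_def aX T_def act_corner[OF C i] o oi by (simp_all add: algebra_simps)
qed

text \<open>Completing the square for the block matrix with blocks I, -T, -T*, I: what remains
  besides the square is |p|^2 - |T p|^2, so positivity means that T is a contraction.\<close>

lemma pform_real_tuple:
  assumes C: "realsym k C1" "realsym k C2" "realsym k D" and \<epsilon>: "cnj \<epsilon> = \<epsilon>"
  defines "X \<equiv> real_tuple k C1 C2 D" and "T \<equiv> corner C1 C2 D"
  shows "pform (\<i> * \<epsilon>) (2*k) X x y x y =
    (let r = outer_part k x y; p = inner_part k x y; l = act (2*k) (T \<epsilon>) p in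
       ip (2*k) (\<lambda>i. r i - l i) (\<lambda>i. r i - l i) + ip (2*k) p p - ip (2*k) l l)"
proof -
  define r where "r = outer_part k x y"
  define p where "p = inner_part k x y"
  define l where "l = act (2*k) (T \<epsilon>) p"
  note P = pauli_real_tuple[OF C, folded X_def T_def, of _ \<epsilon> x y, folded r_def p_def l_def]
  have oi: "i < k \<Longrightarrow> x i = r i" "i < k \<Longrightarrow> y i = r (k+i)" "i < k \<Longrightarrow> x (k+i) = p i" "i < k \<Longrightarrow> y (k+i) = p (k+i)" for i
    by (auto simp: outer_part_def inner_part_def r_def p_def)
  have "pform (\<i> * \<epsilon>) (2*k) X x y x y
      = ip (2*k) (\<lambda>i. r i - l i) r + ip (2*k) (\<lambda>i. p i - act (2*k) (T (-\<epsilon>)) r i) p"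
    unfolding pform_def ip_def sum_two_blocks by (simp add: P oi l_def)
  also have "ip (2*k) (\<lambda>i. p i - act (2*k) (T (-\<epsilon>)) r i) p = ip (2*k) p p - ip (2*k) r l"
    using ip_adjoint[OF corner_carrier[OF C], of \<epsilon> r p] corner_adjoint[OF C \<epsilon>]
    by (simp add: ip_lin T_def l_def)
  finally show ?thesis
    unfolding Let_def r_def[symmetric] p_def[symmetric] l_def[symmetric] by (simp add: ip_lin)
qed

text \<open>The defect $I - T^* T = c u u^*$ makes the kernel of the form consist of
  the pairs (T p, p) with p orthogonal to u.\<close>

definition rank_one_defect :: "nat \<Rightarrow> complex mat \<Rightarrow> real \<Rightarrow> (nat \<Rightarrow> complex) \<Rightarrow> bool" where
  "rank_one_defect N T c u \<longleftrightarrow> c \<ge> 0 \<and> (\<forall>i<N. cnj (u i) = u i) \<and>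
     (\<forall>i<N. \<forall>j<N. (mat_adjoint T * T) $$ (i,j) = (if i = j then 1 else 0) - complex_of_real c * u i * u j)"

lemma gram_entry:
  assumes T: "T \<in> carrier_mat N N" and ij: "i < N" "j < N"
  shows "(mat_adjoint T * T) $$ (i,j) = act N (mat_adjoint T) (act N T (\<lambda>q. if q = j then 1 else 0)) i"
proof -
  have "act N T (\<lambda>q. if q = j then 1 else 0) = (\<lambda>k. T $$ (k,j))"
    using ij(2) by (auto simp: act_def if_distrib cong: if_cong)
  then show ?thesis using mult_index[OF adjoint_carrier[OF T] T ij] by (simp add: act_def)
qed

lemma rank_one_defect_act:
  assumes d: "rank_one_defect N T c u" and T: "T \<in> carrier_mat N N" and i: "i < N"
  shows "act N (mat_adjoint T) (act N T p) i = p i - complex_of_real c * u i * (\<Sum>j<N. u j * p j)"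
proof -
  have "act N (mat_adjoint T) (act N T p) i = act N (mat_adjoint T * T) p i"
    by (rule act_mult[OF adjoint_carrier[OF T] T i, symmetric])
  also have "\<dots> = (\<Sum>j<N. (if j = i then p j else 0) - complex_of_real c * u i * (u j * p j))"
    unfolding act_def
  proof (rule sum.cong)
    fix j assume "j \<in> {..<N}"
    then have g: "(mat_adjoint T * T) $$ (i,j) = (if i = j then 1 else 0) - complex_of_real c * u i * u j"
      using d i by (simp add: rank_one_defect_def)
    show "(mat_adjoint T * T) $$ (i,j) * p j = (if j = i then p j else 0) - complex_of_real c * u i * (u j * p j)"
      unfolding g by (simp add: algebra_simps)
  qed simp
  finally show ?thesis using i by (simp add: sum_subtractf sum_distrib_left)
qed

text \<open>The defect identity turns |p|^2 - |T p|^2 into c |u . p|^2.\<close>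

lemma real_tuple_in_free_spec:
  assumes C: "realsym k C1" "realsym k C2" "realsym k D" and k: "k \<ge> 1"
    and d: "\<And>\<epsilon>. \<epsilon> \<in> {1,-1} \<Longrightarrow> rank_one_defect (2*k) (corner C1 C2 D \<epsilon>) c (u \<epsilon>)"
  shows "real_tuple k C1 C2 D \<in> free_spec 4 F3 (2*k)"
  unfolding free_spec_F3_iff
proof (intro conjI allI impI)
  show "2*k \<noteq> 0" using k by simp
  show "SM_tuple 3 (2*k) (real_tuple k C1 C2 D)" by (rule real_tuple_SM[OF C])
  fix e x y assume e: "e \<in> {\<i>, -\<i>}"
  define \<epsilon> where "\<epsilon> = - \<i> * e"
  have \<epsilon>: "\<epsilon> \<in> {1,-1}" "e = \<i> * \<epsilon>" "cnj \<epsilon> = \<epsilon>" using e by (auto simp: \<epsilon>_def)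
  define r where "r = outer_part k x y"
  define p where "p = inner_part k x y"
  define T where "T = corner C1 C2 D \<epsilon>"
  define l where "l = act (2*k) T p"
  define q where "q = (\<Sum>j<2*k. u \<epsilon> j * p j)"
  have T: "T \<in> carrier_mat (2*k) (2*k)" unfolding T_def by (rule corner_carrier[OF C])
  have u: "cnj (u \<epsilon> i) = u \<epsilon> i" if "i < 2*k" for i using d[OF \<epsilon>(1)] that by (auto simp: rank_one_defect_def)
  have "ip (2*k) l l = ip (2*k) (act (2*k) (mat_adjoint T) l) p"
    by (simp add: ip_adjoint[OF T] l_def)
  also have "\<dots> = ip (2*k) (\<lambda>i. p i - complex_of_real c * q * u \<epsilon> i) p"
    by (rule ip_cong) (simp_all add: l_def rank_one_defect_act[OF d[OF \<epsilon>(1)] T[unfolded T_def], folded T_def] q_def)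
  also have "\<dots> = ip (2*k) p p - complex_of_real c * q * ip (2*k) (u \<epsilon>) p" by (simp add: ip_lin)
  also have "ip (2*k) (u \<epsilon>) p = cnj q" by (simp add: ip_def q_def u)
  finally have l: "ip (2*k) l l = ip (2*k) p p - complex_of_real c * (q * cnj q)" by simp
  have "pform e (2*k) (real_tuple k C1 C2 D) x y x y
      = ip (2*k) (\<lambda>i. r i - l i) (\<lambda>i. r i - l i) + complex_of_real (c * (cmod q)\<^sup>2)"
    unfolding \<epsilon>(2) pform_real_tuple[OF C \<epsilon>(3)] Let_def
    by (simp only: r_def[symmetric] p_def[symmetric] T_def[symmetric] l_def[symmetric] l of_real_mult complex_norm_square) simp
  then show "0 \<le> Re (pform e (2*k) (real_tuple k C1 C2 D) x y x y)"
    using ip_self_nonneg d[OF \<epsilon>(1)] by (simp add: rank_one_defect_def)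
qed

text \<open>If p is orthogonal to u then T* T p = p, so both block rows annihilate the pair (T p,
  p). The vectors x and y are this pair with the sorting of coordinates undone.\<close>

lemma real_tuple_kernel:
  assumes C: "realsym k C1" "realsym k C2" "realsym k D" and \<epsilon>: "\<epsilon> \<in> {1,-1}"
    and d: "rank_one_defect (2*k) (corner C1 C2 D \<epsilon>) c u"
    and p: "(\<Sum>j<2*k. u j * p j) = 0" and i: "i < 2*k"
  defines "l \<equiv> act (2*k) (corner C1 C2 D \<epsilon>) p"
  defines "x \<equiv> (\<lambda>i. if i < k then l i else p (i - k))" and "y \<equiv> (\<lambda>i. if i < k then l (k+i) else p i)"
  shows "pauli1 (\<i> * \<epsilon>) (2*k) (real_tuple k C1 C2 D) x y i = 0 \<and>
    pauli2 (\<i> * \<epsilon>) (2*k) (real_tuple k C1 C2 D) x y i = 0"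
proof -
  have ro: "outer_part k x y j = l j" "inner_part k x y j = p j" if "j < 2*k" for j
    using that by (auto simp: outer_part_def inner_part_def x_def y_def)
  have ac: "act (2*k) A (outer_part k x y) j = act (2*k) A l j"
    "act (2*k) A (inner_part k x y) j = act (2*k) A p j" for A j
    by (auto intro!: act_cong simp: ro)
  have "cnj \<epsilon> = \<epsilon>" using \<epsilon> by auto
  have Tl: "act (2*k) (corner C1 C2 D (-\<epsilon>)) l j = p j" if "j < 2*k" for j
    using rank_one_defect_act[OF d corner_carrier[OF C] that, of p] p
    by (simp add: corner_adjoint[OF C \<open>cnj \<epsilon> = \<epsilon>\<close>] l_def)
  show ?thesis
  proof (cases "i < k")
    case True
    then have "i < 2*k" "k + i < 2*k" by auto
    with True show ?thesis by (simp add: pauli_real_tuple[OF C] ac ro l_def)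
  next
    case False
    define j where "j = i - k"
    have j: "j < k" "i = k + j" using False i by (auto simp: j_def)
    then have "j < 2*k" "k + j < 2*k" by auto
    with j show ?thesis by (simp add: pauli_real_tuple[OF C] ac ro Tl)
  qed
qed

lemma four_block_inject:
  assumes "A \<in> carrier_mat k k" "B \<in> carrier_mat k k" "C \<in> carrier_mat k k" "D \<in> carrier_mat k k"
    "A' \<in> carrier_mat k k" "B' \<in> carrier_mat k k" "C' \<in> carrier_mat k k" "D' \<in> carrier_mat k k"
    and eq: "four_block_mat A B C D = four_block_mat A' B' C' D'"
  shows "A = A' \<and> B = B' \<and> C = C' \<and> D = D'"
proof -
  have e: "four_block_mat A B C D $$ (i,j) = four_block_mat A' B' C' D' $$ (i,j)" for i j using eq by simp
  have "A $$ (i,j) = A' $$ (i,j) \<and> B $$ (i,j) = B' $$ (i,j) \<and> C $$ (i,j) = C' $$ (i,j) \<and> D $$ (i,j) = D' $$ (i,j)"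
    if "i < k" "j < k" for i j
    using that assms(1-8) e[of i j] e[of i "k+j"] e[of "k+i" j] e[of "k+i" "k+j"] by auto
  then show ?thesis using assms(1-8) by (auto intro!: eq_matI)
qed

text \<open>Split H into blocks A, B, F, E. Commuting with the first two matrices makes A - E and B
  - F anticommute with C1 and C2, hence vanish; then A and B commute with C1 and C2 and are scalars
  a and b. The third matrix has the off-diagonal blocks i D and -i D of opposite sign, which forces
  b = -b.\<close>

lemma real_tuple_irreducible:
  assumes C: "realsym k C1" "realsym k C2" "realsym k D" and k: "k \<ge> 1"
    and comm: "\<And>K. K \<in> carrier_mat k k \<Longrightarrow> K * C1 = C1 * K \<Longrightarrow> K * C2 = C2 * K \<Longrightarrow> \<exists>c. K = c \<cdot>\<^sub>m 1\<^sub>m k"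
    and anti: "\<And>K. K \<in> carrier_mat k k \<Longrightarrow> K * C1 = - (C1 * K) \<Longrightarrow> K * C2 = - (C2 * K) \<Longrightarrow> K = 0\<^sub>m k k"
    and D: "D \<noteq> 0\<^sub>m k k"
  shows "irreducible_tuple (2*k) (real_tuple k C1 C2 D)"
  unfolding irreducible_tuple_def
proof (intro ballI impI)
  fix H assume H: "H \<in> carrier_mat (2*k) (2*k)" and HX: "\<forall>j<3. H * real_tuple k C1 C2 D ! j = real_tuple k C1 C2 D ! j * H"
  define A where "A = mat k k (\<lambda>(i,j). H $$ (i,j))"
  define B where "B = mat k k (\<lambda>(i,j). H $$ (i,k+j))"
  define F where "F = mat k k (\<lambda>(i,j). H $$ (k+i,j))"
  define E where "E = mat k k (\<lambda>(i,j). H $$ (k+i,k+j))"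
  have c: "A \<in> carrier_mat k k" "B \<in> carrier_mat k k" "F \<in> carrier_mat k k" "E \<in> carrier_mat k k"
    by (auto simp: A_def B_def F_def E_def)
  have cC: "C1 \<in> carrier_mat k k" "C2 \<in> carrier_mat k k" "D \<in> carrier_mat k k" using C by (auto simp: realsym_def)
  have Hb: "H = four_block_mat A B F E"
    by (rule eq_matI) (use H in \<open>auto simp: A_def B_def F_def E_def\<close>)
  note z = zero_carrier_mat[of k k]
  have prod: "B * N = M * F \<and> A * M = M * E \<and> E * N = N * A \<and> F * M = N * B"
    if "M \<in> carrier_mat k k" "N \<in> carrier_mat k k"
      "H * four_block_mat (0\<^sub>m k k) M N (0\<^sub>m k k) = four_block_mat (0\<^sub>m k k) M N (0\<^sub>m k k) * H" for M N
  proof (rule four_block_inject[of _ k])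
    show "four_block_mat (B * N) (A * M) (E * N) (F * M) = four_block_mat (M * F) (M * E) (N * A) (N * B)"
      using that c by (simp add: Hb mult_four_block_mat[OF c z that(1,2) z] mult_four_block_mat[OF z that(1,2) z c])
  qed (use c that(1,2) in auto)
  have e1: "B * C1 = C1 * F \<and> A * C1 = C1 * E \<and> E * C1 = C1 * A \<and> F * C1 = C1 * B"
    using prod[OF cC(1) cC(1)] HX[rule_format, of 0] real_tuple_nth[OF C] by simp
  have e2: "B * C2 = C2 * F \<and> A * C2 = C2 * E \<and> E * C2 = C2 * A \<and> F * C2 = C2 * B"
    using prod[OF cC(2) cC(2)] HX[rule_format, of 1] real_tuple_nth[OF C] by simp
  have e3: "B * ((-\<i>) \<cdot>\<^sub>m D) = \<i> \<cdot>\<^sub>m D * F"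
    using prod[of "\<i> \<cdot>\<^sub>m D" "(-\<i>) \<cdot>\<^sub>m D"] cC(3) HX[rule_format, of 2] real_tuple_nth[OF C] by simp
  have AE: "A - E = 0\<^sub>m k k"
    using e1 e2 c cC by (intro anti) (auto simp: minus_mult_distrib_mat[of _ k k _ _ k] mult_minus_distrib_mat[of _ k k _ k]
      intro!: eq_matI)
  have BF: "B - F = 0\<^sub>m k k"
    using e1 e2 c cC by (intro anti) (auto simp: minus_mult_distrib_mat[of _ k k _ _ k] mult_minus_distrib_mat[of _ k k _ k]
      intro!: eq_matI)
  have EA: "E = A"
  proof (rule eq_matI)
    fix i j assume "i < dim_row A" "j < dim_col A"
    then show "E $$ (i,j) = A $$ (i,j)" using arg_cong[OF AE, of "\<lambda>M. M $$ (i,j)"] c by auto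
  qed (use c in auto)
  have FB: "F = B"
  proof (rule eq_matI)
    fix i j assume "i < dim_row B" "j < dim_col B"
    then show "F $$ (i,j) = B $$ (i,j)" using arg_cong[OF BF, of "\<lambda>M. M $$ (i,j)"] c by auto
  qed (use c in auto)
  obtain a where a: "A = a \<cdot>\<^sub>m 1\<^sub>m k" using comm[OF c(1)] e1 e2 EA by auto
  obtain b where b: "B = b \<cdot>\<^sub>m 1\<^sub>m k" using comm[OF c(2)] e1 e2 FB by auto
  have "b = 0"
  proof -
    obtain i j where ij: "i < k" "j < k" "D $$ (i,j) \<noteq> 0" using D cC(3) by (metis eq_matI index_zero_mat carrier_matD)
    have "(b \<cdot>\<^sub>m 1\<^sub>m k * ((-\<i>) \<cdot>\<^sub>m D)) $$ (i,j) = (\<i> \<cdot>\<^sub>m D * (b \<cdot>\<^sub>m 1\<^sub>m k)) $$ (i,j)" using e3 FB b by simp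
    moreover have "b \<cdot>\<^sub>m 1\<^sub>m k * ((-\<i>) \<cdot>\<^sub>m D) = b \<cdot>\<^sub>m ((-\<i>) \<cdot>\<^sub>m D)"
      using cC(3) mult_smult_assoc_mat[of "1\<^sub>m k" k k "(-\<i>) \<cdot>\<^sub>m D" k b] left_mult_one_mat[of "(-\<i>) \<cdot>\<^sub>m D" k k] by simp
    moreover have "\<i> \<cdot>\<^sub>m D * (b \<cdot>\<^sub>m 1\<^sub>m k) = b \<cdot>\<^sub>m (\<i> \<cdot>\<^sub>m D)"
      using cC(3) mult_smult_distrib[of "\<i> \<cdot>\<^sub>m D" k k "1\<^sub>m k" k b] right_mult_one_mat[of "\<i> \<cdot>\<^sub>m D" k k] by simp
    ultimately show "b = 0" using ij cC(3) by simp
  qed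
  then have "H = a \<cdot>\<^sub>m 1\<^sub>m (2*k)"
    unfolding Hb EA FB a b by (auto intro!: eq_matI)
  then show "\<exists>c. H = c \<cdot>\<^sub>m 1\<^sub>m (2*k)" ..
qed

section \<open>A linear system\<close>

text \<open>The coefficients of the linear combinations come from Gaussian elimination over
  $Q(\sqrt{2\sqrt 2 - 2})$. The symmetry of the tuple that exchanges the first two coordinates
  splits its linear system into an even and an odd part; a name ending in p or m stands for the
  sum or the difference of the unknowns with the indicated and the next index.\<close>

lemma linear_system6_even:
  fixes a s x0p x2 x3p x5 y0m y3m z0p z2 z3p z5 :: complex
  assumes
    E0: "(2 + 2 * a) * x0p - 4 * a * x2 + 8 * x3p - 8 * s * y0m + (-2 + 6 * a) * z0p + 4 * a * z2 = 0" (is "?e0 = 0") and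
    E1: "(2 - 6 * a) * x0p - 4 * a * x2 + (-2 - 2 * a) * z0p + 4 * a * z2 - 8 * z3p = 0" (is "?e1 = 0") and
    E2: "(2 - 6 * a) * x0p - 4 * a * x2 + (-2 - 2 * a) * z0p + 4 * a * z2 + 8 * z3p = 0" (is "?e2 = 0") and
    E3: "(2 + 2 * a) * x0p - 4 * a * x2 - 8 * x3p - 8 * s * y0m + (-2 + 6 * a) * z0p + 4 * a * z2 = 0" (is "?e3 = 0") and
    E4: "(2 - 4 * s - 2 * a) * x0p - 4 * a * x2 + 4 * x3p + (-4 * s - 4 * a) * y0m + 4 * y3m + (-2 - 4 * s +
      2 * a) * z0p + 4 * a * z2 + 4 * z3p = 0" (is "?e4 = 0") and
    E5: "(2 + 4 * s - 2 * a) * x0p - 4 * a * x2 - 4 * x3p + (-4 * s + 4 * a) * y0m + 4 * y3m + (-2 + 4 * s +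
      2 * a) * z0p + 4 * a * z2 - 4 * z3p = 0" (is "?e5 = 0") and
    E6: "8 * x2 + 8 * x5 + 8 * z2 - 8 * z5 = 0" (is "?e6 = 0") and
    E7: "- 8 * x2 + 8 * x5 - 8 * z2 - 8 * z5 = 0" (is "?e7 = 0") and
    E8: "(2 + 2 * s - 4 * a + 2 * a * s) * x0p + (-2 + 2 * a - 4 * a * s) * x2 + 8 * s * x3p - 8 * a * x5 +
      (2 * s - 16 * a - 6 * a * s) * y0m + (-2 - 2 * s - 12 * a + 6 * a * s) * z0p + (2 - 10 * a + 4 * a *
      s) * z2 = 0" (is "?e8 = 0") and
    E9: "(2 + 2 * s + 12 * a - 6 * a * s) * x0p + (-2 + 10 * a - 4 * a * s) * x2 + (2 * s + 2 * a * s) * y0m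
      + 8 * s * y3m + (-2 - 2 * s + 4 * a - 2 * a * s) * z0p + (2 - 2 * a + 4 * a * s) * z2 - 8 * s * z3p
      + 8 * a * z5 = 0" (is "?e9 = 0") and
    a: "a * a = 1 - 2 * a" and s: "s * s = 2 * a"
  shows "x0p = 0 \<and> x2 = 0 \<and> x3p = 0 \<and> x5 = 0 \<and> y0m = 0 \<and> y3m = 0 \<and> z0p = 0
      \<and> z2 = 0 \<and> z3p = 0 \<and> z5 = 0"
proof -
  have aa: "a * (a * t) = t - 2 * (a * t)" for t
    using arg_cong[OF a, of "\<lambda>c. c * t"] by (simp only: mult.assoc left_diff_distrib mult_1_left)
  have ss: "s * (s * t) = 2 * (a * t)" for t
    using arg_cong[OF s, of "\<lambda>c. c * t"] by (simp only: mult.assoc)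
  note R = a s aa ss
  have "16 * z3p = - ?e1 + ?e2"
    by (simp add: algebra_simps R)
  then have z3p: "z3p = 0" unfolding E1 E2 by simp
  have "16 * x3p = ?e0 - ?e3"
    by (simp add: algebra_simps R z3p)
  then have x3p: "x3p = 0" unfolding E0 E3 by simp
  have "8 * y3m = - ?e0 - ?e1 + ?e4 + ?e5"
    by (simp add: algebra_simps R z3p x3p)
  then have y3m: "y3m = 0" unfolding E0 E1 E4 E5 by simp
  have "8 * y0m = (-s - a) * ?e0 + (s - a) * ?e1 + 2 * a * ?e5"
    by (simp add: algebra_simps R z3p x3p y3m)
  then have y0m: "y0m = 0" unfolding E0 E1 E5 by simp
  have "32 * z0p = (3 + 2 * s + 3 * a) * ?e0 + (-5 + 2 * s - a) * ?e2 - a * ?e6 - a * ?e7 - 2 * ?e8 - 2 * ?e9"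
    by (simp add: algebra_simps R z3p x3p y3m y0m)
  then have z0p: "z0p = 0" unfolding E0 E2 E6 E7 E8 E9 by simp
  have "8 * x0p = (2 + a) * ?e0 + (-2 - a) * ?e2"
    by (simp add: algebra_simps R z3p x3p y3m y0m z0p)
  then have x0p: "x0p = 0" unfolding E0 E2 by simp
  have "32 * x2 = (-8 - 4 * a) * ?e0 + ?e6 - ?e7"
    by (simp add: algebra_simps R z3p x3p y3m y0m z0p x0p)
  then have x2: "x2 = 0" unfolding E0 E6 E7 by simp
  have "4 * z2 = (2 + a) * ?e5"
    by (simp add: algebra_simps R z3p x3p y3m y0m z0p x0p x2)
  then have z2: "z2 = 0" unfolding E5 by simp
  have "8 * z5 = (2 + a) * ?e9"
    by (simp add: algebra_simps R z3p x3p y3m y0m z0p x0p x2 z2)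
  then have z5: "z5 = 0" unfolding E9 by simp
  have "8 * x5 = ?e7"
    by (simp add: algebra_simps R z3p x3p y3m y0m z0p x0p x2 z2 z5)
  then have x5: "x5 = 0" unfolding E7 by simp
  show ?thesis using z3p x3p y3m y0m z0p x0p x2 z2 z5 x5 by blast
qed

lemma linear_system6_odd:
  fixes a s x0m x3m y0p y2 y3p y5 z0m z3m :: complex
  assumes
    E0: "(-2 + 6 * a) * y0p + 4 * a * y2 - 8 * s * z0m = 0" (is "?e0 = 0") and
    E1: "8 * s * x0m + (2 + 2 * a) * y0p - 4 * a * y2 + 8 * y3p = 0" (is "?e1 = 0") and
    E2: "- 8 * s * x0m + (-2 - 2 * a) * y0p + 4 * a * y2 + 8 * y3p = 0" (is "?e2 = 0") and
    E3: "(2 - 6 * a) * y0p - 4 * a * y2 + 8 * s * z0m = 0" (is "?e3 = 0") and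
    E4: "(-4 * s + 4 * a) * x0m + 4 * x3m + (-2 - 4 * s + 2 * a) * y0p + 4 * a * y2 + 4 * y3p + (-4 * s - 4 *
      a) * z0m + 4 * z3m = 0" (is "?e4 = 0") and
    E5: "(4 * s + 4 * a) * x0m - 4 * x3m + (2 - 4 * s - 2 * a) * y0p - 4 * a * y2 + 4 * y3p + (4 * s - 4 * a)
      * z0m - 4 * z3m = 0" (is "?e5 = 0") and
    E6: "8 * y2 - 8 * y5 = 0" (is "?e6 = 0") and
    E7: "8 * y2 + 8 * y5 = 0" (is "?e7 = 0") and
    E8: "(2 * s + 2 * a * s) * x0m + 8 * s * x3m + (-2 - 2 * s - 12 * a + 6 * a * s) * y0p + (2 - 10 * a + 4
      * a * s) * y2 + (2 * s - 16 * a - 6 * a * s) * z0m = 0" (is "?e8 = 0") and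
    E9: "(-2 * s + 16 * a + 6 * a * s) * x0m + (2 + 2 * s - 4 * a + 2 * a * s) * y0p + (-2 + 2 * a - 4 * a *
      s) * y2 + 8 * s * y3p - 8 * a * y5 + (-2 * s - 2 * a * s) * z0m - 8 * s * z3m = 0" (is "?e9 = 0") and
    a: "a * a = 1 - 2 * a" and s: "s * s = 2 * a"
  shows "x0m = 0 \<and> x3m = 0 \<and> y0p = 0 \<and> y2 = 0 \<and> y3p = 0 \<and> y5 = 0 \<and> z0m = 0
      \<and> z3m = 0"
proof -
  have aa: "a * (a * t) = t - 2 * (a * t)" for t
    using arg_cong[OF a, of "\<lambda>c. c * t"] by (simp only: mult.assoc left_diff_distrib mult_1_left)
  have ss: "s * (s * t) = 2 * (a * t)" for t
    using arg_cong[OF s, of "\<lambda>c. c * t"] by (simp only: mult.assoc)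
  note R = a s aa ss
  have "16 * y5 = - ?e6 + ?e7"
    by (simp add: algebra_simps R)
  then have y5: "y5 = 0" unfolding E6 E7 by simp
  have "8 * y2 = ?e7"
    by (simp add: algebra_simps R y5)
  then have y2: "y2 = 0" unfolding E7 by simp
  have "16 * y3p = ?e1 + ?e2"
    by (simp add: algebra_simps R y5 y2)
  then have y3p: "y3p = 0" unfolding E1 E2 by simp
  have "8 * y0p = a * ?e0 + a * ?e1 - s * ?e4 - s * ?e5"
    by (simp add: algebra_simps R y5 y2 y3p)
  then have y0p: "y0p = 0" unfolding E0 E1 E4 E5 by simp
  have "16 * x0m = (2 * s + a * s) * ?e1"
    by (simp add: algebra_simps R y5 y2 y3p y0p)
  then have x0m: "x0m = 0" unfolding E1 by simp
  have "16 * z0m = (2 * s + a * s) * ?e3"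
    by (simp add: algebra_simps R y5 y2 y3p y0p x0m)
  then have z0m: "z0m = 0" unfolding E3 by simp
  have "16 * z3m = (-2 * s - a * s) * ?e9"
    by (simp add: algebra_simps R y5 y2 y3p y0p x0m z0m)
  then have z3m: "z3m = 0" unfolding E9 by simp
  have "4 * x3m = ?e4"
    by (simp add: algebra_simps R y5 y2 y3p y0p x0m z0m z3m)
  then have x3m: "x3m = 0" unfolding E4 by simp
  show ?thesis using y5 y2 y3p y0p x0m z0m z3m x3m by blast
qed

section \<open>The explicit tuples\<close>

text \<open>The system of \<open>row_rigid\<close> is evaluated only at the kernel vectors (T p, p).
  The substitution z = i r3 turns e r3 into the sign times z, so no imaginary unit is left in the
  coefficients.\<close>

lemma real_tuple_rigidI:
  assumes C: "realsym k C1" "realsym k C2" "realsym k D"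
    and d: "\<And>\<epsilon>. \<epsilon> \<in> {1,-1} \<Longrightarrow> rank_one_defect (2*k) (corner C1 C2 D \<epsilon>) c (u \<epsilon>)"
    and main: "\<And>x y z. (\<And>\<epsilon> p l. \<epsilon> \<in> {1,-1} \<Longrightarrow> (\<Sum>j<2*k. u \<epsilon> j * p j) = 0 \<Longrightarrow>
        l = act (2*k) (corner C1 C2 D \<epsilon>) p \<Longrightarrow>
        (\<Sum>i<k. x i * l i + x (k+i) * p i + (y i + \<epsilon> * z i) * l (k+i) + (y (k+i) + \<epsilon> * z (k+i)) * p (k+i)) = 0 \<and>
        (\<Sum>i<k. (y i - \<epsilon> * z i) * l i + (y (k+i) - \<epsilon> * z (k+i)) * p i - x i * l (k+i) - x (k+i) * p (k+i)) = 0)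
      \<Longrightarrow> \<forall>m<2*k. x m = 0 \<and> y m = 0 \<and> z m = 0"
  shows "row_rigid (2*k) (real_tuple k C1 C2 D)"
  unfolding row_rigid_def
proof (intro allI impI)
  fix r1 r2 r3 m
  assume H: "\<forall>e x y. e \<in> {\<i>, -\<i>} \<and> (\<forall>i<2*k. pauli1 e (2*k) (real_tuple k C1 C2 D) x y i = 0 \<and>
        pauli2 e (2*k) (real_tuple k C1 C2 D) x y i = 0) \<longrightarrow>
        (\<Sum>j<2*k. r1 j * x j + r2 j * y j + e * (r3 j * y j)) = 0 \<and>
        (\<Sum>j<2*k. r2 j * x j - r1 j * y j - e * (r3 j * x j)) = 0" and m: "m < 2*k"
  define z where "z i = \<i> * r3 i" for i
  have "\<forall>m<2*k. r1 m = 0 \<and> r2 m = 0 \<and> z m = 0"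
  proof (rule main)
    fix \<epsilon> :: complex and p l
    assume \<epsilon>: "\<epsilon> \<in> {1,-1}" and p: "(\<Sum>j<2*k. u \<epsilon> j * p j) = 0"
      and l: "l = act (2*k) (corner C1 C2 D \<epsilon>) p"
    define x where "x = (\<lambda>i. if i < k then l i else p (i - k))"
    define y where "y = (\<lambda>i. if i < k then l (k+i) else p i)"
    have "pauli1 (\<i> * \<epsilon>) (2*k) (real_tuple k C1 C2 D) x y i = 0 \<and>
        pauli2 (\<i> * \<epsilon>) (2*k) (real_tuple k C1 C2 D) x y i = 0" if "i < 2*k" for i
      unfolding x_def y_def l by (rule real_tuple_kernel[OF C \<epsilon> d[OF \<epsilon>] p that])
    moreover have "\<i> * \<epsilon> \<in> {\<i>, -\<i>}" using \<epsilon> by auto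
    ultimately have "(\<Sum>j<2*k. r1 j * x j + r2 j * y j + \<i> * \<epsilon> * (r3 j * y j)) = 0 \<and>
        (\<Sum>j<2*k. r2 j * x j - r1 j * y j - \<i> * \<epsilon> * (r3 j * x j)) = 0"
      using H by blast
    then show "(\<Sum>i<k. r1 i * l i + r1 (k+i) * p i + (r2 i + \<epsilon> * z i) * l (k+i) + (r2 (k+i) + \<epsilon> * z (k+i)) * p (k+i)) = 0 \<and>
        (\<Sum>i<k. (r2 i - \<epsilon> * z i) * l i + (r2 (k+i) - \<epsilon> * z (k+i)) * p i - r1 i * l (k+i) - r1 (k+i) * p (k+i)) = 0"
      unfolding sum_two_blocks sum.distrib[symmetric] sum_subtractf[symmetric]
      by (simp add: x_def y_def z_def algebra_simps sum.distrib sum_subtractf)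
  qed
  then show "r1 m = 0 \<and> r2 m = 0 \<and> r3 m = 0" using m by (simp add: z_def)
qed

lemma commute_entry:
  assumes "K \<in> carrier_mat k k" "M \<in> carrier_mat k k" "K * M = M * K" "i < k" "j < k"
  shows "(\<Sum>q<k. K $$ (i,q) * M $$ (q,j)) = (\<Sum>q<k. M $$ (i,q) * K $$ (q,j))"
  using mult_index[OF assms(1,2,4,5)] mult_index[OF assms(2,1,4,5)] assms(3) by simp

lemma anticommute_entry:
  assumes "K \<in> carrier_mat k k" "M \<in> carrier_mat k k" "K * M = - (M * K)" "i < k" "j < k"
  shows "(\<Sum>q<k. K $$ (i,q) * M $$ (q,j)) = - (\<Sum>q<k. M $$ (i,q) * K $$ (q,j))"
  using mult_index[OF assms(1,2,4,5)] mult_index[OF assms(2,1,4,5)] assms by simp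

lemma mat2_eqI:
  assumes "A \<in> carrier_mat 2 2" "B \<in> carrier_mat 2 2"
    "\<And>i j. i \<in> {0,1} \<Longrightarrow> j \<in> {0,1} \<Longrightarrow> A $$ (i,j) = B $$ (i,j)"
  shows "A = B"
  by (rule eq_matI) (use assms less_2_cases in auto)

lemma mat3_eqI:
  assumes "A \<in> carrier_mat 3 3" "B \<in> carrier_mat 3 3"
    "\<And>i j. i \<in> {0,1,2} \<Longrightarrow> j \<in> {0,1,2} \<Longrightarrow> A $$ (i,j) = B $$ (i,j)"
  shows "A = B"
  by (rule eq_matI) (use assms nat3_cases in auto)

lemma lessThan_small:
  "{..<2::nat} = {0,1}" "{..<3::nat} = {0,1,2}" "{..<4::nat} = {0,1,2,3}" "{..<6::nat} = {0,1,2,3,4,5}"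
  by auto

section \<open>The tuple of size 4\<close>

abbreviation rt3 :: complex where "rt3 \<equiv> complex_of_real (sqrt 3)"

text \<open>The second equation reaches the right-nested products that \<open>algebra_simps\<close>
  produces.\<close>

lemma rt3_sq: "rt3 * rt3 = 3" "rt3 * (rt3 * t) = 3 * t"
proof -
  have "rt3 * rt3 = complex_of_real (sqrt 3 * sqrt 3)" by (simp only: of_real_mult)
  then show r: "rt3 * rt3 = 3" by simp
  show "rt3 * (rt3 * t) = 3 * t" by (simp only: mult.assoc[symmetric] r)
qed

definition C4a :: "complex mat" where "C4a = mat_of_rows_list 2 [[(3 + rt3) / 6, 0], [0, (rt3 - 1) / 2]]"
definition C4b :: "complex mat" where "C4b = mat_of_rows_list 2 [[0, 1/2], [1/2, 0]]"
definition D4 :: "complex mat" where "D4 = mat_of_rows_list 2 [[(2 * rt3 - 3) / 6, 0], [0, -1/2]]"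

lemmas C4_defs = C4a_def C4b_def D4_def mat_of_rows_list_def

lemma inverse_rt3: "1 / rt3 = rt3 / 3" "\<i> / rt3 = \<i> * rt3 / 3"
  using rt3_sq by (simp_all add: field_simps)

lemma C4_real_tuple: "Xof 2 C4 = real_tuple 2 C4a C4b D4"
proof -
  have "C4 = [C4a, C4b, \<i> \<cdot>\<^sub>m D4]"
    unfolding C4_def list.map
    by (intro arg_cong2[of _ _ _ _ Cons] refl mat2_eqI)
       (auto simp: C4_defs of_real_divide inverse_rt3 field_simps rt3_sq)
  then show ?thesis by simp
qed

lemma realsym_C4: "realsym 2 C4a" "realsym 2 C4b" "realsym 2 D4"
  by (auto simp: realsym_def C4_defs less_2_cases_iff)

lemma act_C4:
  "act 2 C4a q 0 = (3 + rt3) / 6 * q 0" "act 2 C4a q 1 = (rt3 - 1) / 2 * q 1"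
    "act 2 C4b q 0 = q 1 / 2" "act 2 C4b q 1 = q 0 / 2"
    "act 2 D4 q 0 = (2 * rt3 - 3) / 6 * q 0" "act 2 D4 q 1 = - q 1 / 2"
  by (simp_all add: act_def lessThan_small C4_defs)

lemma act_corner4:
  "act 4 (corner C4a C4b D4 \<epsilon>) p 0 = ((3 + rt3) * p 0 - \<epsilon> * (2 * rt3 - 3) * p 2 + 3 * p 3) / 6"
  "act 4 (corner C4a C4b D4 \<epsilon>) p 1 = ((3 * rt3 - 3) * p 1 + 3 * p 2 + 3 * \<epsilon> * p 3) / 6"
  "act 4 (corner C4a C4b D4 \<epsilon>) p 2 = (3 * p 1 + \<epsilon> * (2 * rt3 - 3) * p 0 - (3 + rt3) * p 2) / 6"
  "act 4 (corner C4a C4b D4 \<epsilon>) p 3 = (3 * p 0 - 3 * \<epsilon> * p 1 - (3 * rt3 - 3) * p 3) / 6"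
  using act_corner[OF realsym_C4, of 0 \<epsilon> p] act_corner[OF realsym_C4, of 1 \<epsilon> p]
  by (simp_all del: One_nat_def add_2_eq_Suc add: act_C4)

text \<open>Eigenvector of I - T* T for its only nonzero eigenvalue. The squared norm is 8, so with
  the constant of \<open>defect4\<close> the corner T has the singular value 1 three times and one
  with square 1 - 8 (sqrt 3 - 1)/6.\<close>

definition u4 :: "complex \<Rightarrow> nat \<Rightarrow> complex" where "u4 \<epsilon> i = [1, \<epsilon> * rt3, \<epsilon>, - rt3] ! i"

lemma defect4:
  assumes "\<epsilon> \<in> {1,-1}"
  shows "rank_one_defect (2*2) (corner C4a C4b D4 \<epsilon>) ((sqrt 3 - 1) / 6) (u4 \<epsilon>)"
proof -
  have e: "cnj \<epsilon> = \<epsilon>" "\<epsilon> * \<epsilon> = 1" using assms by auto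
  have ee: "\<epsilon> * (\<epsilon> * t) = t" for t by (simp only: mult.assoc[symmetric] e mult_1_left)
  note Tc = corner_carrier[OF realsym_C4]
  have g: "(mat_adjoint (corner C4a C4b D4 \<epsilon>) * corner C4a C4b D4 \<epsilon>) $$ (i,j)
      = act 4 (corner C4a C4b D4 (-\<epsilon>)) (act 4 (corner C4a C4b D4 \<epsilon>) (\<lambda>q. if q = j then 1 else 0)) i"
    if "i < 4" "j < 4" for i j
    using gram_entry[OF Tc, of i j \<epsilon>] that by (simp add: corner_adjoint[OF realsym_C4 e(1)])
  have "(mat_adjoint (corner C4a C4b D4 \<epsilon>) * corner C4a C4b D4 \<epsilon>) $$ (i,j)
      = (if i = j then 1 else 0) - complex_of_real ((sqrt 3 - 1) / 6) * u4 \<epsilon> i * u4 \<epsilon> j"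
    if "i < 4" "j < 4" for i j
    unfolding g[OF that]
    using nat4_cases[OF that(1)] nat4_cases[OF that(2)]
    by (elim disjE; simp only:; simp del: One_nat_def add: act_corner4 u4_def; simp add: field_simps rt3_sq e ee)
  moreover have "cnj (u4 \<epsilon> i) = u4 \<epsilon> i" if "i < 4" for i
    using nat4_cases[OF that] by (auto simp: u4_def e)
  ultimately show ?thesis unfolding rank_one_defect_def by simp
qed

text \<open>\<open>C4a\<close> is diagonal with distinct entries and \<open>C4b\<close> exchanges
  the coordinates, so only scalars commute with both. No two diagonal entries of \<open>C4a\<close>,
  equal or not, have sum 0, so only 0 anticommutes with it.\<close>

lemma C4_irreducible: "irreducible_tuple 4 (real_tuple 2 C4a C4b D4)"
proof -
  have c: "C4a \<in> carrier_mat 2 2" "C4b \<in> carrier_mat 2 2" using realsym_C4 by (auto simp: realsym_def)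
  have "(3 + rt3) * (3 - rt3) = 6" "(rt3 + 1) * (rt3 - 1) = 2" by (simp_all add: algebra_simps rt3_sq)
  then have nz0: "rt3 \<noteq> 0" "3 - rt3 \<noteq> 0" "3 + rt3 \<noteq> 0" "rt3 - 1 \<noteq> 0" by (auto simp del: of_real_eq_0_iff) 
  have "irreducible_tuple (2*2) (real_tuple 2 C4a C4b D4)"
  proof (rule real_tuple_irreducible[OF realsym_C4])
    fix K assume K: "K \<in> carrier_mat 2 2" and k1: "K * C4a = C4a * K" and k2: "K * C4b = C4b * K"
    note e = commute_entry[OF K]
    have "(3 - rt3) * K $$ (0,1) = 0" "(3 - rt3) * K $$ (1,0) = 0"
      using e[OF c(1) k1, of 0 1] e[OF c(1) k1, of 1 0] by (simp_all add: lessThan_small C4_defs field_simps)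
    then have k: "K $$ (0,1) = 0" "K $$ (1,0) = 0" using nz0 by auto
    have "K $$ (1,1) = K $$ (0,0)"
      using e[OF c(2) k2, of 0 1] by (simp add: lessThan_small C4_defs field_simps)
    then have "K = K $$ (0,0) \<cdot>\<^sub>m 1\<^sub>m 2" using K by (intro mat2_eqI) (auto simp: k[simplified])
    then show "\<exists>c. K = c \<cdot>\<^sub>m 1\<^sub>m 2" ..
  next
    fix K assume K: "K \<in> carrier_mat 2 2" and k1: "K * C4a = - (C4a * K)" and k2: "K * C4b = - (C4b * K)"
    note e = anticommute_entry[OF K]
    have z: "c * x = 0" if "x * c = - (c * x)" for c x :: complex
    proof -
      have "2 * (c * x) = x * c + c * x" by simp
      also have "\<dots> = 0" by (simp only: that) simp
      finally show ?thesis by simp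
    qed
    have "(3 + rt3) / 6 * K $$ (0,0) = 0"
      by (rule z) (use e[OF c(1) k1, of 0 0] in \<open>simp add: lessThan_small C4_defs\<close>)
    moreover have "(rt3 - 1) / 2 * K $$ (1,1) = 0"
      by (rule z) (use e[OF c(1) k1, of 1 1] in \<open>simp add: lessThan_small C4_defs\<close>)
    moreover have "rt3 * K $$ (0,1) = 0"
    proof -
      have "K $$ (0,1) * ((rt3 - 1) / 2) = - ((3 + rt3) / 6 * K $$ (0,1))"
        using e[OF c(1) k1, of 0 1] by (simp add: lessThan_small C4_defs)
      moreover have "rt3 * K $$ (0,1) = 3/2 * (K $$ (0,1) * ((rt3 - 1) / 2) + (3 + rt3) / 6 * K $$ (0,1))"
        by (simp add: field_simps)
      ultimately show ?thesis by simp
    qed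
    moreover have "rt3 * K $$ (1,0) = 0"
    proof -
      have "K $$ (1,0) * ((3 + rt3) / 6) = - ((rt3 - 1) / 2 * K $$ (1,0))"
        using e[OF c(1) k1, of 1 0] by (simp add: lessThan_small C4_defs)
      moreover have "rt3 * K $$ (1,0) = 3/2 * (K $$ (1,0) * ((3 + rt3) / 6) + (rt3 - 1) / 2 * K $$ (1,0))"
        by (simp add: field_simps)
      ultimately show ?thesis by simp
    qed
    ultimately have k: "K $$ (0,0) = 0" "K $$ (1,1) = 0" "K $$ (0,1) = 0" "K $$ (1,0) = 0"
      using nz0 by auto
    show "K = 0\<^sub>m 2 2" using K by (intro mat2_eqI) (auto simp: k[simplified])
  next
    show "D4 \<noteq> 0\<^sub>m 2 2"
    proof
      assume "D4 = 0\<^sub>m 2 2"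
      then have "D4 $$ (1,1) = 0\<^sub>m 2 2 $$ (1,1)" by (rule arg_cong)
      then show False by (simp add: C4_defs)
    qed
  qed simp
  then show ?thesis by simp
qed

text \<open>Three vectors p for each sign and two equations for each vector give a square system in
  the 12 unknowns. It is inverted explicitly.\<close>

lemma C4_rigid: "row_rigid 4 (real_tuple 2 C4a C4b D4)"
proof -
  have "row_rigid (2*2) (real_tuple 2 C4a C4b D4)"
  proof (rule real_tuple_rigidI[OF realsym_C4 defect4])
    fix x y z :: "nat \<Rightarrow> complex"
    assume H: "\<And>\<epsilon> p l. \<epsilon> \<in> {1,-1} \<Longrightarrow> (\<Sum>j<2*2. u4 \<epsilon> j * p j) = 0 \<Longrightarrow>
        l = act (2*2) (corner C4a C4b D4 \<epsilon>) p \<Longrightarrow>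
        (\<Sum>i<2. x i * l i + x (2+i) * p i + (y i + \<epsilon> * z i) * l (2+i) + (y (2+i) + \<epsilon> * z (2+i)) * p (2+i)) = 0 \<and>
        (\<Sum>i<2. (y i - \<epsilon> * z i) * l i + (y (2+i) - \<epsilon> * z (2+i)) * p i - x i * l (2+i) - x (2+i) * p (2+i)) = 0"
    \<comment> \<open>\<open>f\<close> and \<open>g\<close> are 6 times the two equations, which
      removes the denominators of \<open>act_corner4\<close>.\<close>
    define f where "f \<epsilon> p0 p1 p2 p3 =
      x 0 * ((3 + rt3) * p0 - \<epsilon> * (2 * rt3 - 3) * p2 + 3 * p3) + x 1 * ((3 * rt3 - 3) * p1 + 3 * p2 + 3 * \<epsilon> * p3) + 6 * x 2 * p0 + 6 * x 3 * p1 + (y 0 + \<epsilon> * z 0) * (3 * p1 + \<epsilon> * (2 * rt3 - 3) * p0 - (3 + rt3) * p2) + (y 1 + \<epsilon> * z 1) * (3 * p0 - 3 * \<epsilon> * p1 - (3 * rt3 - 3) * p3) + 6 * (y 2 + \<epsilon> * z 2) * p2 + 6 * (y 3 + \<epsilon> * z 3) * p3" for \<epsilon> p0 p1 p2 p3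
    define g where "g \<epsilon> p0 p1 p2 p3 =
      (y 0 - \<epsilon> * z 0) * ((3 + rt3) * p0 - \<epsilon> * (2 * rt3 - 3) * p2 + 3 * p3) + (y 1 - \<epsilon> * z 1) * ((3 * rt3 - 3) * p1 + 3 * p2 + 3 * \<epsilon> * p3) + 6 * (y 2 - \<epsilon> * z 2) * p0 + 6 * (y 3 - \<epsilon> * z 3) * p1 - x 0 * (3 * p1 + \<epsilon> * (2 * rt3 - 3) * p0 - (3 + rt3) * p2) - x 1 * (3 * p0 - 3 * \<epsilon> * p1 - (3 * rt3 - 3) * p3) - 6 * x 2 * p2 - 6 * x 3 * p3" for \<epsilon> p0 p1 p2 p3
    have fg: "f \<epsilon> p0 p1 p2 p3 = 0 \<and> g \<epsilon> p0 p1 p2 p3 = 0" if "\<epsilon> \<in> {1,-1}" "p0 + \<epsilon> * rt3 * p1 + \<epsilon> * p2 - rt3 * p3 = 0" for \<epsilon> p0 p1 p2 p3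
    proof -
      let ?p = "\<lambda>i. [p0, p1, p2, p3] ! i"
      have "(\<Sum>j<2*2. u4 \<epsilon> j * ?p j) = p0 + \<epsilon> * rt3 * p1 + \<epsilon> * p2 - rt3 * p3"
        by (simp add: lessThan_small u4_def algebra_simps)
      then have up: "(\<Sum>j<2*2. u4 \<epsilon> j * ?p j) = 0"
        using that(2) by simp
      define l where "l = act (2*2) (corner C4a C4b D4 \<epsilon>) ?p"
      note h = H[OF that(1) up l_def]
      have "f \<epsilon> p0 p1 p2 p3 = 6 * (\<Sum>i<2. x i * l i + x (2+i) * ?p i + (y i + \<epsilon> * z i) * l (2+i)
          + (y (2+i) + \<epsilon> * z (2+i)) * ?p (2+i))"
        unfolding l_def by (simp del: One_nat_def add_2_eq_Suc add: lessThan_small act_corner4 f_def; simp add: field_simps)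
      moreover have "g \<epsilon> p0 p1 p2 p3 = 6 * (\<Sum>i<2. (y i - \<epsilon> * z i) * l i + (y (2+i) - \<epsilon> * z (2+i)) * ?p i
          - x i * l (2+i) - x (2+i) * ?p (2+i))"
        unfolding l_def by (simp del: One_nat_def add_2_eq_Suc add: lessThan_small act_corner4 g_def; simp add: field_simps)
      ultimately show ?thesis unfolding h[THEN conjunct1] h[THEN conjunct2] by simp
    qed
    note R = algebra_simps rt3_sq
    \<comment> \<open>The vectors of \<open>k1\<close> to \<open>k3\<close> span the complement of
      \<open>u4 1\<close>, those of \<open>k4\<close> to \<open>k6\<close> the complement of
      \<open>u4 (-1)\<close>.\<close>
    have k1: "f 1 1 0 (-1) 0 = 0 \<and> g 1 1 0 (-1) 0 = 0"
      by (rule fg) (simp_all add: R)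
    have k2: "f 1 0 1 0 1 = 0 \<and> g 1 0 1 0 1 = 0"
      by (rule fg) (simp_all add: R)
    have k3: "f 1 rt3 (-1) 0 0 = 0 \<and> g 1 rt3 (-1) 0 0 = 0"
      by (rule fg) (simp_all add: R)
    have k4: "f (-1) 1 0 1 0 = 0 \<and> g (-1) 1 0 1 0 = 0"
      by (rule fg) (simp_all add: R)
    have k5: "f (-1) 0 1 0 (-1) = 0 \<and> g (-1) 0 1 0 (-1) = 0"
      by (rule fg) (simp_all add: R)
    have k6: "f (-1) rt3 1 0 0 = 0 \<and> g (-1) rt3 1 0 0 = 0"
      by (rule fg) (simp_all add: R)
    \<comment> \<open>This and the next eleven combinations are the rows of the inverse of the 12 by
      12 matrix, with denominators cleared.\<close>
    have "144 * x 0 = (-3 + rt3) * f 1 1 0 (-1) 0 + (-3 - rt3) * g 1 1 0 (-1) 0 + (3 + rt3) * f 1 0 1 0 1 + (-3 + rt3) * g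
      1 0 1 0 1 + 2 * rt3 * f 1 rt3 (-1) 0 0 + 2 * rt3 * g 1 rt3 (-1) 0 0 + (-3 + rt3) * f (-1) 1 0 1 0 +
      (3 + rt3) * g (-1) 1 0 1 0 + (-3 - rt3) * f (-1) 0 1 0 (-1) + (-3 + rt3) * g (-1) 0 1 0 (-1) + 2 *
      rt3 * f (-1) rt3 1 0 0 - 2 * rt3 * g (-1) rt3 1 0 0"
      by (simp add: f_def g_def R)
    then have x0: "x 0 = 0" by (simp add: k1 k2 k3 k4 k5 k6)
    have "48 * x 1 = (1 - rt3) * f 1 1 0 (-1) 0 + (1 + rt3) * g 1 1 0 (-1) 0 + (1 + rt3) * f 1 0 1 0 1 + (-1 + rt3) * g 1
      0 1 0 1 + 2 * f 1 rt3 (-1) 0 0 - 2 * g 1 rt3 (-1) 0 0 + (-1 + rt3) * f (-1) 1 0 1 0 + (1 + rt3) * g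
      (-1) 1 0 1 0 + (1 + rt3) * f (-1) 0 1 0 (-1) + (1 - rt3) * g (-1) 0 1 0 (-1) - 2 * f (-1) rt3 1 0 0
      - 2 * g (-1) rt3 1 0 0"
      by (simp add: f_def g_def R)
    then have x1: "x 1 = 0" by (simp add: k1 k2 k3 k4 k5 k6)
    have "72 * x 2 = 3 * g 1 1 0 (-1) 0 - rt3 * g 1 0 1 0 1 + rt3 * f 1 rt3 (-1) 0 0 - rt3 * g 1 rt3 (-1) 0 0 - 3 * g
      (-1) 1 0 1 0 - rt3 * g (-1) 0 1 0 (-1) + rt3 * f (-1) rt3 1 0 0 + rt3 * g (-1) rt3 1 0 0"
      by (simp add: f_def g_def R)
    then have x2: "x 2 = 0" by (simp add: k1 k2 k3 k4 k5 k6)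
    have "24 * x 3 = rt3 * g 1 1 0 (-1) 0 - g 1 0 1 0 1 - f 1 rt3 (-1) 0 0 - g 1 rt3 (-1) 0 0 + rt3 * g (-1) 1 0 1 0 + g
      (-1) 0 1 0 (-1) + f (-1) rt3 1 0 0 - g (-1) rt3 1 0 0"
      by (simp add: f_def g_def R)
    then have x3: "x 3 = 0" by (simp add: k1 k2 k3 k4 k5 k6)
    have "48 * y 0 = rt3 * f 1 1 0 (-1) 0 + rt3 * g 1 1 0 (-1) 0 + f 1 0 1 0 1 + g 1 0 1 0 1 - rt3 * f (-1) 1 0 1 0 + rt3
      * g (-1) 1 0 1 0 + f (-1) 0 1 0 (-1) - g (-1) 0 1 0 (-1)"
      by (simp add: f_def g_def R)
    then have y0: "y 0 = 0" by (simp add: k1 k2 k4 k5)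
    have "48 * y 1 = f 1 1 0 (-1) 0 - g 1 1 0 (-1) 0 - rt3 * f 1 0 1 0 1 + rt3 * g 1 0 1 0 1 + f (-1) 1 0 1 0 + g (-1) 1
      0 1 0 + rt3 * f (-1) 0 1 0 (-1) + rt3 * g (-1) 0 1 0 (-1)"
      by (simp add: f_def g_def R)
    then have y1: "y 1 = 0" by (simp add: k1 k2 k4 k5)
    have "24 * y 2 = - f 1 1 0 (-1) 0 + g 1 1 0 (-1) 0 + f (-1) 1 0 1 0 + g (-1) 1 0 1 0"
      by (simp add: f_def g_def R)
    then have y2: "y 2 = 0" by (simp add: k1 k4)
    have "24 * y 3 = f 1 0 1 0 1 + g 1 0 1 0 1 - f (-1) 0 1 0 (-1) + g (-1) 0 1 0 (-1)"
      by (simp add: f_def g_def R)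
    then have y3: "y 3 = 0" by (simp add: k2 k5)
    have "144 * z 0 = (3 + 2 * rt3) * f 1 1 0 (-1) 0 + (3 - 2 * rt3) * g 1 1 0 (-1) 0 - rt3 * f 1 0 1 0 1 - rt3 * g 1 0 1
      0 1 - 2 * rt3 * f 1 rt3 (-1) 0 0 - 2 * rt3 * g 1 rt3 (-1) 0 0 + (3 + 2 * rt3) * f (-1) 1 0 1 0 + (-3
      + 2 * rt3) * g (-1) 1 0 1 0 + rt3 * f (-1) 0 1 0 (-1) - rt3 * g (-1) 0 1 0 (-1) - 2 * rt3 * f (-1)
      rt3 1 0 0 + 2 * rt3 * g (-1) rt3 1 0 0"
      by (simp add: f_def g_def R)
    then have z0: "z 0 = 0" by (simp add: k1 k2 k3 k4 k5 k6)
    have "48 * z 1 = (2 - rt3) * f 1 1 0 (-1) 0 + (2 + rt3) * g 1 1 0 (-1) 0 + f 1 0 1 0 1 - g 1 0 1 0 1 + 2 * f 1 rt3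
      (-1) 0 0 - 2 * g 1 rt3 (-1) 0 0 + (-2 + rt3) * f (-1) 1 0 1 0 + (2 + rt3) * g (-1) 1 0 1 0 + f (-1)
      0 1 0 (-1) + g (-1) 0 1 0 (-1) - 2 * f (-1) rt3 1 0 0 - 2 * g (-1) rt3 1 0 0"
      by (simp add: f_def g_def R)
    then have z1: "z 1 = 0" by (simp add: k1 k2 k3 k4 k5 k6)
    have "72 * z 2 = - 3 * f 1 1 0 (-1) 0 - rt3 * g 1 0 1 0 1 + rt3 * f 1 rt3 (-1) 0 0 - rt3 * g 1 rt3 (-1) 0 0 - 3 * f
      (-1) 1 0 1 0 - rt3 * g (-1) 0 1 0 (-1) + rt3 * f (-1) rt3 1 0 0 + rt3 * g (-1) rt3 1 0 0"
      by (simp add: f_def g_def R)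
    then have z2: "z 2 = 0" by (simp add: k1 k2 k3 k4 k5 k6)
    have "24 * z 3 = - rt3 * g 1 1 0 (-1) 0 + f 1 0 1 0 1 + f 1 rt3 (-1) 0 0 + g 1 rt3 (-1) 0 0 - rt3 * g (-1) 1 0 1 0 +
      f (-1) 0 1 0 (-1) - f (-1) rt3 1 0 0 + g (-1) rt3 1 0 0"
      by (simp add: f_def g_def R)
    then have z3: "z 3 = 0" by (simp add: k1 k2 k3 k4 k5 k6)
    have "x 0 = 0 \<and> x 1 = 0 \<and> x 2 = 0 \<and> x 3 = 0 \<and> y 0 = 0 \<and> y 1 = 0 \<and> y 2 = 0 \<and> y 3 = 0 \<and> z 0 = 0 \<and> z 1 = 0 \<and> z 2 = 0 \<and> z 3 = 0"
      by (simp only: x0 x1 x2 x3 y0 y1 y2 y3 z0 z1 z2 z3 simp_thms)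
    then show "\<forall>m<2*2. x m = 0 \<and> y m = 0 \<and> z m = 0"
      using nat4_cases by fastforce
  qed
  then show ?thesis by simp
qed

section \<open>The tuple of size 6\<close>

definition a6 :: complex where "a6 = complex_of_real alpha6"
definition s6 :: complex where "s6 = complex_of_real (sqrt (2 * alpha6))"

lemma cnj_a6_s6 [simp]: "cnj a6 = a6" "cnj s6 = s6" by (simp_all add: a6_def s6_def)

lemma alpha6_pos: "alpha6 > 0" by (simp add: alpha6_def)

lemma a6_sq: "a6 * a6 = 1 - 2 * a6" "a6 * (a6 * t) = t - 2 * (a6 * t)"
proof -
  have "alpha6 * alpha6 = 1 - 2 * alpha6" by (simp add: alpha6_def algebra_simps)
  then have "complex_of_real (alpha6 * alpha6) = complex_of_real (1 - 2 * alpha6)" by (rule arg_cong)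
  then show a: "a6 * a6 = 1 - 2 * a6" by (simp add: a6_def)
  show "a6 * (a6 * t) = t - 2 * (a6 * t)"
    using arg_cong[OF a, of "\<lambda>c. c * t"] by (simp only: mult.assoc left_diff_distrib mult_1_left)
qed

lemma s6_sq: "s6 * s6 = 2 * a6" "s6 * (s6 * t) = 2 * (a6 * t)"
proof -
  have "sqrt (2 * alpha6) * sqrt (2 * alpha6) = 2 * alpha6" using alpha6_pos by simp
  then have "complex_of_real (sqrt (2 * alpha6) * sqrt (2 * alpha6)) = complex_of_real (2 * alpha6)" by (rule arg_cong)
  then show s: "s6 * s6 = 2 * a6" by (simp only: s6_def a6_def of_real_mult of_real_numeral)
  show "s6 * (s6 * t) = 2 * (a6 * t)"
    using arg_cong[OF s, of "\<lambda>c. c * t"] by (simp only: mult.assoc)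
qed

definition C6a :: "complex mat" where
  "C6a = mat_of_rows_list 3 [[(a6 + 1)/4, 0, -a6/4], [0, (a6 + 1)/4, -a6/4], [-a6/4, -a6/4, (a6 + 1)/4]]"
definition C6b :: "complex mat" where "C6b = mat_of_rows_list 3 [[- s6, 0, 0], [0, s6, 0], [0, 0, 0]]"
definition D6 :: "complex mat" where
  "D6 = mat_of_rows_list 3 [[0, (3 * a6 - 1)/4, a6/4], [(3 * a6 - 1)/4, 0, a6/4], [a6/4, a6/4, (3 - a6)/4]]"

lemmas C6_defs = C6a_def C6b_def D6_def mat_of_rows_list_def

lemma C6_real_tuple: "Xof 3 C6 = real_tuple 3 C6a C6b D6"
proof -
  have "C6 = [C6a, C6b, \<i> \<cdot>\<^sub>m D6]"
    unfolding C6_def Let_def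
    by (intro arg_cong2[of _ _ _ _ Cons] refl mat3_eqI) (auto simp: C6_defs a6_def s6_def)
  then show ?thesis by simp
qed

lemma realsym_C6: "realsym 3 C6a" "realsym 3 C6b" "realsym 3 D6"
  unfolding realsym_def by (auto simp: C6_defs dest!: nat3_cases)

lemma act_C6:
  "act 3 C6a q 0 = ((a6 + 1) * q 0 - a6 * q 2) / 4" "act 3 C6a q 1 = ((a6 + 1) * q 1 - a6 * q 2) / 4"
    "act 3 C6a q 2 = (- a6 * q 0 - a6 * q 1 + (a6 + 1) * q 2) / 4"
    "act 3 C6b q 0 = - s6 * q 0" "act 3 C6b q 1 = s6 * q 1" "act 3 C6b q 2 = 0"
    "act 3 D6 q 0 = ((3 * a6 - 1) * q 1 + a6 * q 2) / 4" "act 3 D6 q 1 = ((3 * a6 - 1) * q 0 + a6 * q 2) / 4"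
    "act 3 D6 q 2 = (a6 * q 0 + a6 * q 1 + (3 - a6) * q 2) / 4"
  by (simp_all add: act_def lessThan_small C6_defs field_simps)

lemma act_corner6:
  "act 6 (corner C6a C6b D6 \<epsilon>) p 0 = ((a6 + 1) * p 0 - a6 * p 2 - 4 * s6 * p 3 - \<epsilon> * ((3 * a6 - 1) * p 4 + a6 * p 5)) / 4"
  "act 6 (corner C6a C6b D6 \<epsilon>) p 1 = ((a6 + 1) * p 1 - a6 * p 2 + 4 * s6 * p 4 - \<epsilon> * ((3 * a6 - 1) * p 3 + a6 * p 5)) / 4"
  "act 6 (corner C6a C6b D6 \<epsilon>) p 2 = ((a6 + 1) * p 2 - a6 * p 0 - a6 * p 1 - \<epsilon> * (a6 * p 3 + a6 * p 4 + (3 - a6) * p 5)) / 4"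
  "act 6 (corner C6a C6b D6 \<epsilon>) p 3 = (\<epsilon> * ((3 * a6 - 1) * p 1 + a6 * p 2) - 4 * s6 * p 0 - ((a6 + 1) * p 3 - a6 * p 5)) / 4"
  "act 6 (corner C6a C6b D6 \<epsilon>) p 4 = (\<epsilon> * ((3 * a6 - 1) * p 0 + a6 * p 2) + 4 * s6 * p 1 - ((a6 + 1) * p 4 - a6 * p 5)) / 4"
  "act 6 (corner C6a C6b D6 \<epsilon>) p 5 = (\<epsilon> * (a6 * p 0 + a6 * p 1 + (3 - a6) * p 2) - ((a6 + 1) * p 5 - a6 * p 3 - a6 * p 4)) / 4"
  using act_corner[OF realsym_C6, of 0 \<epsilon> p] act_corner[OF realsym_C6, of 1 \<epsilon> p] act_corner[OF realsym_C6, of 2 \<epsilon> p]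
  by (simp_all del: One_nat_def add_2_eq_Suc add: act_C6; simp add: field_simps)+

text \<open>Since a6 (a6 + 2) = 1, the entry 2 s6 (a6 + 2) is 2 s6 / a6 written without division.
  With the constant of \<open>defect6\<close> the only nonzero eigenvalue of I - T* T is sqrt 2 -
  1/2.\<close>

definition u6 :: "complex \<Rightarrow> nat \<Rightarrow> complex" where
  "u6 \<epsilon> i = [1, -1, \<epsilon> * (2 * s6 * (a6 + 2)), - \<epsilon>, \<epsilon>, 2 * s6 * (a6 + 2)] ! i"

lemma nat6_cases: "i < 6 \<Longrightarrow> i = 0 \<or> i = 1 \<or> i = 2 \<or> i = 3 \<or> i = 4 \<or> i = (5::nat)" by linarith

lemma defect6:
  assumes "\<epsilon> \<in> {1,-1}"
  shows "rank_one_defect (2*3) (corner C6a C6b D6 \<epsilon>) (alpha6\<^sup>2 / 8) (u6 \<epsilon>)"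
proof -
  have e: "cnj \<epsilon> = \<epsilon>" "\<epsilon> * \<epsilon> = 1" using assms by auto
  have ee: "\<epsilon> * (\<epsilon> * t) = t" for t by (simp only: mult.assoc[symmetric] e mult_1_left)
  note Tc = corner_carrier[OF realsym_C6]
  have g: "(mat_adjoint (corner C6a C6b D6 \<epsilon>) * corner C6a C6b D6 \<epsilon>) $$ (i,j)
      = act 6 (corner C6a C6b D6 (-\<epsilon>)) (act 6 (corner C6a C6b D6 \<epsilon>) (\<lambda>q. if q = j then 1 else 0)) i"
    if "i < 6" "j < 6" for i j
    using gram_entry[OF Tc, of i j \<epsilon>] that by (simp add: corner_adjoint[OF realsym_C6 e(1)])
  have c: "complex_of_real (alpha6\<^sup>2 / 8) = (1 - 2 * a6) / 8" using a6_sq(1) by (simp add: power2_eq_square a6_def)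
  \<comment> \<open>Applying T* T to a general p leaves six polynomial identities in place of 36
    entries.\<close>
  have gram: "act 6 (corner C6a C6b D6 (-\<epsilon>)) (act 6 (corner C6a C6b D6 \<epsilon>) p) i
      = p i - (1 - 2 * a6) / 8 * u6 \<epsilon> i * (\<Sum>j<6. u6 \<epsilon> j * p j)" if "i < 6" for i p
  proof -
    \<comment> \<open>The factor 4 keeps the identity \<open>h\<close> free of denominators; the two
      factors together account for the 16 there.\<close>
    define L where "L k = 4 * act 6 (corner C6a C6b D6 \<epsilon>) p k" for k
    define U where "U = (\<Sum>j<6. u6 \<epsilon> j * p j)"
    have L: "act 6 (corner C6a C6b D6 \<epsilon>) p = (\<lambda>k. 1/4 * L k)" by (simp add: L_def)
    have 4: "L 0 = (a6 + 1) * p 0 - a6 * p 2 - 4 * s6 * p 3 - \<epsilon> * ((3 * a6 - 1) * p 4 + a6 * p 5)" "L 1 = (a6 + 1) * p 1 - a6 * p 2 + 4 * s6 * p 4 - \<epsilon> * ((3 * a6 - 1) * p 3 + a6 * p 5)" "L 2 = (a6 + 1) * p 2 - a6 * p 0 - a6 * p 1 - \<epsilon> * (a6 * p 3 + a6 * p 4 + (3 - a6) * p 5)" "L 3 = \<epsilon> * ((3 * a6 - 1) * p 1 + a6 * p 2) - 4 * s6 * p 0 - ((a6 + 1) * p 3 - a6 * p 5)" "L 4 = \<epsilon> * ((3 * a6 - 1) * p 0 + a6 * p 2) + 4 * s6 * p 1 - ((a6 + 1) * p 4 - a6 * p 5)" "L 5 = \<epsilon> * (a6 * p 0 + a6 *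 p 1 + (3 - a6) * p 2) - ((a6 + 1) * p 5 - a6 * p 3 - a6 * p 4)"
      unfolding L_def act_corner6 by simp_all
    have U: "U = p 0 - p 1 + \<epsilon> * (2 * s6 * (a6 + 2)) * p 2 - \<epsilon> * p 3 + \<epsilon> * p 4 + 2 * s6 * (a6 + 2) * p 5"
      by (simp add: U_def lessThan_small u6_def)
    have h: "4 * act 6 (corner C6a C6b D6 (-\<epsilon>)) L i = 16 * p i - 2 * (1 - 2 * a6) * u6 \<epsilon> i * U"
      using nat6_cases[OF that]
      by (elim disjE; simp only: act_corner6; simp add: u6_def 4[unfolded One_nat_def] U;
          simp add: algebra_simps a6_sq s6_sq e ee)
    have "1/4 * act 6 (corner C6a C6b D6 (-\<epsilon>)) L i = 1/16 * (4 * act 6 (corner C6a C6b D6 (-\<epsilon>)) L i)" by simp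
    also have "\<dots> = p i - (1 - 2 * a6) / 8 * u6 \<epsilon> i * U" unfolding h by (simp add: field_simps)
    finally show ?thesis unfolding L act_scale U_def[symmetric] .
  qed
  have "(mat_adjoint (corner C6a C6b D6 \<epsilon>) * corner C6a C6b D6 \<epsilon>) $$ (i,j)
      = (if i = j then 1 else 0) - complex_of_real (alpha6\<^sup>2 / 8) * u6 \<epsilon> i * u6 \<epsilon> j"
    if "i < 6" "j < 6" for i j
    unfolding g[OF that] c gram[OF that(1)] using that(2) by (simp add: if_distrib cong: if_cong)
  moreover have "cnj (u6 \<epsilon> i) = u6 \<epsilon> i" if "i < 6" for i
    using nat6_cases[OF that] by (auto simp: u6_def e)
  ultimately show ?thesis unfolding rank_one_defect_def by simp
qed

text \<open>\<open>C6b\<close> is diagonal with the distinct entries -s6, s6, 0. A commuting matrix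
  is therefore diagonal, and the entries -a6/4 of \<open>C6a\<close> tie the first two diagonal
  entries to the third. An anticommuting one keeps only the positions (0,1), (1,0), (2,2), which the
  nonzero diagonal of \<open>C6a\<close> kills.\<close>

lemma C6_irreducible: "irreducible_tuple 6 (real_tuple 3 C6a C6b D6)"
proof -
  have c: "C6a \<in> carrier_mat 3 3" "C6b \<in> carrier_mat 3 3" using realsym_C6 by (auto simp: realsym_def)
  have "a6 + 1 = complex_of_real (alpha6 + 1)" by (simp add: a6_def)
  moreover have "alpha6 + 1 \<noteq> 0" using alpha6_pos by simp
  ultimately have nz: "a6 \<noteq> 0" "s6 \<noteq> 0" "a6 + 1 \<noteq> 0"
    using alpha6_pos by (simp_all only: of_real_eq_0_iff) (simp_all add: a6_def s6_def)
  have "irreducible_tuple (2*3) (real_tuple 3 C6a C6b D6)"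
  proof (rule real_tuple_irreducible[OF realsym_C6])
    fix K assume K: "K \<in> carrier_mat 3 3" and k1: "K * C6a = C6a * K" and k2: "K * C6b = C6b * K"
    note e = commute_entry[OF K]
    have off: "K $$ (0,1) = 0" "K $$ (0,2) = 0" "K $$ (1,0) = 0" "K $$ (1,2) = 0" "K $$ (2,0) = 0" "K $$ (2,1) = 0"
      using e[OF c(2) k2, of 0 1] e[OF c(2) k2, of 0 2] e[OF c(2) k2, of 1 0]
        e[OF c(2) k2, of 1 2] e[OF c(2) k2, of 2 0] e[OF c(2) k2, of 2 1] nz
      by (simp_all add: lessThan_small C6_defs)
    have "K $$ (0,0) = K $$ (2,2)" "K $$ (1,1) = K $$ (2,2)"
      using e[OF c(1) k1, of 0 2] e[OF c(1) k1, of 1 2] nz off by (simp_all add: lessThan_small C6_defs)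
    with off have "K = K $$ (0,0) \<cdot>\<^sub>m 1\<^sub>m 3" using K by (intro mat3_eqI) auto
    then show "\<exists>c. K = c \<cdot>\<^sub>m 1\<^sub>m 3" ..
  next
    fix K assume K: "K \<in> carrier_mat 3 3" and k1: "K * C6a = - (C6a * K)" and k2: "K * C6b = - (C6b * K)"
    note e = anticommute_entry[OF K]
    have off: "K $$ (0,0) = 0" "K $$ (0,2) = 0" "K $$ (1,1) = 0" "K $$ (1,2) = 0" "K $$ (2,0) = 0" "K $$ (2,1) = 0"
      using e[OF c(2) k2, of 0 0] e[OF c(2) k2, of 0 2] e[OF c(2) k2, of 1 1]
        e[OF c(2) k2, of 1 2] e[OF c(2) k2, of 2 0] e[OF c(2) k2, of 2 1] nz
      by (simp_all add: lessThan_small C6_defs)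
    have "K $$ (0,1) = 0" "K $$ (1,0) = 0" "K $$ (2,2) = 0"
      using e[OF c(1) k1, of 0 1] e[OF c(1) k1, of 1 0] e[OF c(1) k1, of 2 2] nz off
      by (simp_all add: lessThan_small C6_defs)
    with off show "K = 0\<^sub>m 3 3" using K by (intro mat3_eqI) auto
  next
    show "D6 \<noteq> 0\<^sub>m 3 3"
    proof
      assume "D6 = 0\<^sub>m 3 3"
      then have "D6 $$ (0,2) = 0\<^sub>m 3 3 $$ (0,2)" by (rule arg_cong)
      then show False using nz by (simp add: C6_defs)
    qed
  qed simp
  then show ?thesis by simp
qed

text \<open>The map (p0, ..., p5) to (p1, p0, p2, -p4, -p3, -p5) takes the complement of
  \<open>u6 1\<close> to that of \<open>u6 (-1)\<close> and the vectors of \<open>k1\<close> to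
  \<open>k5\<close> to those of \<open>k6\<close> to \<open>k10\<close>. Combining the equations of
  corresponding vectors splits the system into ten equations for the 10 even unknowns and ten for
  the 8 odd ones.\<close>

lemma C6_rigid: "row_rigid 6 (real_tuple 3 C6a C6b D6)"
proof -
  have "row_rigid (2*3) (real_tuple 3 C6a C6b D6)"
  proof (rule real_tuple_rigidI[OF realsym_C6 defect6])
    fix x y z :: "nat \<Rightarrow> complex"
    assume H: "\<And>\<epsilon> p l. \<epsilon> \<in> {1,-1} \<Longrightarrow> (\<Sum>j<2*3. u6 \<epsilon> j * p j) = 0 \<Longrightarrow>
        l = act (2*3) (corner C6a C6b D6 \<epsilon>) p \<Longrightarrow>
        (\<Sum>i<3. x i * l i + x (3+i) * p i + (y i + \<epsilon> * z i) * l (3+i) + (y (3+i) + \<epsilon> * z (3+i)) * p (3+i)) = 0 \<and>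
        (\<Sum>i<3. (y i - \<epsilon> * z i) * l i + (y (3+i) - \<epsilon> * z (3+i)) * p i - x i * l (3+i) - x (3+i) * p (3+i)) = 0"
    define f where "f \<epsilon> p0 p1 p2 p3 p4 p5 =
      x 0 * ((a6 + 1) * p0 - a6 * p2 - 4 * s6 * p3 - \<epsilon> * ((3 * a6 - 1) * p4 + a6 * p5)) + x 1 * ((a6 + 1) * p1 - a6 * p2 + 4 * s6 * p4 - \<epsilon> * ((3 * a6 - 1) * p3 + a6 * p5)) + x 2 * ((a6 + 1) * p2 - a6 * p0 - a6 * p1 - \<epsilon> * (a6 * p3 + a6 * p4 + (3 - a6) * p5)) + 4 * x 3 * p0 + 4 * x 4 * p1 + 4 * x 5 * p2 + (y 0 + \<epsilon> * z 0) * (\<epsilon> * ((3 * a6 - 1) * p1 + a6 * p2) - 4 * s6 * p0 - ((a6 + 1) * p3 - a6 * p5)) + (y 1 + \<epsilon> * z 1) * (\<epsilon> * ((3 * a6 - 1) * p0 + a6 * p2) + 4 * s6 * p1 - ((a6 + 1) * p4 - a6 * p5)) + (y 2 + \<epsilon> * z 2) * (\<epsilon> * (a6 * p0 + a6 * p1 + (3 - a6) * p2) - ((a6 + 1) * p5 - a6 * p3 - a6 * p4)) + 4 * (y 3 + \<epsilon> * z 3) * p3 + 4 * (y 4 + \<epsilon> * z 4) * p4 + 4 * (y 5 + \<epsilon> * z 5) * p5" for \<epsilon> p0 p1 p2 p3 p4 p5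
    define g where "g \<epsilon> p0 p1 p2 p3 p4 p5 =
      (y 0 - \<epsilon> * z 0) * ((a6 + 1) * p0 - a6 * p2 - 4 * s6 * p3 - \<epsilon> * ((3 * a6 - 1) * p4 + a6 * p5)) + (y 1 - \<epsilon> * z 1) * ((a6 + 1) * p1 - a6 * p2 + 4 * s6 * p4 - \<epsilon> * ((3 * a6 - 1) * p3 + a6 * p5)) + (y 2 - \<epsilon> * z 2) * ((a6 + 1) * p2 - a6 * p0 - a6 * p1 - \<epsilon> * (a6 * p3 + a6 * p4 + (3 - a6) * p5)) + 4 * (y 3 - \<epsilon> * z 3) * p0 + 4 * (y 4 - \<epsilon> * z 4) * p1 + 4 * (y 5 - \<epsilon> * z 5) * p2 - x 0 * (\<epsilon> * ((3 * a6 - 1) * p1 + a6 * p2) - 4 * s6 * p0 - ((a6 + 1) * p3 - a6 * p5)) - x 1 * (\<epsilon> * ((3 * a6 - 1) * p0 + a6 * p2) + 4 * s6 * p1 - ((a6 + 1) * p4 - a6 * p5)) - x 2 * (\<epsilon> * (a6 * p0 + a6 * p1 + (3 - a6) * p2) - ((a6 + 1) * p5 - a6 * p3 - a6 * p4)) - 4 * x 3 * p3 - 4 * x 4 * p4 - 4 * x 5 * p5" for \<epsilon> p0 p1 p2 p3 p4 p5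
    have fg: "f \<epsilon> p0 p1 p2 p3 p4 p5 = 0 \<and> g \<epsilon> p0 p1 p2 p3 p4 p5 = 0" if "\<epsilon> \<in> {1,-1}" "p0 - p1 + \<epsilon> * (2 * s6 * (a6 + 2)) * p2 - \<epsilon> * p3 + \<epsilon> * p4 + 2 * s6 * (a6 + 2) * p5 = 0" for \<epsilon> p0 p1 p2 p3 p4 p5
    proof -
      let ?p = "\<lambda>i. [p0, p1, p2, p3, p4, p5] ! i"
      have "(\<Sum>j<2*3. u6 \<epsilon> j * ?p j) = p0 - p1 + \<epsilon> * (2 * s6 * (a6 + 2)) * p2 - \<epsilon> * p3 + \<epsilon> * p4 + 2 * s6 * (a6 + 2) * p5"
        by (simp add: lessThan_small u6_def algebra_simps)
      then have up: "(\<Sum>j<2*3. u6 \<epsilon> j * ?p j) = 0"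
        using that(2) by simp
      define l where "l = act (2*3) (corner C6a C6b D6 \<epsilon>) ?p"
      note h = H[OF that(1) up l_def]
      have "f \<epsilon> p0 p1 p2 p3 p4 p5 = 4 * (\<Sum>i<3. x i * l i + x (3+i) * ?p i + (y i + \<epsilon> * z i) * l (3+i)
          + (y (3+i) + \<epsilon> * z (3+i)) * ?p (3+i))"
        unfolding l_def by (simp del: One_nat_def add_2_eq_Suc add: lessThan_small act_corner6 f_def; simp add: field_simps)
      moreover have "g \<epsilon> p0 p1 p2 p3 p4 p5 = 4 * (\<Sum>i<3. (y i - \<epsilon> * z i) * l i + (y (3+i) - \<epsilon> * z (3+i)) * ?p i
          - x i * l (3+i) - x (3+i) * ?p (3+i))"
        unfolding l_def by (simp del: One_nat_def add_2_eq_Suc add: lessThan_small act_corner6 g_def; simp add: field_simps)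
      ultimately show ?thesis unfolding h[THEN conjunct1] h[THEN conjunct2] by simp
    qed
    note R = algebra_simps a6_sq s6_sq
    have k1: "f 1 1 1 0 0 0 0 = 0 \<and> g 1 1 1 0 0 0 0 = 0"
      by (rule fg) (simp_all add: R)
    have k2: "f 1 0 0 0 1 1 0 = 0 \<and> g 1 0 0 0 1 1 0 = 0"
      by (rule fg) (simp_all add: R)
    have k3: "f 1 1 0 0 1 0 0 = 0 \<and> g 1 1 0 0 1 0 0 = 0"
      by (rule fg) (simp_all add: R)
    have k4: "f 1 0 0 1 0 0 (-1) = 0 \<and> g 1 0 0 1 0 0 (-1) = 0"
      by (rule fg) (simp_all add: R)
    \<comment> \<open>Orthogonality is again the relation a6 (a6 + 2) = 1.\<close>
    have k5: "f 1 (2 * s6) 0 (-a6) 0 0 0 = 0 \<and> g 1 (2 * s6) 0 (-a6) 0 0 0 = 0"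
      by (rule fg) (simp_all add: R)
    have k6: "f (-1) 1 1 0 0 0 0 = 0 \<and> g (-1) 1 1 0 0 0 0 = 0"
      by (rule fg) (simp_all add: R)
    have k7: "f (-1) 0 0 0 (-1) (-1) 0 = 0 \<and> g (-1) 0 0 0 (-1) (-1) 0 = 0"
      by (rule fg) (simp_all add: R)
    have k8: "f (-1) 0 1 0 0 (-1) 0 = 0 \<and> g (-1) 0 1 0 0 (-1) 0 = 0"
      by (rule fg) (simp_all add: R)
    have k9: "f (-1) 0 0 1 0 0 1 = 0 \<and> g (-1) 0 0 1 0 0 1 = 0"
      by (rule fg) (simp_all add: R)
    have k10: "f (-1) 0 (2 * s6) (-a6) 0 0 0 = 0 \<and> g (-1) 0 (2 * s6) (-a6) 0 0 0 = 0"
      by (rule fg) (simp_all add: R)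
    \<comment> \<open>The even part adds the two values of \<open>f\<close> and subtracts those of
      \<open>g\<close>; the odd part does the opposite.\<close>
    have even: "x 0 + x 1 = 0 \<and> x 2 = 0 \<and> x 3 + x 4 = 0 \<and> x 5 = 0 \<and> y 0 - y 1 = 0 \<and> y 3 - y
      4 = 0 \<and> z 0 + z 1 = 0 \<and> z 2 = 0 \<and> z 3 + z 4 = 0 \<and> z 5 = 0"
    proof (rule linear_system6_even[OF _ _ _ _ _ _ _ _ _ _ a6_sq(1) s6_sq(1)])
      show "(2 + 2 * a6) * (x 0 + x 1) - 4 * a6 * x 2 + 8 * (x 3 + x 4) - 8 * s6 * (y 0 - y 1) + (-2 + 6 * a6) *
        (z 0 + z 1) + 4 * a6 * z 2 = 0" (is "?E = 0")
      proof -
        have "?E = f 1 1 1 0 0 0 0 + f (-1) 1 1 0 0 0 0"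
          by (simp add: f_def R)
        then show ?thesis using k1 k6 by simp
      qed
      show "(2 - 6 * a6) * (x 0 + x 1) - 4 * a6 * x 2 + (-2 - 2 * a6) * (z 0 + z 1) + 4 * a6 * z 2 - 8 * (z 3 +
        z 4) = 0" (is "?E = 0")
      proof -
        have "?E = g 1 1 1 0 0 0 0 - g (-1) 1 1 0 0 0 0"
          by (simp add: g_def R)
        then show ?thesis using k1 k6 by simp
      qed
      show "(2 - 6 * a6) * (x 0 + x 1) - 4 * a6 * x 2 + (-2 - 2 * a6) * (z 0 + z 1) + 4 * a6 * z 2 + 8 * (z 3 +
        z 4) = 0" (is "?E = 0")
      proof -
        have "?E = f 1 0 0 0 1 1 0 + f (-1) 0 0 0 (-1) (-1) 0"
          by (simp add: f_def R)
        then show ?thesis using k2 k7 by simp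
      qed
      show "(2 + 2 * a6) * (x 0 + x 1) - 4 * a6 * x 2 - 8 * (x 3 + x 4) - 8 * s6 * (y 0 - y 1) + (-2 + 6 * a6) *
        (z 0 + z 1) + 4 * a6 * z 2 = 0" (is "?E = 0")
      proof -
        have "?E = g 1 0 0 0 1 1 0 - g (-1) 0 0 0 (-1) (-1) 0"
          by (simp add: g_def R)
        then show ?thesis using k2 k7 by simp
      qed
      show "(2 - 4 * s6 - 2 * a6) * (x 0 + x 1) - 4 * a6 * x 2 + 4 * (x 3 + x 4) + (-4 * s6 - 4 * a6) * (y 0 - y
        1) + 4 * (y 3 - y 4) + (-2 - 4 * s6 + 2 * a6) * (z 0 + z 1) + 4 * a6 * z 2 + 4 * (z 3 + z 4) = 0" (is "?E = 0")
      proof -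
        have "?E = f 1 1 0 0 1 0 0 + f (-1) 0 1 0 0 (-1) 0"
          by (simp add: f_def R)
        then show ?thesis using k3 k8 by simp
      qed
      show "(2 + 4 * s6 - 2 * a6) * (x 0 + x 1) - 4 * a6 * x 2 - 4 * (x 3 + x 4) + (-4 * s6 + 4 * a6) * (y 0 - y
        1) + 4 * (y 3 - y 4) + (-2 + 4 * s6 + 2 * a6) * (z 0 + z 1) + 4 * a6 * z 2 - 4 * (z 3 + z 4) = 0" (is "?E = 0")
      proof -
        have "?E = g 1 1 0 0 1 0 0 - g (-1) 0 1 0 0 (-1) 0"
          by (simp add: g_def R)
        then show ?thesis using k3 k8 by simp
      qed
      show "8 * x 2 + 8 * x 5 + 8 * z 2 - 8 * z 5 = 0" (is "?E = 0")
      proof -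
        have "?E = f 1 0 0 1 0 0 (-1) + f (-1) 0 0 1 0 0 1"
          by (simp add: f_def R)
        then show ?thesis using k4 k9 by simp
      qed
      show "- 8 * x 2 + 8 * x 5 - 8 * z 2 - 8 * z 5 = 0" (is "?E = 0")
      proof -
        have "?E = g 1 0 0 1 0 0 (-1) - g (-1) 0 0 1 0 0 1"
          by (simp add: g_def R)
        then show ?thesis using k4 k9 by simp
      qed
      show "(2 + 2 * s6 - 4 * a6 + 2 * a6 * s6) * (x 0 + x 1) + (-2 + 2 * a6 - 4 * a6 * s6) * x 2 + 8 * s6 * (x
        3 + x 4) - 8 * a6 * x 5 + (2 * s6 - 16 * a6 - 6 * a6 * s6) * (y 0 - y 1) + (-2 - 2 * s6 - 12 * a6 +
        6 * a6 * s6) * (z 0 + z 1) + (2 - 10 * a6 + 4 * a6 * s6) * z 2 = 0" (is "?E = 0")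
      proof -
        have "?E = f 1 (2 * s6) 0 (-a6) 0 0 0 + f (-1) 0 (2 * s6) (-a6) 0 0 0"
          by (simp add: f_def R)
        then show ?thesis using k5 k10 by simp
      qed
      show "(2 + 2 * s6 + 12 * a6 - 6 * a6 * s6) * (x 0 + x 1) + (-2 + 10 * a6 - 4 * a6 * s6) * x 2 + (2 * s6 +
        2 * a6 * s6) * (y 0 - y 1) + 8 * s6 * (y 3 - y 4) + (-2 - 2 * s6 + 4 * a6 - 2 * a6 * s6) * (z 0 + z
        1) + (2 - 2 * a6 + 4 * a6 * s6) * z 2 - 8 * s6 * (z 3 + z 4) + 8 * a6 * z 5 = 0" (is "?E = 0")
      proof -
        have "?E = g 1 (2 * s6) 0 (-a6) 0 0 0 - g (-1) 0 (2 * s6) (-a6) 0 0 0"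
          by (simp add: g_def R)
        then show ?thesis using k5 k10 by simp
      qed
    qed
    have odd: "x 0 - x 1 = 0 \<and> x 3 - x 4 = 0 \<and> y 0 + y 1 = 0 \<and> y 2 = 0 \<and> y 3 + y 4 = 0 \<and> y
      5 = 0 \<and> z 0 - z 1 = 0 \<and> z 3 - z 4 = 0"
    proof (rule linear_system6_odd[OF _ _ _ _ _ _ _ _ _ _ a6_sq(1) s6_sq(1)])
      show "(-2 + 6 * a6) * (y 0 + y 1) + 4 * a6 * y 2 - 8 * s6 * (z 0 - z 1) = 0" (is "?E = 0")
      proof -
        have "?E = f 1 1 1 0 0 0 0 - f (-1) 1 1 0 0 0 0"
          by (simp add: f_def R)
        then show ?thesis using k1 k6 by simp
      qed
      show "8 * s6 * (x 0 - x 1) + (2 + 2 * a6) * (y 0 + y 1) - 4 * a6 * y 2 + 8 * (y 3 + y 4) = 0" (is "?E = 0")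
      proof -
        have "?E = g 1 1 1 0 0 0 0 + g (-1) 1 1 0 0 0 0"
          by (simp add: g_def R)
        then show ?thesis using k1 k6 by simp
      qed
      show "- 8 * s6 * (x 0 - x 1) + (-2 - 2 * a6) * (y 0 + y 1) + 4 * a6 * y 2 + 8 * (y 3 + y 4) = 0" (is "?E = 0")
      proof -
        have "?E = f 1 0 0 0 1 1 0 - f (-1) 0 0 0 (-1) (-1) 0"
          by (simp add: f_def R)
        then show ?thesis using k2 k7 by simp
      qed
      show "(2 - 6 * a6) * (y 0 + y 1) - 4 * a6 * y 2 + 8 * s6 * (z 0 - z 1) = 0" (is "?E = 0")
      proof -
        have "?E = g 1 0 0 0 1 1 0 + g (-1) 0 0 0 (-1) (-1) 0"
          by (simp add: g_def R)
        then show ?thesis using k2 k7 by simp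
      qed
      show "(-4 * s6 + 4 * a6) * (x 0 - x 1) + 4 * (x 3 - x 4) + (-2 - 4 * s6 + 2 * a6) * (y 0 + y 1) + 4 * a6 *
        y 2 + 4 * (y 3 + y 4) + (-4 * s6 - 4 * a6) * (z 0 - z 1) + 4 * (z 3 - z 4) = 0" (is "?E = 0")
      proof -
        have "?E = f 1 1 0 0 1 0 0 - f (-1) 0 1 0 0 (-1) 0"
          by (simp add: f_def R)
        then show ?thesis using k3 k8 by simp
      qed
      show "(4 * s6 + 4 * a6) * (x 0 - x 1) - 4 * (x 3 - x 4) + (2 - 4 * s6 - 2 * a6) * (y 0 + y 1) - 4 * a6 * y
        2 + 4 * (y 3 + y 4) + (4 * s6 - 4 * a6) * (z 0 - z 1) - 4 * (z 3 - z 4) = 0" (is "?E = 0")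
      proof -
        have "?E = g 1 1 0 0 1 0 0 + g (-1) 0 1 0 0 (-1) 0"
          by (simp add: g_def R)
        then show ?thesis using k3 k8 by simp
      qed
      show "8 * y 2 - 8 * y 5 = 0" (is "?E = 0")
      proof -
        have "?E = f 1 0 0 1 0 0 (-1) - f (-1) 0 0 1 0 0 1"
          by (simp add: f_def R)
        then show ?thesis using k4 k9 by simp
      qed
      show "8 * y 2 + 8 * y 5 = 0" (is "?E = 0")
      proof -
        have "?E = g 1 0 0 1 0 0 (-1) + g (-1) 0 0 1 0 0 1"
          by (simp add: g_def R)
        then show ?thesis using k4 k9 by simp
      qed
      show "(2 * s6 + 2 * a6 * s6) * (x 0 - x 1) + 8 * s6 * (x 3 - x 4) + (-2 - 2 * s6 - 12 * a6 + 6 * a6 * s6)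
        * (y 0 + y 1) + (2 - 10 * a6 + 4 * a6 * s6) * y 2 + (2 * s6 - 16 * a6 - 6 * a6 * s6) * (z 0 - z 1) = 0" (is "?E = 0")
      proof -
        have "?E = f 1 (2 * s6) 0 (-a6) 0 0 0 - f (-1) 0 (2 * s6) (-a6) 0 0 0"
          by (simp add: f_def R)
        then show ?thesis using k5 k10 by simp
      qed
      show "(-2 * s6 + 16 * a6 + 6 * a6 * s6) * (x 0 - x 1) + (2 + 2 * s6 - 4 * a6 + 2 * a6 * s6) * (y 0 + y 1)
        + (-2 + 2 * a6 - 4 * a6 * s6) * y 2 + 8 * s6 * (y 3 + y 4) - 8 * a6 * y 5 + (-2 * s6 - 2 * a6 * s6)
        * (z 0 - z 1) - 8 * s6 * (z 3 - z 4) = 0" (is "?E = 0")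
      proof -
        have "?E = g 1 (2 * s6) 0 (-a6) 0 0 0 + g (-1) 0 (2 * s6) (-a6) 0 0 0"
          by (simp add: g_def R)
        then show ?thesis using k5 k10 by simp
      qed
    qed
    have half: "u = 0 \<and> v = 0" if "u + v = 0" "u - v = 0" for u v :: complex
      using that by (simp add: eq_neg_iff_add_eq_0)
    have "x 0 = 0 \<and> x 1 = 0 \<and> x 2 = 0 \<and> x 3 = 0 \<and> x 4 = 0 \<and> x 5 = 0 \<and> y 0 = 0
      \<and> y 1 = 0 \<and> y 2 = 0 \<and> y 3 = 0 \<and> y 4 = 0 \<and> y 5 = 0 \<and> z 0 = 0 \<and> z 1
      = 0 \<and> z 2 = 0 \<and> z 3 = 0 \<and> z 4 = 0 \<and> z 5 = 0"
      using even odd half[of "x 0" "x 1"]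
        half[of "x 3" "x 4"]
        half[of "y 0" "y 1"]
        half[of "y 3" "y 4"]
        half[of "z 0" "z 1"]
        half[of "z 3" "z 4"] by simp
    then show "\<forall>m<2*3. x m = 0 \<and> y m = 0 \<and> z m = 0"
      using nat6_cases by fastforce
  qed
  then show ?thesis by simp
qed

section \<open>The first level and the maximal set over the ball\<close>

abbreviation point1 :: "real \<Rightarrow> real \<Rightarrow> real \<Rightarrow> complex mat list" where
  "point1 t1 t2 t3 \<equiv> map (\<lambda>t. mat 1 1 (\<lambda>_. complex_of_real t)) [t1,t2,t3]"

lemma lift1_ball3_iff:
  "X \<in> lift1 ball3 \<longleftrightarrow> (\<exists>(t1::real) (t2::real) (t3::real). t1\<^sup>2 + t2\<^sup>2 + t3\<^sup>2 \<le> 1 \<and>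
     X = point1 t1 t2 t3)"
proof
  assume "X \<in> lift1 ball3"
  then obtain x where x: "length x = 3" "(\<Sum>t\<leftarrow>x. t\<^sup>2) \<le> 1" "X = map (\<lambda>t. mat 1 1 (\<lambda>_. complex_of_real t)) x"
    by (auto simp: lift1_def ball3_def)
  moreover obtain t1 t2 t3 where "x = [t1,t2,t3]"
    using x(1) by (auto simp: length_Suc_conv numeral_3_eq_3)
  ultimately show "\<exists>(t1::real) (t2::real) (t3::real). t1\<^sup>2 + t2\<^sup>2 + t3\<^sup>2 \<le> 1 \<and>
     X = point1 t1 t2 t3"
    by (intro exI[of _ t1] exI[of _ t2] exI[of _ t3]) simp
next
  assume "\<exists>(t1::real) (t2::real) (t3::real). t1\<^sup>2 + t2\<^sup>2 + t3\<^sup>2 \<le> 1 \<and>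
     X = point1 t1 t2 t3"
  then obtain t1 t2 t3 :: real where "t1\<^sup>2 + t2\<^sup>2 + t3\<^sup>2 \<le> 1"
     "X = point1 t1 t2 t3" by blast
  then show "X \<in> lift1 ball3"
    unfolding lift1_def ball3_def by (intro image_eqI[of _ _ "[t1,t2,t3]"]) auto
qed

lemma SM_tuple_level1:
  "SM_tuple 3 1 X \<longleftrightarrow> (\<exists>(t1::real) (t2::real) (t3::real). X = point1 t1 t2 t3)"
proof
  assume S: "SM_tuple 3 1 X"
  have real: "X!j = mat 1 1 (\<lambda>_. complex_of_real (Re (X!j $$ (0,0))))" if "j < 3" for j
  proof -
    have c: "X!j \<in> carrier_mat 1 1" "cnj (X!j $$ (0,0)) = X!j $$ (0,0)"
      using S that by (auto simp: SM_tuple_def selfadj_entry)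
    have "complex_of_real (Re (X!j $$ (0,0))) = X!j $$ (0,0)"
      using c(2) by (simp add: complex_eq_iff)
    then show ?thesis using c(1) by (intro eq_matI) auto
  qed
  have len: "length X = 3" using S by (simp add: SM_tuple_def)
  have "X = [X!0, X!1, X!2]"
    by (rule nth_equalityI) (use len in \<open>auto dest!: nat3_cases\<close>)
  then have "X = point1 (Re (X!0 $$ (0,0))) (Re (X!1 $$ (0,0))) (Re (X!2 $$ (0,0)))"
    using real[of 0] real[of 1] real[of 2] by simp
  then show "\<exists>(t1::real) (t2::real) (t3::real). X = point1 t1 t2 t3" by blast
next
  assume "\<exists>(t1::real) (t2::real) (t3::real). X = point1 t1 t2 t3"
  then show "SM_tuple 3 1 X" by (auto simp: SM_tuple_def selfadj_entry dest!: nat3_cases)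
qed

lemma pform_level1:
  fixes e :: complex and t1 t2 t3 :: real
  assumes "e \<in> {\<i>, -\<i>}"
  shows "pform e 1 (point1 t1 t2 t3) x y x y
    = (1 - t1) * (x 0 * cnj (x 0)) + (1 + t1) * (y 0 * cnj (y 0))
      - (t2 + e * t3) * (y 0 * cnj (x 0)) - (t2 - e * t3) * (x 0 * cnj (y 0))"
  by (simp add: pform_expand ip_def act_def algebra_simps)

text \<open>At level 1 the form belongs to a 2 by 2 Hermitian matrix with diagonal 1 - t1, 1 + t1
  and determinant 1 - |t|^2.\<close>

lemma free_spec_F3_level1: "free_spec 4 F3 1 = lift1 ball3"
proof (rule Set.set_eqI)
  fix X
  have "(\<forall>e x y. e \<in> {\<i>, -\<i>} \<longrightarrow> 0 \<le> Re (pform e 1 (point1 t1 t2 t3) x y x y)) \<longleftrightarrow> t1\<^sup>2 + t2\<^sup>2 + t3\<^sup>2 \<le> 1"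
    (is "?l \<longleftrightarrow> ?r") for t1 t2 t3 :: real
  proof
    assume l: ?l
    define N where "N = 1 - (t1\<^sup>2 + t2\<^sup>2 + t3\<^sup>2)"
    \<comment> \<open>The test vectors are the columns of the adjugate matrix, where the form takes
      the values (1 - t1) N and (1 + t1) N. Adding the two avoids a case distinction at t1 = 1 and
      t1 = -1.\<close>
    have "0 \<le> Re (pform \<i> 1 (point1 t1 t2 t3) (\<lambda>_. t2 + \<i> * t3) (\<lambda>_. 1 - t1) (\<lambda>_. t2 + \<i> * t3) (\<lambda>_. 1 - t1))"
      "0 \<le> Re (pform \<i> 1 (point1 t1 t2 t3) (\<lambda>_. 1 + t1) (\<lambda>_. t2 - \<i> * t3) (\<lambda>_. 1 + t1) (\<lambda>_. t2 - \<i> * t3))"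
      using l by blast+
    moreover have "Re (pform \<i> 1 (point1 t1 t2 t3) (\<lambda>_. t2 + \<i> * t3) (\<lambda>_. 1 - t1) (\<lambda>_. t2 + \<i> * t3) (\<lambda>_. 1 - t1)) = (1 - t1) * N"
      unfolding pform_level1[where e = "\<i>", OF insertI1] by (simp add: N_def algebra_simps power2_eq_square)
    moreover have "Re (pform \<i> 1 (point1 t1 t2 t3) (\<lambda>_. 1 + t1) (\<lambda>_. t2 - \<i> * t3) (\<lambda>_. 1 + t1) (\<lambda>_. t2 - \<i> * t3)) = (1 + t1) * N"
      unfolding pform_level1[where e = "\<i>", OF insertI1] by (simp add: N_def algebra_simps power2_eq_square)
    ultimately have "0 \<le> (1 - t1) * N + (1 + t1) * N" by linarith
    also have "\<dots> = 2 * N" by (simp add: algebra_simps)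
    finally show ?r by (simp add: N_def)
  next
    assume r: ?r
    show ?l
    proof (intro allI impI)
      fix e :: complex and x y :: "nat \<Rightarrow> complex"
      assume e: "e \<in> {\<i>, -\<i>}"
      define a where "a = x 0"
      define b where "b = y 0"
      define w where "w = (complex_of_real t2 + e * complex_of_real t3) * (b * cnj a)"
      have t1: "\<bar>t1\<bar> \<le> 1" using r abs_le_square_iff[of t1 1] by (smt (verit) one_power2 zero_le_power2)
      have e2: "cnj (complex_of_real t2 + e * complex_of_real t3) = complex_of_real t2 - e * complex_of_real t3" using e by auto
      have cw: "cnj w = (complex_of_real t2 - e * complex_of_real t3) * (a * cnj b)" unfolding w_def complex_cnj_mult e2 complex_cnj_cnj by simp
      have pf: "pform e 1 (point1 t1 t2 t3) x y x y
          = (1 - t1) * (a * cnj a) + (1 + t1) * (b * cnj b) - (w + cnj w)"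
        unfolding pform_level1[OF e] cw by (simp add: a_def b_def w_def)
      have val: "Re (pform e 1 (point1 t1 t2 t3) x y x y) = (1 - t1) * (cmod a)\<^sup>2 + (1 + t1) * (cmod b)\<^sup>2 - 2 * Re w"
        unfolding pf by (simp add: complex_norm_square[symmetric] del: of_real_power flip: of_real_power)
      have "cmod (complex_of_real t2 + e * complex_of_real t3) = sqrt (t2\<^sup>2 + t3\<^sup>2)" using e by (auto simp: cmod_def)
      also have "\<dots> \<le> sqrt (1 - t1\<^sup>2)" using r by simp
      finally have "Re w \<le> sqrt (1 - t1\<^sup>2) * (cmod b * cmod a)"
        using complex_Re_le_cmod[of w] mult_right_mono[of "cmod (complex_of_real t2 + e * complex_of_real t3)" "sqrt (1 - t1\<^sup>2)" "cmod b * cmod a"]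
        by (simp add: w_def norm_mult)
      also have "sqrt (1 - t1\<^sup>2) = sqrt (1 - t1) * sqrt (1 + t1)"
        by (simp add: real_sqrt_mult[symmetric] algebra_simps power2_eq_square)
      finally have "Re w \<le> sqrt (1 - t1) * sqrt (1 + t1) * (cmod b * cmod a)" .
      moreover have "0 \<le> (sqrt (1 - t1) * cmod a - sqrt (1 + t1) * cmod b)\<^sup>2" by simp
      moreover have "(sqrt (1 - t1) * cmod a - sqrt (1 + t1) * cmod b)\<^sup>2
          = (1 - t1) * (cmod a)\<^sup>2 + (1 + t1) * (cmod b)\<^sup>2 - 2 * (sqrt (1 - t1) * sqrt (1 + t1) * (cmod b * cmod a))"
        using t1 by (simp add: power2_diff power_mult_distrib algebra_simps)
      ultimately show "0 \<le> Re (pform e 1 (point1 t1 t2 t3) x y x y)" unfolding val by linarith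
    qed
  qed
  then show "X \<in> free_spec 4 F3 1 \<longleftrightarrow> X \<in> lift1 ball3"
    unfolding free_spec_F3_iff lift1_ball3_iff SM_tuple_level1 by blast
qed

text \<open>The maximal matrix convex set over the ball, cut out by its supporting half
  spaces.\<close>

definition wmax_ball :: "nat \<Rightarrow> complex mat list set" where
  "wmax_ball n = (if n = 0 then {} else {Z. SM_tuple 3 n Z \<and>
     (\<forall>(u1::real) (u2::real) (u3::real). u1\<^sup>2 + u2\<^sup>2 + u3\<^sup>2 = (1::real) \<longrightarrow> (\<forall>x.
        Re (u1 * ip n (act n (Z!0) x) x + u2 * ip n (act n (Z!1) x) x + u3 * ip n (act n (Z!2) x) x) \<le> Re (ip n x x)))})"

lemma wmax_ballD:
  fixes u1 u2 u3 :: real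
  assumes "Z \<in> wmax_ball n" "u1\<^sup>2 + u2\<^sup>2 + u3\<^sup>2 = 1"
  shows "Re (u1 * ip n (act n (Z!0) x) x + u2 * ip n (act n (Z!1) x) x + u3 * ip n (act n (Z!2) x) x) \<le> Re (ip n x x)"
  using assms unfolding wmax_ball_def by (auto split: if_splits)

lemma wmax_ball_convex: "matrix_convex 3 wmax_ball"
  unfolding matrix_convex_def
proof (intro conjI allI impI ballI)
  show "wmax_ball 0 = {}" by (simp add: wmax_ball_def)
  have SM: "SM_tuple 3 n X" if "X \<in> wmax_ball n" for n X
    using that by (simp add: wmax_ball_def split: if_splits)
  then show "SM_tuple 3 n X" if "X \<in> wmax_ball n" for n X using that .
  fix n :: nat and I :: "nat set" and m V Y
  assume n: "1 \<le> n" and data: "mconv_data 3 wmax_ball n I m V Y"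
  have "Re (u1 * ip n (act n (mconv_comb 3 n I V Y ! 0) x) x + u2 * ip n (act n (mconv_comb 3 n I V Y ! 1) x) x
        + u3 * ip n (act n (mconv_comb 3 n I V Y ! 2) x) x) \<le> Re (ip n x x)"
    if u: "u1\<^sup>2 + u2\<^sup>2 + u3\<^sup>2 = 1" for u1 u2 u3 :: real and x
  proof -
    have "Re (u1 * ip n (act n (mconv_comb 3 n I V Y ! 0) x) x + u2 * ip n (act n (mconv_comb 3 n I V Y ! 1) x) x
        + u3 * ip n (act n (mconv_comb 3 n I V Y ! 2) x) x)
      = (\<Sum>i\<in>I. Re (u1 * ip (m i) (act (m i) (Y i ! 0) (act n (V i) x)) (act n (V i) x)
          + u2 * ip (m i) (act (m i) (Y i ! 1) (act n (V i) x)) (act n (V i) x)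
          + u3 * ip (m i) (act (m i) (Y i ! 2) (act n (V i) x)) (act n (V i) x)))"
      by (simp del: One_nat_def add: ip_comb[OF data SM] sum_distrib_left sum.distrib)
    also have "\<dots> \<le> (\<Sum>i\<in>I. Re (ip (m i) (act n (V i) x) (act n (V i) x)))"
      by (intro sum_mono wmax_ballD u) (use data in \<open>auto simp: mconv_data_def\<close>)
    also have "\<dots> = Re (ip n x x)" by (simp add: ip_comb_one[OF data])
    finally show ?thesis .
  qed
  then show "mconv_comb 3 n I V Y \<in> wmax_ball n"
    using n mconv_comb_SM[OF data SM] by (simp add: wmax_ball_def)
qed

lemma wmax_ball_level1: "wmax_ball 1 = lift1 ball3"
proof (rule Set.set_eqI)
  fix X
  have val: "(Re (u1 * ip 1 (act 1 (point1 t1 t2 t3 ! 0) x) x + u2 * ip 1 (act 1 (point1 t1 t2 t3 ! 1) x) x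
      + u3 * ip 1 (act 1 (point1 t1 t2 t3 ! 2) x) x) \<le> Re (ip 1 x x))
      \<longleftrightarrow> (u1 * t1 + u2 * t2 + u3 * t3) * (cmod (x 0))\<^sup>2 \<le> (cmod (x 0))\<^sup>2" for u1 u2 u3 t1 t2 t3 :: real and x
    unfolding cmod_power2 by (simp add: ip_def act_def algebra_simps power2_eq_square)
  have "(\<forall>(u1::real) (u2::real) (u3::real). u1\<^sup>2 + u2\<^sup>2 + u3\<^sup>2 = (1::real) \<longrightarrow> (\<forall>x :: nat \<Rightarrow> complex.
      (u1 * t1 + u2 * t2 + u3 * t3) * (cmod (x 0))\<^sup>2 \<le> (cmod (x 0))\<^sup>2)) \<longleftrightarrow> t1\<^sup>2 + t2\<^sup>2 + t3\<^sup>2 \<le> 1"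
    (is "?l \<longleftrightarrow> ?r") for t1 t2 t3 :: real
  proof
    assume l: ?l
    define R where "R = sqrt (t1\<^sup>2 + t2\<^sup>2 + t3\<^sup>2)"
    have R2: "R\<^sup>2 = t1\<^sup>2 + t2\<^sup>2 + t3\<^sup>2" by (simp add: R_def)
    show ?r
    proof (cases "R = 0")
      case True
      then show ?thesis using R2 by simp
    next
      case False
      have "(t1/R)\<^sup>2 + (t2/R)\<^sup>2 + (t3/R)\<^sup>2 = R\<^sup>2 / R\<^sup>2"
        unfolding R2 power_divide add_divide_distrib by (simp add: R2)
      also have "\<dots> = 1" using False by simp
      finally have "(t1/R)\<^sup>2 + (t2/R)\<^sup>2 + (t3/R)\<^sup>2 = 1" .
      from l[rule_format, OF this, of "\<lambda>_. 1"] have "t1/R * t1 + t2/R * t2 + t3/R * t3 \<le> 1" by simp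
      also have "t1/R * t1 + t2/R * t2 + t3/R * t3 = R"
        using False R2 by (simp add: power2_eq_square field_simps)
      finally have "R \<le> 1" .
      moreover have "R \<ge> 0" by (simp add: R_def)
      ultimately have "R\<^sup>2 \<le> 1" by (simp add: power_le_one)
      then show ?thesis using R2 by simp
    qed
  next
    assume r: ?r
    show ?l
    proof (intro allI impI)
      fix u1 u2 u3 :: real and x :: "nat \<Rightarrow> complex"
      assume u: "u1\<^sup>2 + u2\<^sup>2 + u3\<^sup>2 = 1"
      have "0 \<le> (u1 - t1)\<^sup>2 + (u2 - t2)\<^sup>2 + (u3 - t3)\<^sup>2" by simp
      also have "\<dots> = (u1\<^sup>2 + u2\<^sup>2 + u3\<^sup>2) + (t1\<^sup>2 + t2\<^sup>2 + t3\<^sup>2) - 2 * (u1 * t1 + u2 * t2 + u3 * t3)"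
        by (simp add: power2_diff algebra_simps)
      finally have "2 * (u1 * t1 + u2 * t2 + u3 * t3) \<le> (u1\<^sup>2 + u2\<^sup>2 + u3\<^sup>2) + (t1\<^sup>2 + t2\<^sup>2 + t3\<^sup>2)"
        by simp
      also have "\<dots> \<le> 1 + 1" using u r by (intro add_mono) simp_all
      finally have "u1 * t1 + u2 * t2 + u3 * t3 \<le> 1" by simp
      then show "(u1 * t1 + u2 * t2 + u3 * t3) * (cmod (x 0))\<^sup>2 \<le> (cmod (x 0))\<^sup>2"
        using mult_right_mono[of "u1 * t1 + u2 * t2 + u3 * t3" 1 "(cmod (x 0))\<^sup>2"] by simp
    qed
  qed
  then have key: "(\<forall>(u1::real) (u2::real) (u3::real). u1\<^sup>2 + u2\<^sup>2 + u3\<^sup>2 = (1::real) \<longrightarrow> (\<forall>x.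
      Re (u1 * ip 1 (act 1 (point1 t1 t2 t3 ! 0) x) x + u2 * ip 1 (act 1 (point1 t1 t2 t3 ! 1) x) x
      + u3 * ip 1 (act 1 (point1 t1 t2 t3 ! 2) x) x) \<le> Re (ip 1 x x))) \<longleftrightarrow> t1\<^sup>2 + t2\<^sup>2 + t3\<^sup>2 \<le> 1" for t1 t2 t3 :: real
    unfolding val .
  have "X \<in> wmax_ball 1 \<longleftrightarrow> SM_tuple 3 1 X \<and> (\<forall>(u1::real) (u2::real) (u3::real). u1\<^sup>2 + u2\<^sup>2 + u3\<^sup>2 = (1::real) \<longrightarrow> (\<forall>x.
      Re (u1 * ip 1 (act 1 (X ! 0) x) x + u2 * ip 1 (act 1 (X ! 1) x) x
      + u3 * ip 1 (act 1 (X ! 2) x) x) \<le> Re (ip 1 x x)))"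
    unfolding wmax_ball_def by simp
  then show "X \<in> wmax_ball 1 \<longleftrightarrow> X \<in> lift1 ball3"
    unfolding lift1_ball3_iff SM_tuple_level1 using key by metis
qed

section \<open>A block positive form\<close>

text \<open>A weighted sum of squares of the functionals that vanish on the state \<open>horodecki\<close> below and
  on its partial transpose, restricted to product vectors. It has no product vector in its
  kernel, so it remains a block positive form, i.e. a positive map from 2 by 2 to 4 by 4
  matrices, after subtracting a small multiple of the norm; but then it is negative on
  the state. The weights and the coordinates p, m of f1, f4 make the partial trace
  equal to 18 times the identity.\<close>

definition block_form :: "complex \<Rightarrow> complex \<Rightarrow> complex \<Rightarrow> complex \<Rightarrow> complex \<Rightarrow> complex \<Rightarrow> real" where
  "block_form \<alpha> \<beta> p m f2 f3 = (let f1 = p + 3/5 * m; f4 = p - 3/5 * m in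
     7 * (cmod (\<alpha> * f1 - \<beta> * f2))\<^sup>2 + 7 * (cmod (cnj \<alpha> * f4 - cnj \<beta> * f3))\<^sup>2
     + 8 * (cmod (\<alpha> * f3 - \<beta> * (f4 - f1 / 2)))\<^sup>2 + 8 * (cmod (cnj \<alpha> * f2 - cnj \<beta> * (f1 - f4 / 2)))\<^sup>2
     + 3/2 * (cmod (\<alpha> * f2 - \<beta> * f3))\<^sup>2 + 3/2 * (cmod (cnj \<alpha> * f3 - cnj \<beta> * f2))\<^sup>2)"

lemma block_form_nonneg: "0 \<le> block_form \<alpha> \<beta> p m f2 f3"
  unfolding block_form_def Let_def by simp

text \<open>With z = \<beta> / \<alpha>, the equations f2 = z f3 and f3 = \<open>cnj z\<close> f2
  give |z| = 1 unless f2 = 0. In that case f1 = z f2 and f4 = \<open>cnj z\<close> f3 reduce f3 = z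
  (f4 - f1 / 2) to z^2 f2 = 0, so f2 = 0 after all.\<close>

lemma block_form_zero:
  assumes z: "block_form \<alpha> \<beta> p m f2 f3 = 0" and u: "\<alpha> \<noteq> 0 \<or> \<beta> \<noteq> 0"
  shows "p = 0 \<and> m = 0 \<and> f2 = 0 \<and> f3 = 0"
proof -
  define f1 where "f1 = p + 3/5 * m"
  define f4 where "f4 = p - 3/5 * m"
  have "\<alpha> * f1 - \<beta> * f2 = 0 \<and> cnj \<alpha> * f4 - cnj \<beta> * f3 = 0 \<and> \<alpha> * f3 - \<beta> * (f4 - f1 / 2) = 0 \<and>
      cnj \<alpha> * f2 - cnj \<beta> * (f1 - f4 / 2) = 0 \<and> \<alpha> * f2 - \<beta> * f3 = 0 \<and> cnj \<alpha> * f3 - cnj \<beta> * f2 = 0"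
    using z unfolding block_form_def Let_def f1_def[symmetric] f4_def[symmetric]
    by (simp add: add_nonneg_eq_0_iff)
  then have e1: "\<alpha> * f1 = \<beta> * f2" and e2: "cnj \<alpha> * f4 = cnj \<beta> * f3" and e3: "\<alpha> * f3 = \<beta> * (f4 - f1 / 2)"
    and e4: "cnj \<alpha> * f2 = cnj \<beta> * (f1 - f4 / 2)" and e5: "\<alpha> * f2 = \<beta> * f3" and e6: "cnj \<alpha> * f3 = cnj \<beta> * f2"
    by simp_all
  have "f1 = 0 \<and> f2 = 0 \<and> f3 = 0 \<and> f4 = 0"
  proof (cases "\<alpha> = 0 \<or> \<beta> = 0")
    case True
    then show ?thesis
    proof
      assume "\<alpha> = 0"
      then have "f2 = 0" "f3 = 0" "f4 = f1 / 2" "f1 = f4 / 2" using u e1 e2 e3 e4 by auto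
      then show ?thesis by auto
    next
      assume "\<beta> = 0"
      then show ?thesis using u e1 e2 e3 e4 by auto
    qed
  next
    case False
    then have ab: "\<alpha> \<noteq> 0" "\<beta> \<noteq> 0" by auto
    define z where "z = \<beta> / \<alpha>"
    have z: "\<beta> = z * \<alpha>" "z \<noteq> 0" using ab by (simp_all add: z_def)
    have f1: "f1 = z * f2" and f4: "f4 = cnj z * f3" and f3: "f3 = z * (f4 - f1 / 2)" and f2: "f2 = z * f3" and f3': "f3 = cnj z * f2"
      using e1 e2 e3 e5 e6 ab by (auto simp: z(1))
    have "f2 = 0"
    proof (rule ccontr)
      assume "f2 \<noteq> 0"
      moreover have "f2 = z * cnj z * f2" using f2 f3' by (simp add: mult.assoc)
      ultimately have zz: "z * cnj z = 1" by simp
      have "f3 = z * cnj z * f3 - z * z * f2 / 2" using f3 f4 f1 by (simp add: algebra_simps)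
      then have "z * z * f2 = 0" unfolding zz by simp
      then show False using \<open>f2 \<noteq> 0\<close> z(2) by simp
    qed
    then show ?thesis using f1 f4 f3' by simp
  qed
  then have f: "f1 = 0" "f4 = 0" "f2 = 0" "f3 = 0" by auto
  have "2 * p = f1 + f4" "6/5 * m = f1 - f4" by (simp_all add: f1_def f4_def)
  then show ?thesis using f by simp
qed

lemma block_form_scale:
  "block_form \<alpha> \<beta> (complex_of_real r * p) (complex_of_real r * m) (complex_of_real r * f2) (complex_of_real r * f3)
     = r\<^sup>2 * block_form \<alpha> \<beta> p m f2 f3"
proof -
  have *: "cmod (a * (complex_of_real r * x) - b * (complex_of_real r * y)) = \<bar>r\<bar> * cmod (a * x - b * y)" for a b x y
  proof -
    have "a * (complex_of_real r * x) - b * (complex_of_real r * y) = complex_of_real r * (a * x - b * y)"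
      by (simp add: algebra_simps)
    then show ?thesis by (simp add: norm_mult)
  qed
  have l: "complex_of_real r * p + 3/5 * (complex_of_real r * m) = complex_of_real r * (p + 3/5 * m)"
    "complex_of_real r * p - 3/5 * (complex_of_real r * m) = complex_of_real r * (p - 3/5 * m)"
    "complex_of_real r * x - complex_of_real r * y / 2 = complex_of_real r * (x - y / 2)" for x y
    by (simp_all add: algebra_simps)
  show ?thesis unfolding block_form_def Let_def l * by (simp add: power_mult_distrib algebra_simps)
qed

text \<open>By compactness the continuous form, positive by \<open>block_form_zero\<close>, attains
  a positive minimum on the product of two unit spheres; homogeneity extends the bound.\<close>

lemma block_form_lower:
  "\<exists>\<epsilon>>0. \<forall>\<alpha> \<beta> p m f2 f3. (cmod \<alpha>)\<^sup>2 + (cmod \<beta>)\<^sup>2 = 1 \<longrightarrow>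
     \<epsilon> * ((cmod p)\<^sup>2 + (cmod m)\<^sup>2 + (cmod f2)\<^sup>2 + (cmod f3)\<^sup>2) \<le> block_form \<alpha> \<beta> p m f2 f3"
proof -
  define S where "S = sphere (0::complex \<times> complex) 1 \<times> sphere (0::complex \<times> complex \<times> complex \<times> complex) 1"
  define f :: "(complex \<times> complex) \<times> (complex \<times> complex \<times> complex \<times> complex) \<Rightarrow> real" where
    "f x = block_form (fst (fst x)) (snd (fst x)) (fst (snd x)) (fst (snd (snd x))) (fst (snd (snd (snd x)))) (snd (snd (snd (snd x))))" for x
  have "compact S" unfolding S_def by (intro compact_Times compact_sphere)
  moreover have "((1,0),(1,0,0,0)) \<in> S" by (simp add: S_def norm_Pair)
  then have "S \<noteq> {}" by blast
  moreover have "continuous_on S f"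
    unfolding f_def block_form_def Let_def by (intro continuous_intros) auto
  ultimately obtain x where x: "x \<in> S" "\<forall>y\<in>S. f x \<le> f y"
    using continuous_attains_inf by blast
  have pos: "f x > 0"
  proof -
    obtain \<alpha> \<beta> p m f2 f3 where xx: "x = ((\<alpha>,\<beta>),(p,m,f2,f3))" by (metis prod.collapse)
    have "f x \<noteq> 0"
    proof
      assume "f x = 0"
      then have "block_form \<alpha> \<beta> p m f2 f3 = 0" by (simp add: f_def xx)
      moreover have "\<alpha> \<noteq> 0 \<or> \<beta> \<noteq> 0" using x(1) by (auto simp: S_def xx norm_Pair)
      ultimately have "p = 0 \<and> m = 0 \<and> f2 = 0 \<and> f3 = 0" by (rule block_form_zero)
      then show False using x(1) by (auto simp: S_def xx norm_Pair)
    qed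
    moreover have "f x \<ge> 0" by (simp add: f_def block_form_nonneg)
    ultimately show ?thesis by simp
  qed
  show ?thesis
  proof (intro exI[of _ "f x"] conjI pos allI impI)
    fix \<alpha> \<beta> p m f2 f3 :: complex
    assume u: "(cmod \<alpha>)\<^sup>2 + (cmod \<beta>)\<^sup>2 = 1"
    define n where "n = (cmod p)\<^sup>2 + (cmod m)\<^sup>2 + (cmod f2)\<^sup>2 + (cmod f3)\<^sup>2"
    show "f x * ((cmod p)\<^sup>2 + (cmod m)\<^sup>2 + (cmod f2)\<^sup>2 + (cmod f3)\<^sup>2) \<le> block_form \<alpha> \<beta> p m f2 f3"
    proof (cases "n = 0")
      case True
      then show ?thesis using block_form_nonneg by (simp add: n_def)
    next
      case False
      moreover have "n \<ge> 0" by (simp add: n_def)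
      ultimately have n: "n > 0" by simp
      define r where "r = 1 / sqrt n"
      have r2: "r\<^sup>2 * n = 1" using n by (simp add: r_def power_divide)
      let ?y = "((\<alpha>,\<beta>),(complex_of_real r * p, complex_of_real r * m, complex_of_real r * f2, complex_of_real r * f3))"
      have "r\<^sup>2 * (cmod p)\<^sup>2 + (r\<^sup>2 * (cmod m)\<^sup>2 + (r\<^sup>2 * (cmod f2)\<^sup>2 + r\<^sup>2 * (cmod f3)\<^sup>2)) = 1"
        using r2 by (simp add: n_def algebra_simps)
      then have "?y \<in> S" using u by (simp add: S_def norm_Pair norm_mult power_mult_distrib)
      then have "f x \<le> f ?y" using x(2) by blast
      also have "\<dots> = r\<^sup>2 * block_form \<alpha> \<beta> p m f2 f3" by (simp add: f_def block_form_scale)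
      finally have "f x * n \<le> r\<^sup>2 * block_form \<alpha> \<beta> p m f2 f3 * n" using n by (intro mult_right_mono) auto
      also have "\<dots> = block_form \<alpha> \<beta> p m f2 f3" using r2 by (simp add: mult.commute mult.left_commute)
      finally show ?thesis by (simp add: n_def)
    qed
  qed
qed

text \<open>The Bloch components of \<open>block_form\<close>, see \<open>block_form_bloch\<close>.\<close>

definition Yw :: "complex mat list" where
  "Yw = map (mat_of_rows_list 4)
    [[[-10, 0, 0, 0], [0, 198/25, 0, 0], [0, 0, -1, 0], [0, 0, 0, -1]],
     [[0, 0, 11, 11], [0, 0, 57/5, -57/5], [11, 57/5, 0, 3], [11, -57/5, 3, 0]],
     [[0, 0, 11 * \<i>, - 11 * \<i>], [0, 0, 57/5 * \<i>, 57/5 * \<i>],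
      [- 11 * \<i>, - 57/5 * \<i>, 0, 3 * \<i>], [11 * \<i>, - 57/5 * \<i>, - 3 * \<i>, 0]]]"

lemma Yw_selfadj: "l < 3 \<Longrightarrow> selfadj 4 (Yw ! l)"
  by (drule nat3_cases, elim disjE; simp add: Yw_def selfadj_entry)
     (auto simp: mat_of_rows_list_def dest!: nat4_cases)

lemma ip4: "ip 4 x y = x 0 * cnj (y 0) + x 1 * cnj (y 1) + x 2 * cnj (y 2) + x 3 * cnj (y 3)"
proof -
  have "{..<4::nat} = {0,1,2,3}" by auto
  then show ?thesis by (simp add: ip_def)
qed

lemma act4: "act 4 A x i = A $$ (i,0) * x 0 + A $$ (i,1) * x 1 + A $$ (i,2) * x 2 + A $$ (i,3) * x 3"
proof -
  have "{..<4::nat} = {0,1,2,3}" by auto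
  then show ?thesis by (simp add: act_def)
qed

lemma Yw_form:
  "ip 4 (act 4 (Yw!0) x) y = -10 * x 0 * cnj (y 0) + 198/25 * x 1 * cnj (y 1) - x 2 * cnj (y 2) - x 3 * cnj (y 3)"
  "ip 4 (act 4 (Yw!1) x) y = (11 * x 2 + 11 * x 3) * cnj (y 0) + (57/5 * x 2 - 57/5 * x 3) * cnj (y 1)
     + (11 * x 0 + 57/5 * x 1 + 3 * x 3) * cnj (y 2) + (11 * x 0 - 57/5 * x 1 + 3 * x 2) * cnj (y 3)"
  "ip 4 (act 4 (Yw!2) x) y = \<i> * ((11 * x 2 - 11 * x 3) * cnj (y 0) + (57/5 * x 2 + 57/5 * x 3) * cnj (y 1)
     + (- 11 * x 0 - 57/5 * x 1 + 3 * x 3) * cnj (y 2) + (11 * x 0 - 57/5 * x 1 - 3 * x 2) * cnj (y 3))"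
  by (simp_all add: ip4 act4 Yw_def mat_of_rows_list_def algebra_simps)

text \<open>The three coefficients are the Bloch coordinates of (\<alpha>, \<beta>). Writing the 1
  in front of the norm term as |\<alpha>|^2 + |\<beta>|^2 makes both sides homogeneous, and the
  claim becomes a polynomial identity.\<close>

lemma block_form_bloch:
  fixes x :: "nat \<Rightarrow> complex"
  assumes u: "(cmod \<alpha>)\<^sup>2 + (cmod \<beta>)\<^sup>2 = 1"
  shows "complex_of_real (2 * block_form \<alpha> \<beta> (x 0) (x 1) (x 2) (x 3)) = 18 * ip 4 x x
     - ((\<alpha> * cnj \<alpha> - \<beta> * cnj \<beta>) * ip 4 (act 4 (Yw!0) x) x + (\<alpha> * cnj \<beta> + cnj \<alpha> * \<beta>) * ip 4 (act 4 (Yw!1) x) x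
     + \<i> * (\<alpha> * cnj \<beta> - cnj \<alpha> * \<beta>) * ip 4 (act 4 (Yw!2) x) x)"
proof -
  have ii: "\<i> * (\<i> * t) = - t" for t by (simp flip: mult.assoc)
  have "(\<alpha> * cnj \<alpha> + \<beta> * cnj \<beta>) = complex_of_real ((cmod \<alpha>)\<^sup>2 + (cmod \<beta>)\<^sup>2)"
    by (simp only: complex_norm_square of_real_add)
  then have one: "\<alpha> * cnj \<alpha> + \<beta> * cnj \<beta> = 1" using u by simp
  have "complex_of_real (2 * block_form \<alpha> \<beta> (x 0) (x 1) (x 2) (x 3)) = 18 * ((\<alpha> * cnj \<alpha> + \<beta> * cnj \<beta>) * ip 4 x x)
     - ((\<alpha> * cnj \<alpha> - \<beta> * cnj \<beta>) * ip 4 (act 4 (Yw!0) x) x + (\<alpha> * cnj \<beta> + cnj \<alpha> * \<beta>) * ip 4 (act 4 (Yw!1) x) x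
     + \<i> * (\<alpha> * cnj \<beta> - cnj \<alpha> * \<beta>) * ip 4 (act 4 (Yw!2) x) x)"
  proof -
    \<comment> \<open>The scaling by 2 and 10 clears the denominators 2 and 5 in the arguments of
      \<open>block_form\<close>.\<close>
    define p where "p = x 0 / 2"
    define m where "m = x 1 / 10"
    have x: "x 0 = 2 * p" "x 1 = 10 * m" by (simp_all add: p_def m_def)
    have f: "2 * p + 3/5 * (10 * m) = 2 * p + 6 * m" "2 * p - 3/5 * (10 * m) = 2 * p - 6 * m"
      "2 * p - 6 * m - (2 * p + 6 * m) / 2 = p - 9 * m" "2 * p + 6 * m - (2 * p - 6 * m) / 2 = p + 9 * m"
      by (simp_all add: field_simps)
    have c: "complex_of_real (2 * (7 * a\<^sup>2 + 7 * b\<^sup>2 + 8 * c\<^sup>2 + 8 * d\<^sup>2 + 3/2 * e\<^sup>2 + 3/2 * g\<^sup>2))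
        = 14 * complex_of_real (a\<^sup>2) + 14 * complex_of_real (b\<^sup>2) + 16 * complex_of_real (c\<^sup>2)
          + 16 * complex_of_real (d\<^sup>2) + 3 * complex_of_real (e\<^sup>2) + 3 * complex_of_real (g\<^sup>2)" for a b c d e g
      by simp
    show ?thesis
      unfolding block_form_def Let_def Yw_form
      unfolding ip4 x f c complex_norm_square
      by (simp add: algebra_simps ii)
  qed
  then show ?thesis by (simp add: one)
qed

text \<open>Surjectivity of the Hopf map: \<alpha> may be taken as the real number sqrt ((1 +
  u1)/2), which determines \<beta>. At the pole u1 = -1 this \<alpha> is 0 and cannot be divided
  by.\<close>

lemma bloch_vector:
  fixes u1 u2 u3 :: real
  assumes u: "u1\<^sup>2 + u2\<^sup>2 + u3\<^sup>2 = 1"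
  shows "\<exists>\<alpha> \<beta>. (cmod \<alpha>)\<^sup>2 + (cmod \<beta>)\<^sup>2 = 1 \<and> \<alpha> * cnj \<alpha> - \<beta> * cnj \<beta> = u1 \<and>
     \<alpha> * cnj \<beta> + cnj \<alpha> * \<beta> = u2 \<and> \<i> * (\<alpha> * cnj \<beta> - cnj \<alpha> * \<beta>) = u3"
proof (cases "u1 = -1")
  case True
  then have "u2\<^sup>2 + u3\<^sup>2 = 0" using u by simp
  then have "u2 = 0" "u3 = 0" by (simp_all add: sum_power2_eq_zero_iff)
  then show ?thesis using True by (intro exI[of _ 0] exI[of _ 1]) simp
next
  case False
  have "u1\<^sup>2 \<le> 1" using u by (smt (verit) zero_le_power2)
  then have "\<bar>u1\<bar> \<le> 1" by (simp add: abs_square_le_1)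
  then have pos: "1 + u1 > 0" using False by linarith
  define a where "a = sqrt ((1 + u1) / 2)"
  have a: "a > 0" "a * a = (1 + u1) / 2" using pos by (simp_all add: a_def)
  define \<beta> where "\<beta> = Complex (u2 / (2 * a)) (u3 / (2 * a))"
  have "(u2 / (2 * a))\<^sup>2 + (u3 / (2 * a))\<^sup>2 = (u2\<^sup>2 + u3\<^sup>2) / (4 * (a * a))"
    by (simp add: power_divide power_mult_distrib add_divide_distrib power2_eq_square)
  also have "u2\<^sup>2 + u3\<^sup>2 = (1 - u1) * (1 + u1)" using u by (simp add: algebra_simps power2_eq_square)
  also have "4 * (a * a) = 2 * (1 + u1)" using a(2) by simp
  also have "(1 - u1) * (1 + u1) / (2 * (1 + u1)) = (1 - u1) / 2"
    by (rule mult_divide_mult_cancel_right) (use pos in simp)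
  finally have b: "(u2 / (2 * a))\<^sup>2 + (u3 / (2 * a))\<^sup>2 = (1 - u1) / 2" .
  have cb: "(cmod \<beta>)\<^sup>2 = (1 - u1) / 2" using b by (simp add: \<beta>_def cmod_power2)
  have bb: "\<beta> * cnj \<beta> = complex_of_real ((1 - u1) / 2)" using cb by (simp only: complex_norm_square[symmetric])
  show ?thesis
  proof (rule exI[of _ "complex_of_real a"], rule exI[of _ \<beta>], intro conjI)
    have "(cmod (complex_of_real a))\<^sup>2 = (1 + u1) / 2" using a by (simp add: power2_eq_square)
    then show "(cmod (complex_of_real a))\<^sup>2 + (cmod \<beta>)\<^sup>2 = 1" unfolding cb by (simp add: field_simps)
    have "complex_of_real a * cnj (complex_of_real a) = complex_of_real ((1 + u1) / 2)" by (simp flip: a(2))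
    then show "complex_of_real a * cnj (complex_of_real a) - \<beta> * cnj \<beta> = u1"
      unfolding bb by (simp add: field_simps)
    show "complex_of_real a * cnj \<beta> + cnj (complex_of_real a) * \<beta> = u2"
      "\<i> * (complex_of_real a * cnj \<beta> - cnj (complex_of_real a) * \<beta>) = u3"
      using a(1) by (simp_all add: complex_eq_iff \<beta>_def field_simps)
  qed
qed

text \<open>By \<open>block_form_bloch\<close> a lower bound \<epsilon> for the block form is the
  upper bound 18 - 2 \<epsilon> for every component of \<open>Yw\<close> in a unit
  direction.\<close>

lemma scaled_Yw_in_wmax:
  assumes h: "h > 0" "18 - 2 * \<epsilon> \<le> h"
    and low: "\<And>\<alpha> \<beta> p m f2 f3. (cmod \<alpha>)\<^sup>2 + (cmod \<beta>)\<^sup>2 = 1 \<Longrightarrow>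
     \<epsilon> * ((cmod p)\<^sup>2 + (cmod m)\<^sup>2 + (cmod f2)\<^sup>2 + (cmod f3)\<^sup>2) \<le> block_form \<alpha> \<beta> p m f2 f3"
  shows "map (\<lambda>l. complex_of_real (1/h) \<cdot>\<^sub>m Yw ! l) [0..<3] \<in> wmax_ball 4"
proof -
  define Y where "Y = map (\<lambda>l. complex_of_real (1/h) \<cdot>\<^sub>m Yw ! l) [0..<3]"
  have Yl: "Y ! l = complex_of_real (1/h) \<cdot>\<^sub>m Yw ! l" if "l < 3" for l using that by (simp add: Y_def)
  have c: "Yw ! l \<in> carrier_mat 4 4" if "l < 3" for l using Yw_selfadj[OF that] by (simp add: selfadj_def)
  have "SM_tuple 3 4 Y"
    unfolding SM_tuple_def
  proof (intro conjI allI impI)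
    show "length Y = 3" by (simp add: Y_def)
    fix l :: nat assume l: "l < 3"
    show "selfadj 4 (Y ! l)" unfolding Yl[OF l] using Yw_selfadj[OF l] by (auto simp: selfadj_entry)
  qed
  moreover have "Re (u1 * ip 4 (act 4 (Y!0) x) x + u2 * ip 4 (act 4 (Y!1) x) x + u3 * ip 4 (act 4 (Y!2) x) x) \<le> Re (ip 4 x x)"
    if u: "u1\<^sup>2 + u2\<^sup>2 + u3\<^sup>2 = (1::real)" for u1 u2 u3 x
  proof -
    obtain \<alpha> \<beta> where ab: "(cmod \<alpha>)\<^sup>2 + (cmod \<beta>)\<^sup>2 = 1" "\<alpha> * cnj \<alpha> - \<beta> * cnj \<beta> = u1"
     "\<alpha> * cnj \<beta> + cnj \<alpha> * \<beta> = u2" "\<i> * (\<alpha> * cnj \<beta> - cnj \<alpha> * \<beta>) = u3"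
      using bloch_vector[OF u] by blast
    have sc: "ip 4 (act 4 (Y!l) x) x = complex_of_real (1/h) * ip 4 (act 4 (Yw!l) x) x" if "l < 3" for l
    proof -
      have "ip 4 (act 4 (Y!l) x) x = ip 4 (\<lambda>i. complex_of_real (1/h) * act 4 (Yw!l) x i) x"
      proof (rule ip_cong)
        fix i :: nat assume i: "i < 4"
        have "act 4 (complex_of_real (1/h) \<cdot>\<^sub>m Yw ! l) x i = complex_of_real (1/h) * act 4 (Yw!l) x i"
          unfolding act_def sum_distrib_left using c[OF that] i by (intro sum.cong) auto
        then show "act 4 (Y!l) x i = complex_of_real (1/h) * act 4 (Yw!l) x i" unfolding Yl[OF that] .
      qed simp
      then show ?thesis by (simp only: ip_scale_left)
    qed
    define R where "R = Re (u1 * ip 4 (act 4 (Yw!0) x) x + u2 * ip 4 (act 4 (Yw!1) x) x + u3 * ip 4 (act 4 (Yw!2) x) x)"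
    have "2 * block_form \<alpha> \<beta> (x 0) (x 1) (x 2) (x 3) = 18 * Re (ip 4 x x) - R"
      using arg_cong[OF block_form_bloch[OF ab(1), of x], of Re] unfolding ab(2-4) R_def by simp
    moreover have "Re (ip 4 x x) = (cmod (x 0))\<^sup>2 + (cmod (x 1))\<^sup>2 + (cmod (x 2))\<^sup>2 + (cmod (x 3))\<^sup>2"
      unfolding ip4 cmod_power2 by (simp add: power2_eq_square)
    ultimately have "R \<le> (18 - 2 * \<epsilon>) * Re (ip 4 x x)"
      using low[OF ab(1), of "x 0" "x 1" "x 2" "x 3"] by (simp add: algebra_simps)
    also have "\<dots> \<le> h * Re (ip 4 x x)" by (intro mult_right_mono h ip_self_nonneg)
    finally have "R / h \<le> Re (ip 4 x x)" using h(1) by (simp add: field_simps)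
    moreover have "Re (u1 * ip 4 (act 4 (Y!0) x) x + u2 * ip 4 (act 4 (Y!1) x) x + u3 * ip 4 (act 4 (Y!2) x) x) = R / h"
      by (simp del: One_nat_def add: sc R_def add_divide_distrib)
    ultimately show ?thesis by simp
  qed
  ultimately show ?thesis unfolding wmax_ball_def Y_def[symmetric] by simp
qed

section \<open>A state with positive partial transpose\<close>

text \<open>The entangled 2 by 4 state of Horodecki with parameter 3/5: its blocks are $3 I$, $3 N$ and
  $D$, where N is the nilpotent shift and D differs from $3 I$ in its four corners. It is positive
  together with its partial transpose, which yields the two cases of \<open>Hs_half_form\<close>.\<close>

definition H0 :: "complex mat" where
  "H0 = mat_of_rows_list 4 [[7/2, 0, 0, 1], [0, 3, 0, 0], [0, 0, 3, 0], [1, 0, 0, 7/2]]"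

definition Hs :: "complex mat list" where
  "Hs = map (mat_of_rows_list 4)
    [[[-1/2, 0, 0, -1], [0, 0, 0, 0], [0, 0, 0, 0], [-1, 0, 0, -1/2]],
     [[0, 3/2, 0, 0], [3/2, 0, 3/2, 0], [0, 3/2, 0, 3/2], [0, 0, 3/2, 0]],
     [[0, - (3/2 * \<i>), 0, 0], [3/2 * \<i>, 0, - (3/2 * \<i>), 0], [0, 3/2 * \<i>, 0, - (3/2 * \<i>)], [0, 0, 3/2 * \<i>, 0]]]"

lemma H0_selfadj: "selfadj 4 H0"
  unfolding selfadj_entry by (auto simp: H0_def mat_of_rows_list_def dest!: nat4_cases)

lemma Hs_selfadj: "l < 3 \<Longrightarrow> selfadj 4 (Hs ! l)"
  by (drule nat3_cases, elim disjE; simp add: Hs_def selfadj_entry)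
     (auto simp: mat_of_rows_list_def dest!: nat4_cases)

text \<open>The tensor factors stand in the opposite order to the pencil, so that the blocks on
  which \<open>amplify\<close> evaluates a map are combinations of 1 and F3.\<close>

definition horodecki :: "complex mat" where
  "horodecki = kron H0 (1\<^sub>m 4) - msum 16 16 (\<lambda>l. kron (Hs!l) (F3!l)) {..<3}"

lemma F3_carrier: "l < 3 \<Longrightarrow> F3 ! l \<in> carrier_mat 4 4"
  using selfadj_F3 by (auto simp: selfadj_def)

lemma H_carrier: "H0 \<in> carrier_mat 4 4" "l < 3 \<Longrightarrow> Hs ! l \<in> carrier_mat 4 4"
  using H0_selfadj Hs_selfadj by (auto simp: selfadj_def)

lemma horodecki_selfadj: "selfadj 16 horodecki"
proof -
  have "selfadj (4*4) (kron H0 (1\<^sub>m 4))" by (intro selfadj_kron H0_selfadj selfadj_one)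
  moreover have "selfadj (4*4) (kron (Hs!l) (F3!l))" if "l < 3" for l
    by (intro selfadj_kron Hs_selfadj selfadj_F3 that)
  ultimately show ?thesis unfolding horodecki_def by (intro selfadj_diff selfadj_msum) auto
qed

lemma horodecki_index:
  assumes "i < 4" "j < 4" "p < 4" "q < 4"
  shows "horodecki $$ (i*4+p, j*4+q) = H0 $$ (i,j) * (if p = q then 1 else 0)
     - (\<Sum>l<3. Hs!l $$ (i,j) * F3!l $$ (p,q))"
proof -
  have lt: "i*4+p < 16" "j*4+q < 16" using assms by auto
  have k: "kron (Hs!l) (F3!l) $$ (i*4+p, j*4+q) = Hs!l $$ (i,j) * F3!l $$ (p,q)" if "l < 3" for l
    by (rule kron_index[OF H_carrier(2)[OF that] F3_carrier[OF that] assms(1,2,3,4)])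
  have "kron H0 (1\<^sub>m 4) $$ (i*4+p, j*4+q) = H0 $$ (i,j) * 1\<^sub>m 4 $$ (p,q)"
    by (rule kron_index[OF H_carrier(1) one_carrier_mat assms(1,2,3,4)])
  then show ?thesis using lt assms(3,4) k by (simp add: horodecki_def msum_def)
qed

lemma ip_act_blocks:
  "ip (k*n) (act (k*n) A w) w
    = (\<Sum>i<k. \<Sum>j<k. \<Sum>p<n. \<Sum>q<n. A $$ (i*n+p, j*n+q) * w (j*n+q) * cnj (w (i*n+p)))"
  unfolding ip_def act_def sum_blocks sum_distrib_right
  by (rule sum.cong[OF refl]) (rule sum.swap)

text \<open>Regrouping the sums by the second tensor factor makes \<open>F3form_split\<close>
  applicable although F3 now stands on the right.\<close>

lemma horodecki_form:
  "ip 16 (act 16 horodecki w) w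
    = (\<Sum>p<4. ip 4 (act 4 H0 (\<lambda>i. w (i*4+p))) (\<lambda>i. w (i*4+p))) - F3form 4 (\<lambda>l. Hs!l) (\<lambda>p i. w (i*4+p))"
proof -
  have "ip 16 (act 16 horodecki w) w
      = (\<Sum>i<4. \<Sum>j<4. \<Sum>p<4. \<Sum>q<4. H0 $$ (i,j) * (if p = q then 1 else 0) * w (j*4+q) * cnj (w (i*4+p))
         - (\<Sum>l<3. F3!l $$ (p,q) * (Hs!l $$ (i,j) * w (j*4+q) * cnj (w (i*4+p)))))"
  proof -
    have "ip (4*4) (act (4*4) horodecki w) w
      = (\<Sum>i<4. \<Sum>j<4. \<Sum>p<4. \<Sum>q<4. H0 $$ (i,j) * (if p = q then 1 else 0) * w (j*4+q) * cnj (w (i*4+p))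
         - (\<Sum>l<3. F3!l $$ (p,q) * (Hs!l $$ (i,j) * w (j*4+q) * cnj (w (i*4+p)))))"
      unfolding ip_act_blocks
      by (intro sum.cong refl)
         (simp only: lessThan_iff horodecki_index left_diff_distrib sum_distrib_right, simp only: mult_ac)
    then show ?thesis by simp
  qed
  also have "\<dots> = (\<Sum>i<4. \<Sum>j<4. \<Sum>p<4. H0 $$ (i,j) * w (j*4+p) * cnj (w (i*4+p)))
       - (\<Sum>i<4. \<Sum>j<4. \<Sum>p<4. \<Sum>q<4. \<Sum>l<3. F3!l $$ (p,q) * (Hs!l $$ (i,j) * w (j*4+q) * cnj (w (i*4+p))))"
  proof -
    have "(\<Sum>q<4. c * (if p = q then 1 else 0) * w (j*4+q) * d) = c * w (j*4+p) * d" if "p < 4" for c d j p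
    proof -
      have "(\<Sum>q<4. c * (if p = q then 1 else 0) * w (j*4+q) * d) = (\<Sum>q<4. if q = p then c * w (j*4+q) * d else 0)"
        by (rule sum.cong) auto
      then show ?thesis using that by simp
    qed
    then show ?thesis by (simp add: sum_subtractf)
  qed
  also have "(\<Sum>i<4. \<Sum>j<4. \<Sum>p<4. H0 $$ (i,j) * w (j*4+p) * cnj (w (i*4+p)))
      = (\<Sum>p<4. ip 4 (act 4 H0 (\<lambda>i. w (i*4+p))) (\<lambda>i. w (i*4+p)))"
  proof -
    have "(\<Sum>i<4. \<Sum>j<4. \<Sum>p<4. H0 $$ (i,j) * w (j*4+p) * cnj (w (i*4+p)))
        = (\<Sum>i<4. \<Sum>p<4. \<Sum>j<4. H0 $$ (i,j) * w (j*4+p) * cnj (w (i*4+p)))"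
      by (rule sum.cong[OF refl]) (rule sum.swap)
    also have "\<dots> = (\<Sum>p<4. \<Sum>i<4. \<Sum>j<4. H0 $$ (i,j) * w (j*4+p) * cnj (w (i*4+p)))" by (rule sum.swap)
    finally show ?thesis by (simp add: ip_def act_def sum_distrib_right)
  qed
  also have "(\<Sum>i<4. \<Sum>j<4. \<Sum>p<4. \<Sum>q<4. \<Sum>l<3. F3!l $$ (p,q) * (Hs!l $$ (i,j) * w (j*4+q) * cnj (w (i*4+p))))
      = F3form 4 (\<lambda>l. Hs!l) (\<lambda>p i. w (i*4+p))"
  proof -
    let ?g = "\<lambda>i j p q l. F3!l $$ (p,q) * (Hs!l $$ (i,j) * w (j*4+q) * cnj (w (i*4+p)))"
    define T where "T = {..<4::nat} \<times> {..<4::nat} \<times> {..<3::nat}"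
    define G where "G i j t = ?g i j (fst t) (fst (snd t)) (snd (snd t))" for i j t
    have "(\<Sum>i<4. \<Sum>j<4. \<Sum>p<4. \<Sum>q<4. \<Sum>l<3. ?g i j p q l) = (\<Sum>i<4. \<Sum>j<4. \<Sum>t\<in>T. G i j t)"
      by (simp add: T_def G_def sum.cartesian_product')
    also have "\<dots> = (\<Sum>i<4. \<Sum>t\<in>T. \<Sum>j<4. G i j t)"
      by (rule sum.cong[OF refl]) (rule sum.swap)
    also have "\<dots> = (\<Sum>t\<in>T. \<Sum>i<4. \<Sum>j<4. G i j t)" by (rule sum.swap)
    also have "\<dots> = (\<Sum>p<4. \<Sum>q<4. \<Sum>l<3. \<Sum>i<4. \<Sum>j<4. ?g i j p q l)"
      by (simp add: T_def G_def sum.cartesian_product')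
    finally show ?thesis by (simp add: F3form_def ip_def act_def sum_distrib_left sum_distrib_right)
  qed
  finally show ?thesis .
qed

lemma Hs_form:
  "ip 4 (act 4 H0 x) y = (7/2 * x 0 + x 3) * cnj (y 0) + 3 * x 1 * cnj (y 1) + 3 * x 2 * cnj (y 2) + (x 0 + 7/2 * x 3) * cnj (y 3)"
  "ip 4 (act 4 (Hs!0) x) y = (- 1/2 * x 0 - x 3) * cnj (y 0) + (- x 0 - 1/2 * x 3) * cnj (y 3)"
  "ip 4 (act 4 (Hs!1) x) y = 3/2 * (x 1 * cnj (y 0) + (x 0 + x 2) * cnj (y 1) + (x 1 + x 3) * cnj (y 2) + x 2 * cnj (y 3))"
  "ip 4 (act 4 (Hs!2) x) y = 3/2 * \<i> * (- x 1 * cnj (y 0) + (x 0 - x 2) * cnj (y 1) + (x 1 - x 3) * cnj (y 2) + x 2 * cnj (y 3))"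
  by (simp_all add: ip4 act4 H0_def Hs_def mat_of_rows_list_def algebra_simps)

text \<open>Each case is a sum of five squares; the second arises from the first by reversing the
  order of the four coordinates of x and y.\<close>

lemma Hs_half_form:
  assumes e: "e \<in> {\<i>, -\<i>}"
  shows "0 \<le> Re (ip 4 (act 4 H0 x) x + ip 4 (act 4 H0 y) y - pdiag e 4 (\<lambda>l. Hs!l) x y)"
proof -
  have ii: "\<i> * (\<i> * t) = - t" for t by (simp flip: mult.assoc)
  have sq: "z * cnj z = complex_of_real ((cmod z)\<^sup>2)" for z by (rule complex_norm_square[symmetric])
  consider "e = \<i>" | "e = -\<i>" using e by auto
  then show ?thesis
  proof cases
    case 1
    have "ip 4 (act 4 H0 x) x + ip 4 (act 4 H0 y) y - pdiag e 4 (\<lambda>l. Hs!l) x y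
      = 3 * ((y 0) * cnj (y 0)) + 3 * ((y 1 - x 0) * cnj (y 1 - x 0)) + 3 * ((y 2 - x 1) * cnj (y 2 - x 1))
        + 3 * ((y 3 - x 2) * cnj (y 3 - x 2)) + (x 0 + 2 * x 3) * cnj (x 0 + 2 * x 3)"
      unfolding pdiag_def Hs_form 1 by (simp add: algebra_simps ii)
    then show ?thesis unfolding sq by simp
  next
    case 2
    have "ip 4 (act 4 H0 x) x + ip 4 (act 4 H0 y) y - pdiag e 4 (\<lambda>l. Hs!l) x y
      = 3 * ((y 3) * cnj (y 3)) + 3 * ((y 0 - x 1) * cnj (y 0 - x 1)) + 3 * ((y 1 - x 2) * cnj (y 1 - x 2))
        + 3 * ((y 2 - x 3) * cnj (y 2 - x 3)) + (x 3 + 2 * x 0) * cnj (x 3 + 2 * x 0)"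
      unfolding pdiag_def Hs_form 2 by (simp add: algebra_simps ii)
    then show ?thesis unfolding sq by simp
  qed
qed

lemma horodecki_psd: "psd 16 horodecki"
  unfolding psd_iff_ip
proof (intro conjI allI horodecki_selfadj)
  fix w :: "nat \<Rightarrow> complex"
  define v where "v = (\<lambda>p i. w (i*4+p))"
  have vp: "v p = (\<lambda>i. w (i*4+p))" for p by (simp add: v_def)
  define x where "x = (\<lambda>i. (v 0 i + \<i> * v 3 i)/2)"
  define x' where "x' = (\<lambda>i. (v 0 i - \<i> * v 3 i)/2)"
  define y where "y = (\<lambda>i. (v 2 i - \<i> * v 1 i)/2)"
  define y' where "y' = (\<lambda>i. (v 2 i + \<i> * v 1 i)/2)"
  have v: "v a = vsplit x x' y y' a" if "a < 4" for a
    unfolding x_def x'_def y_def y'_def by (rule vsplit_surj[OF that])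
  have 4: "{..<4::nat} = {0,1,2,3}" by auto
  have "(\<Sum>p<4. ip 4 (act 4 H0 (v p)) (v p)) = (\<Sum>p<4. ip 4 (act 4 H0 (vsplit x x' y y' p)) (vsplit x x' y y' p))"
    by (rule sum.cong) (simp_all add: v)
  also have "\<dots> = 2 * (ip 4 (act 4 H0 x) x + ip 4 (act 4 H0 y) y + ip 4 (act 4 H0 x') x' + ip 4 (act 4 H0 y') y')"
    unfolding 4
    by (simp add: vsplit_def act_lin ip_lin act_add[abs_def] act_diff[abs_def] act_minus[abs_def] act_scale[abs_def])
       (simp add: algebra_simps)
  finally have n: "(\<Sum>p<4. ip 4 (act 4 H0 (v p)) (v p))
      = 2 * (ip 4 (act 4 H0 x) x + ip 4 (act 4 H0 y) y + ip 4 (act 4 H0 x') x' + ip 4 (act 4 H0 y') y')" .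
  have f: "F3form 4 (\<lambda>l. Hs!l) v = 2 * (pdiag \<i> 4 (\<lambda>l. Hs!l) x y + pdiag (-\<i>) 4 (\<lambda>l. Hs!l) x' y')"
    unfolding F3form_split[symmetric] by (rule F3form_cong) (simp add: v)
  have "ip 16 (act 16 horodecki w) w = 2 * ((ip 4 (act 4 H0 x) x + ip 4 (act 4 H0 y) y - pdiag \<i> 4 (\<lambda>l. Hs!l) x y)
      + (ip 4 (act 4 H0 x') x' + ip 4 (act 4 H0 y') y' - pdiag (-\<i>) 4 (\<lambda>l. Hs!l) x' y'))"
    unfolding horodecki_form vp[symmetric] n f by (simp add: algebra_simps)
  then show "0 \<le> Re (ip 16 (act 16 horodecki w) w)"
    using Hs_half_form[of \<i> x y] Hs_half_form[of "-\<i>" x' y'] by simp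
qed

text \<open>The basis dual to the functionals f1, f2, f3, f4 in the coordinates p, m, f2, f3.\<close>

definition test_vec :: "nat \<Rightarrow> nat \<Rightarrow> complex" where
  "test_vec i a = [[1/2, 5/6, 0, 0], [0, 0, 1, 0], [0, 0, 0, 1], [1/2, -5/6, 0, 0]] ! i ! a"

text \<open>The ratio of the two values is exactly 18: the functionals whose squares make up the
  block form vanish on the state, so the state pairs to 0 with the form whose partial trace is
  18.\<close>

lemma test_vec_value:
  "(\<Sum>i<4. \<Sum>j<4. H0 $$ (i,j) * ip 4 (test_vec j) (test_vec i)) = 211/18"
  "(\<Sum>i<4. \<Sum>j<4. \<Sum>l<3. Hs!l $$ (i,j) * ip 4 (act 4 (Yw!l) (test_vec j)) (test_vec i)) = 211"
proof -
  have 4: "{..<4::nat} = {0,1,2,3}" and 3: "{..<3::nat} = {0,1,2}" by auto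
  show "(\<Sum>i<4. \<Sum>j<4. H0 $$ (i,j) * ip 4 (test_vec j) (test_vec i)) = 211/18"
    unfolding 4 ip4 by (simp add: test_vec_def H0_def mat_of_rows_list_def)
  show "(\<Sum>i<4. \<Sum>j<4. \<Sum>l<3. Hs!l $$ (i,j) * ip 4 (act 4 (Yw!l) (test_vec j)) (test_vec i)) = 211"
    unfolding 4 3 by (simp del: One_nat_def add: Yw_form) (simp add: test_vec_def Hs_def mat_of_rows_list_def)
qed

text \<open>Block (i,j) of the state is a combination of 1 and F3, where linearity and unitality
  express the map through its values on F3.\<close>

lemma amplified_horodecki:
  assumes phi: "ucp 4 4 phi" and i: "i < 4" and j: "j < 4" and a: "a < 4" and b: "b < 4"
  shows "amplify 4 4 4 phi horodecki $$ (i*4+a, j*4+b)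
     = H0 $$ (i,j) * (if a = b then 1 else 0) - (\<Sum>l<3. Hs!l $$ (i,j) * phi (F3!l) $$ (a,b))"
proof -
  have add: "phi (A + B) = phi A + phi B" if "A \<in> carrier_mat 4 4" "B \<in> carrier_mat 4 4" for A B
    using phi that by (simp add: ucp_def)
  have sm: "phi (c \<cdot>\<^sub>m A) = c \<cdot>\<^sub>m phi A" if "A \<in> carrier_mat 4 4" for c A
    using phi that by (simp add: ucp_def)
  have one: "phi (1\<^sub>m 4) = 1\<^sub>m 4" using phi by (simp add: ucp_def)
  have pc: "phi A \<in> carrier_mat 4 4" if "A \<in> carrier_mat 4 4" for A using phi that by (simp add: ucp_def)
  note Fc = F3_carrier[of 0, simplified] F3_carrier[of 1, simplified] F3_carrier[of 2, simplified]
  note Pc = Fc[THEN pc]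
  have 3: "{..<3::nat} = {0,1,2}" by auto
  define B where "B = mat 4 4 (\<lambda>(p,q). horodecki $$ (i*4+p, j*4+q))"
  have "B = H0 $$ (i,j) \<cdot>\<^sub>m 1\<^sub>m 4 + ((- Hs!0 $$ (i,j)) \<cdot>\<^sub>m F3!0 + ((- Hs!1 $$ (i,j)) \<cdot>\<^sub>m F3!1 + (- Hs!2 $$ (i,j)) \<cdot>\<^sub>m F3!2))"
    by (rule eq_matI) (use Fc in \<open>auto simp: B_def horodecki_index[OF i j] 3\<close>)
  then have pB: "phi B = H0 $$ (i,j) \<cdot>\<^sub>m 1\<^sub>m 4 + ((- Hs!0 $$ (i,j)) \<cdot>\<^sub>m phi (F3!0)
      + ((- Hs!1 $$ (i,j)) \<cdot>\<^sub>m phi (F3!1) + (- Hs!2 $$ (i,j)) \<cdot>\<^sub>m phi (F3!2)))"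
    using Fc by (simp add: add sm one)
  have lt: "i*4+a < 16" "j*4+b < 16" using i j a b by auto
  have "amplify 4 4 4 phi horodecki $$ (i*4+a, j*4+b) = phi B $$ (a,b)"
    using lt a b by (simp add: amplify_def B_def)
  then show ?thesis unfolding pB using a b Pc by (auto simp: 3)
qed

theorem not_maximal: "\<not> is_max_mcs 3 ball3 (matrix_range 4 F3)"
proof
  assume max: "is_max_mcs 3 ball3 (matrix_range 4 F3)"
  obtain \<epsilon>0 where e0: "\<epsilon>0 > 0" "\<And>\<alpha> \<beta> p m f2 f3. (cmod \<alpha>)\<^sup>2 + (cmod \<beta>)\<^sup>2 = 1 \<Longrightarrow>
     \<epsilon>0 * ((cmod p)\<^sup>2 + (cmod m)\<^sup>2 + (cmod f2)\<^sup>2 + (cmod f3)\<^sup>2) \<le> block_form \<alpha> \<beta> p m f2 f3"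
    using block_form_lower by blast
  \<comment> \<open>The bound 17 keeps h positive however large \<open>\<epsilon>0\<close> is; h <
    18 makes the final pairing negative.\<close>
  define h where "h = max 17 (18 - 2 * \<epsilon>0)"
  have h: "h > 0" "h < 18" "18 - 2 * \<epsilon>0 \<le> h" using e0 by (auto simp: h_def)
  define Y where "Y = map (\<lambda>l. complex_of_real (1/h) \<cdot>\<^sub>m Yw ! l) [0..<3]"
  have "Y \<in> wmax_ball 4" unfolding Y_def by (rule scaled_Yw_in_wmax[OF h(1,3) e0(2)])
  moreover have "wmax_ball 4 \<subseteq> matrix_range 4 F3 4"
    using max wmax_ball_convex wmax_ball_level1 unfolding is_max_mcs_def by blast
  ultimately obtain phi where phi: "ucp 4 4 phi" "Y = map phi F3" by (auto simp: matrix_range_def)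
  have Yl: "phi (F3!l) = complex_of_real (1/h) \<cdot>\<^sub>m Yw ! l" if "l < 3" for l
  proof -
    have "map phi F3 ! l = Y ! l" using phi(2) by simp
    then show ?thesis using that by (simp add: Y_def)
  qed
  have Yc: "Yw ! l \<in> carrier_mat 4 4" if "l < 3" for l using Yw_selfadj[OF that] by (simp add: selfadj_def)
  \<comment> \<open>The block vector with blocks \<open>test_vec i\<close>: evaluating the
    amplification here gives the pairing of the state with the map.\<close>
  define w where "w = (\<lambda>r. test_vec (r div 4) (r mod 4))"
  have w: "w (i*4+a) = test_vec i a" if "a < 4" for i a using that by (simp add: w_def)
  have "psd (4*4) (amplify 4 4 4 phi horodecki)"
  proof -
    have "\<forall>k. \<forall>M\<in>carrier_mat (k*4) (k*4). psd (k*4) M \<longrightarrow> psd (k*4) (amplify k 4 4 phi M)"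
      using phi(1) unfolding ucp_def by blast
    moreover have "horodecki \<in> carrier_mat (4*4) (4*4)" "psd (4*4) horodecki"
      using horodecki_psd horodecki_selfadj by (simp_all add: selfadj_def)
    ultimately show ?thesis by blast
  qed
  then have "0 \<le> Re (ip (4*4) (act (4*4) (amplify 4 4 4 phi horodecki) w) w)" unfolding psd_iff_ip by blast
  moreover have "ip (4*4) (act (4*4) (amplify 4 4 4 phi horodecki) w) w
      = 211/18 - complex_of_real (1/h) * 211"
  proof -
    have "(\<Sum>p<4. \<Sum>q<4. amplify 4 4 4 phi horodecki $$ (i*4+p, j*4+q) * w (j*4+q) * cnj (w (i*4+p)))
        = H0 $$ (i,j) * ip 4 (test_vec j) (test_vec i)
          - complex_of_real (1/h) * (\<Sum>l<3. Hs!l $$ (i,j) * ip 4 (act 4 (Yw!l) (test_vec j)) (test_vec i))"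
      if ij: "i < 4" "j < 4" for i j
    proof -
      have "(\<Sum>p<4. \<Sum>q<4. amplify 4 4 4 phi horodecki $$ (i*4+p, j*4+q) * w (j*4+q) * cnj (w (i*4+p)))
        = (\<Sum>p<4. \<Sum>q<4. (if p = q then H0 $$ (i,j) * test_vec j q * cnj (test_vec i p) else 0)
           - complex_of_real (1/h) * (\<Sum>l<3. Hs!l $$ (i,j) * (Yw!l $$ (p,q) * test_vec j q * cnj (test_vec i p))))"
      proof (intro sum.cong refl)
        fix p q assume "p \<in> {..<4::nat}" "q \<in> {..<4::nat}"
        then have pq: "p < 4" "q < 4" by auto
        have "(\<Sum>l<3. Hs!l $$ (i,j) * phi (F3!l) $$ (p,q)) = complex_of_real (1/h) * (\<Sum>l<3. Hs!l $$ (i,j) * Yw!l $$ (p,q))"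
          unfolding sum_distrib_left
        proof (rule sum.cong)
          fix l assume "l \<in> {..<3::nat}"
          then have "l < 3" by simp
          then have "phi (F3!l) $$ (p,q) = complex_of_real (1/h) * Yw!l $$ (p,q)"
            unfolding Yl[OF \<open>l < 3\<close>] using pq Yc[OF \<open>l < 3\<close>] by auto
          then show "Hs!l $$ (i,j) * phi (F3!l) $$ (p,q) = complex_of_real (1/h) * (Hs!l $$ (i,j) * Yw!l $$ (p,q))" by simp
        qed simp
        then show "amplify 4 4 4 phi horodecki $$ (i*4+p, j*4+q) * w (j*4+q) * cnj (w (i*4+p))
            = (if p = q then H0 $$ (i,j) * test_vec j q * cnj (test_vec i p) else 0)
           - complex_of_real (1/h) * (\<Sum>l<3. Hs!l $$ (i,j) * (Yw!l $$ (p,q) * test_vec j q * cnj (test_vec i p)))"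
          unfolding amplified_horodecki[OF phi(1) ij pq] w[OF pq(1)] w[OF pq(2)]
          by (simp add: left_diff_distrib sum_distrib_right mult.assoc)
      qed
      also have "\<dots> = (\<Sum>p<4. H0 $$ (i,j) * test_vec j p * cnj (test_vec i p))
          - complex_of_real (1/h) * (\<Sum>p<4. \<Sum>q<4. \<Sum>l<3. Hs!l $$ (i,j) * (Yw!l $$ (p,q) * test_vec j q * cnj (test_vec i p)))"
        by (simp add: sum_subtractf sum_distrib_left)
      also have "(\<Sum>p<4. \<Sum>q<4. \<Sum>l<3. Hs!l $$ (i,j) * (Yw!l $$ (p,q) * test_vec j q * cnj (test_vec i p)))
          = (\<Sum>l<3. \<Sum>p<4. \<Sum>q<4. Hs!l $$ (i,j) * (Yw!l $$ (p,q) * test_vec j q * cnj (test_vec i p)))"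
      proof -
        have "(\<Sum>p<4. \<Sum>q<4. \<Sum>l<3. Hs!l $$ (i,j) * (Yw!l $$ (p,q) * test_vec j q * cnj (test_vec i p))) = (\<Sum>p<4. \<Sum>l<3. \<Sum>q<4. Hs!l $$ (i,j) * (Yw!l $$ (p,q) * test_vec j q * cnj (test_vec i p)))"
          by (rule sum.cong[OF refl]) (rule sum.swap)
        also have "\<dots> = (\<Sum>l<3. \<Sum>p<4. \<Sum>q<4. Hs!l $$ (i,j) * (Yw!l $$ (p,q) * test_vec j q * cnj (test_vec i p)))" by (rule sum.swap)
        finally show ?thesis .
      qed
      finally show ?thesis by (simp add: ip_def act_def sum_distrib_left sum_distrib_right mult.assoc)
    qed
    then have "ip (4*4) (act (4*4) (amplify 4 4 4 phi horodecki) w) w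
      = (\<Sum>i<4. \<Sum>j<4. H0 $$ (i,j) * ip 4 (test_vec j) (test_vec i)
          - complex_of_real (1/h) * (\<Sum>l<3. Hs!l $$ (i,j) * ip 4 (act 4 (Yw!l) (test_vec j)) (test_vec i)))"
      unfolding ip_act_blocks by simp
    then show ?thesis
      unfolding sum_subtractf sum_distrib_left[symmetric] test_vec_value .
  qed
  \<comment> \<open>The value vanishes at h = 18 and is negative for the smaller h chosen
    here.\<close>
  ultimately have "0 \<le> 211/18 - 1/h * 211" by simp
  then show False using h(1,2) by (simp add: field_simps)
qed

theorem mainTheorem7:
  shows "Xof 2 C4 \<in> free_spec 4 F3 4 \<and> free_extreme 3 (free_spec 4 F3) 4 (Xof 2 C4) \<and>
         Xof 3 C6 \<in> free_spec 4 F3 6 \<and> free_extreme 3 (free_spec 4 F3) 6 (Xof 3 C6) \<and>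
         free_spec 4 F3 1 = lift1 ball3 \<and>
         \<not> is_min_mcs 3 ball3 (free_spec 4 F3) \<and>
         \<not> is_max_mcs 3 ball3 (matrix_range 4 F3)"
proof -
  have d4: "rank_one_defect (2*2) (corner C4a C4b D4 \<epsilon>) ((sqrt 3 - 1) / 6) (u4 \<epsilon>)" if "\<epsilon> \<in> {1,-1}" for \<epsilon>
    by (rule defect4[OF that])
  have d6: "rank_one_defect (2*3) (corner C6a C6b D6 \<epsilon>) (alpha6\<^sup>2 / 8) (u6 \<epsilon>)" if "\<epsilon> \<in> {1,-1}" for \<epsilon>
    by (rule defect6[OF that])
  have X4: "Xof 2 C4 \<in> free_spec 4 F3 4"
    using real_tuple_in_free_spec[OF realsym_C4 _ d4] unfolding C4_real_tuple by simp
  have X6: "Xof 3 C6 \<in> free_spec 4 F3 6"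
    using real_tuple_in_free_spec[OF realsym_C6 _ d6] unfolding C6_real_tuple by simp
  have "free_extreme 3 (free_spec 4 F3) 4 (Xof 2 C4)"
    using X4 C4_rigid C4_irreducible unfolding C4_real_tuple by (intro free_extremeI)
  moreover have "free_extreme 3 (free_spec 4 F3) 6 (Xof 3 C6)"
    using X6 C6_rigid C6_irreducible unfolding C6_real_tuple by (intro free_extremeI)
  moreover have "\<not> is_min_mcs 3 ball3 (free_spec 4 F3)"
    using not_minimal[of "Xof 2 C4" 4 ball3] X4 C4_rigid C4_irreducible unfolding C4_real_tuple by simp
  ultimately show ?thesis using X4 X6 free_spec_F3_level1 not_maximal by blast
qed

end
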